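(* Let $G$ be a polarizable Carnot group of homogeneous dimension $Q$ with homogeneous norm $N_G$ associated with Folland's fundamental solution of the Kohn sub-Laplacian, let $0<a<b$, and let $\Gamma=\Gamma(R_{ab};S_a,S_b)$ be the family of horizontal locally rectifiable curves connecting $S_a$ and $S_b$ in $R_{ab}$. Then for $p>1$, \[ M_p(\Gamma)=C_{S_1}(p)\,C_{ab}(p,Q)^{1-p},\qquad C_{S_1}(p)=\int_{S_1\setminus\mathcal Z}\lambda(\xi)^p\,dv(\xi),\qquad C_{ab}(p,Q)=\int_a^b s^{\frac{1-Q}{p-1}}\,ds . \]
   Context: A Carnot group $G$ is a connected simply connected Lie group with stratified nilpotent Lie algebra $\mathfrak g=V_1\oplus\dots\oplus V_l$, $[V_1,V_j]=V_{j+1}$, $V_{l+1}=0$; $V_1$ carries an inner product $\langle\cdot,\cdot\rangle_0$ with orthonormal basis $X_1,\dots,X_k$ of left-invariant (horizontal) vector fields, and $\|v\|_0^2=\langle v,v\rangle_0$ on horizontal vectors. Via exponential coordinates $G\cong\mathbb{R}^m$; the Haar measure $d\mathbf g$ is Lebesgue measure; $Q=\sum_i i\dim V_i$. The horizontal gradient is $\nabla_0 f=(X_1f,\dots,X_kf)$. $G$ is polarizable if, with $u_2$ the fundamental solution (smooth off $0$, homogeneous of degree $2-Q$) of the Kohn sub-Laplacian $\sum_iX_i^2$, the homogeneous norm $N_G=u_2^{1/(2-Q)}$ satisfies $\langle\nabla_0\|\nabla_0N_G\|_0^2,\nabla_0N_G\rangle_0=0$ away from $0$. Let $\mathcal Z=\{0\}\cup\{g\ne0:\nabla_0N_G(g)=0\}$,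 $S_r=\{N_G=r\}$, $R_{ab}=\{a<N_G<b\}$. The radial flow $\phi(s,g)$ solves $\partial_s\phi=\frac{N_G(\phi)}{s}\frac{\nabla_0N_G(\phi)}{\|\nabla_0N_G(\phi)\|_0^2}$, $\phi(1,g)=g$, on $G\setminus\mathcal Z$; it is horizontal, $N_G(\phi(s,\xi))=sN_G(\xi)$, and $\|\partial_s\phi(s,\xi)\|_0=\lambda(\xi)^{-1}$ is independent of $s$, where $\lambda(\xi)=\|\nabla_0N_G(\phi(s,\xi))\|_0/N_G(\xi)$. There is a unique Radon measure $v$ on $S_1\setminus\mathcal Z$ with $\int_Gf\,d\mathbf g=\int_{S_1\setminus\mathcal Z}\int_0^\infty f(\phi(s,\xi))s^{Q-1}\,ds\,dv(\xi)$ for $f\in L^1(G)$. A curve is horizontal if it is absolutely continuous with tangent in $\mathrm{span}\{X_i\}$ a.e.; its length element is $ds=\|\dot\gamma\|_0\,dt$. $M_p(\Gamma)=\inf\int_G\rho^p\,d\mathbf g$ over non-negative Borel $\rho$ with $\int_\gamma\rho\,ds\ge1$ for all $\gamma\in\Gamma$. *)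

theory Defs
  imports "HOL-Analysis.Analysis"
begin

definition dirD :: "'a::real_normed_vector \<Rightarrow> ('a \<Rightarrow> real) \<Rightarrow> 'a \<Rightarrow> real" where
  "dirD v f x = deriv (\<lambda>t::real. f (x + t *\<^sub>R v)) 0"

fun iterD :: "'a::real_normed_vector list \<Rightarrow> ('a \<Rightarrow> real) \<Rightarrow> 'a \<Rightarrow> real" where
  "iterD [] f = f"
| "iterD (v # vs) f = dirD v (iterD vs f)"

definition smooth_on :: "'a::real_normed_vector set \<Rightarrow> ('a \<Rightarrow> real) \<Rightarrow> bool" where
  "smooth_on U f \<longleftrightarrow> open U \<and>
     (\<forall>vs. continuous_on U (iterD vs f) \<and>
            (\<forall>v. \<forall>x\<in>U. (\<lambda>t::real. iterD vs f (x + t *\<^sub>R v)) differentiable (at 0)))"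

text \<open>Lie bracket read off from the group law in exponential coordinates:
  (tv)(tw)(tv)^{-1}(tw)^{-1} = t^2 [v,w] + O(t^3); inverse of x is -x.\<close>
definition bracket :: "('a::real_normed_vector \<Rightarrow> 'a \<Rightarrow> 'a) \<Rightarrow> 'a \<Rightarrow> 'a \<Rightarrow> 'a" where
  "bracket m v w = Lim (at (0::real))
     (\<lambda>t. (1 / t\<^sup>2) *\<^sub>R m (m (t *\<^sub>R v) (t *\<^sub>R w)) (m (- (t *\<^sub>R v)) (- (t *\<^sub>R w))))"

text \<open>m: group law on G = R^m in exponential coordinates (t \<mapsto> t v are the one-parameter
  subgroups); V i (1 \<le> i \<le> l): the layers of the stratification; xs: an orthonormal basis
  X_1..X_k of V_1 (this fixes the inner product on V_1).\<close>
definition carnot_group ::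
  "('a::euclidean_space \<Rightarrow> 'a \<Rightarrow> 'a) \<Rightarrow> (nat \<Rightarrow> 'a set) \<Rightarrow> nat \<Rightarrow> 'a list \<Rightarrow> bool" where
  "carnot_group m V l xs \<longleftrightarrow>
     (\<forall>x y z. m (m x y) z = m x (m y z)) \<and>
     (\<forall>x. m 0 x = x \<and> m x 0 = x) \<and>
     (\<forall>v s t. m (s *\<^sub>R v) (t *\<^sub>R v) = (s + t) *\<^sub>R v) \<and>
     (\<forall>b\<in>Basis. smooth_on UNIV (\<lambda>(x, y). m x y \<bullet> b)) \<and>
     1 \<le> l \<and>
     (\<forall>i\<in>{1..l}. subspace (V i)) \<and>
     span (\<Union>i\<in>{1..l}. V i) = UNIV \<and>
     (\<Sum>i=1..l. dim (V i)) = DIM('a) \<and>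
     (\<forall>j\<in>{1..l}. span {bracket m v w | v w. v \<in> V 1 \<and> w \<in> V j}
                    = (if j < l then V (Suc j) else {0})) \<and>
     distinct xs \<and> independent (set xs) \<and> span (set xs) = V 1"

definition hdim :: "(nat \<Rightarrow> 'a::euclidean_space set) \<Rightarrow> nat \<Rightarrow> nat" where
  "hdim V l = (\<Sum>i=1..l. i * dim (V i))"

definition dil :: "(nat \<Rightarrow> 'a::euclidean_space set) \<Rightarrow> nat \<Rightarrow> real \<Rightarrow> 'a \<Rightarrow> 'a" where
  "dil V l r = (THE f. linear f \<and> (\<forall>i\<in>{1..l}. \<forall>v\<in>V i. f v = r ^ i *\<^sub>R v))"

definition Xf :: "('a::real_normed_vector \<Rightarrow> 'a \<Rightarrow> 'a) \<Rightarrow> 'a \<Rightarrow> ('a \<Rightarrow> real) \<Rightarrow> 'a \<Rightarrow> real" where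
  "Xf m v f g = deriv (\<lambda>t::real. f (m g (t *\<^sub>R v))) 0"

definition hvec :: "('a::real_normed_vector \<Rightarrow> 'a \<Rightarrow> 'a) \<Rightarrow> 'a \<Rightarrow> 'a \<Rightarrow> 'a" where
  "hvec m g v = vector_derivative (\<lambda>t::real. m g (t *\<^sub>R v)) (at 0)"

definition hgrad_sq :: "('a::real_normed_vector \<Rightarrow> 'a \<Rightarrow> 'a) \<Rightarrow> 'a list \<Rightarrow> ('a \<Rightarrow> real) \<Rightarrow> 'a \<Rightarrow> real" where
  "hgrad_sq m xs f g = (\<Sum>i<length xs. (Xf m (xs ! i) f g)\<^sup>2)"

definition sublap :: "('a::real_normed_vector \<Rightarrow> 'a \<Rightarrow> 'a) \<Rightarrow> 'a list \<Rightarrow> ('a \<Rightarrow> real) \<Rightarrow> 'a \<Rightarrow> real" where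
  "sublap m xs f g = (\<Sum>i<length xs. Xf m (xs ! i) (Xf m (xs ! i) f) g)"

text \<open>u is the fundamental solution of the Kohn sub-Laplacian: smooth off 0, homogeneous of
  degree 2 - Q, and L u = - delta in the sense of distributions (so that u > 0).\<close>
definition fundamental_solution ::
  "('a::euclidean_space \<Rightarrow> 'a \<Rightarrow> 'a) \<Rightarrow> (nat \<Rightarrow> 'a set) \<Rightarrow> nat \<Rightarrow> 'a list \<Rightarrow> ('a \<Rightarrow> real) \<Rightarrow> bool" where
  "fundamental_solution m V l xs u \<longleftrightarrow>
     smooth_on (- {0}) u \<and>
     (\<forall>r>0. \<forall>x. x \<noteq> 0 \<longrightarrow> u (dil V l r x) = r powr (2 - real (hdim V l)) * u x) \<and>
     (\<forall>\<psi>. smooth_on UNIV \<psi> \<and> (\<exists>K. compact K \<and> (\<forall>x. x \<notin> K \<longrightarrow> \<psi> x = 0)) \<longrightarrow>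
          (\<integral>x. u x * sublap m xs \<psi> x \<partial>lborel) = - \<psi> 0)"

definition normG :: "real \<Rightarrow> ('a::real_normed_vector \<Rightarrow> real) \<Rightarrow> 'a \<Rightarrow> real" where
  "normG Q u x = (if x = 0 then 0 else u x powr (1 / (2 - Q)))"

definition polarizable :: "('a::real_normed_vector \<Rightarrow> 'a \<Rightarrow> 'a) \<Rightarrow> 'a list \<Rightarrow> ('a \<Rightarrow> real) \<Rightarrow> bool" where
  "polarizable m xs N \<longleftrightarrow>
     (\<forall>g. g \<noteq> 0 \<longrightarrow> (\<Sum>i<length xs. Xf m (xs ! i) (hgrad_sq m xs N) g * Xf m (xs ! i) N g) = 0)"

definition Zset :: "('a::real_normed_vector \<Rightarrow> 'a \<Rightarrow> 'a) \<Rightarrow> 'a list \<Rightarrow> ('a \<Rightarrow> real) \<Rightarrow> 'a set" where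
  "Zset m xs N = {0} \<union> {g. g \<noteq> 0 \<and> (\<forall>i<length xs. Xf m (xs ! i) N g = 0)}"

definition radial_flow ::
  "('a::real_normed_vector \<Rightarrow> 'a \<Rightarrow> 'a) \<Rightarrow> 'a list \<Rightarrow> ('a \<Rightarrow> real) \<Rightarrow> (real \<Rightarrow> 'a \<Rightarrow> 'a) \<Rightarrow> bool" where
  "radial_flow m xs N \<phi> \<longleftrightarrow>
     (\<forall>\<xi>. \<xi> \<notin> Zset m xs N \<longrightarrow>
        \<phi> 1 \<xi> = \<xi> \<and>
        (\<forall>s>0. \<phi> s \<xi> \<notin> Zset m xs N \<and>
           ((\<lambda>s. \<phi> s \<xi>) has_vector_derivative
              ((N (\<phi> s \<xi>) / (s * hgrad_sq m xs N (\<phi> s \<xi>))) *\<^sub>R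
                 (\<Sum>i<length xs. Xf m (xs ! i) N (\<phi> s \<xi>) *\<^sub>R hvec m (\<phi> s \<xi>) (xs ! i)))) (at s)))"

text \<open>\<lambda>(\<xi>) = \<parallel>\<nabla>_0 N(\<phi>(s,\<xi>))\<parallel>_0 / N(\<xi>), taken at s = 1.\<close>
definition lam :: "('a::real_normed_vector \<Rightarrow> 'a \<Rightarrow> 'a) \<Rightarrow> 'a list \<Rightarrow> ('a \<Rightarrow> real) \<Rightarrow> (real \<Rightarrow> 'a \<Rightarrow> 'a) \<Rightarrow> 'a \<Rightarrow> real" where
  "lam m xs N \<phi> \<xi> = sqrt (hgrad_sq m xs N (\<phi> 1 \<xi>)) / N \<xi>"

definition polar_measure ::
  "('a::euclidean_space \<Rightarrow> real) \<Rightarrow> 'a set \<Rightarrow> (real \<Rightarrow> 'a \<Rightarrow> 'a) \<Rightarrow> real \<Rightarrow> 'a measure \<Rightarrow> bool" where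
  "polar_measure N Z \<phi> Q v \<longleftrightarrow>
     sets v = sets (restrict_space lborel ({x. N x = 1} - Z)) \<and>
     (\<forall>\<xi>\<in>space v. \<exists>U. open U \<and> \<xi> \<in> U \<and> emeasure v (U \<inter> space v) < \<infinity>) \<and>
     (\<forall>f::'a \<Rightarrow> real. integrable lborel f \<longrightarrow>
        (\<integral>x. f x \<partial>lborel) =
        (\<integral>\<xi>. (LINT s:{0<..}|lborel. f (\<phi> s \<xi>) * s powr (Q - 1)) \<partial>v))"

definition abs_cont_on :: "real set \<Rightarrow> (real \<Rightarrow> 'a::real_normed_vector) \<Rightarrow> bool" where
  "abs_cont_on I \<gamma> \<longleftrightarrow>
     (\<forall>\<epsilon>>0. \<exists>\<delta>>0. \<forall>D::(real \<times> real) set.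
        finite D \<and> (\<forall>(s, t)\<in>D. s \<le> t \<and> {s..t} \<subseteq> I) \<and>
        (\<forall>(s, t)\<in>D. \<forall>(s', t')\<in>D. (s, t) \<noteq> (s', t') \<longrightarrow> {s<..<t} \<inter> {s'<..<t'} = {}) \<and>
        (\<Sum>(s, t)\<in>D. t - s) < \<delta>
        \<longrightarrow> (\<Sum>(s, t)\<in>D. norm (\<gamma> t - \<gamma> s)) < \<epsilon>)"

definition hcoef :: "('a::real_normed_vector \<Rightarrow> 'a \<Rightarrow> 'a) \<Rightarrow> 'a list \<Rightarrow> 'a \<Rightarrow> 'a \<Rightarrow> nat \<Rightarrow> real" where
  "hcoef m xs g w = (THE c. (\<forall>i\<ge>length xs. c i = 0) \<and>
                         w = (\<Sum>i<length xs. c i *\<^sub>R hvec m g (xs ! i)))"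

definition hnorm :: "('a::real_normed_vector \<Rightarrow> 'a \<Rightarrow> 'a) \<Rightarrow> 'a list \<Rightarrow> 'a \<Rightarrow> 'a \<Rightarrow> real" where
  "hnorm m xs g w = sqrt (\<Sum>i<length xs. (hcoef m xs g w i)\<^sup>2)"

definition horizontal_curve ::
  "('a::real_normed_vector \<Rightarrow> 'a \<Rightarrow> 'a) \<Rightarrow> 'a list \<Rightarrow> (real \<Rightarrow> 'a) \<Rightarrow> real \<Rightarrow> real \<Rightarrow> bool" where
  "horizontal_curve m xs \<gamma> \<alpha> \<beta> \<longleftrightarrow> \<alpha> < \<beta> \<and> abs_cont_on {\<alpha>..\<beta>} \<gamma> \<and>
     (AE t in lborel. t \<in> {\<alpha><..<\<beta>} \<longrightarrow>
        \<gamma> differentiable (at t) \<and>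
        vector_derivative \<gamma> (at t) \<in> span (hvec m (\<gamma> t) ` set xs))"

definition curve_int ::
  "('a::real_normed_vector \<Rightarrow> 'a \<Rightarrow> 'a) \<Rightarrow> 'a list \<Rightarrow> ('a \<Rightarrow> ennreal) \<Rightarrow> (real \<Rightarrow> 'a) \<Rightarrow> real \<Rightarrow> real \<Rightarrow> ennreal" where
  "curve_int m xs \<rho> \<gamma> \<alpha> \<beta> =
     (\<integral>\<^sup>+ t\<in>{\<alpha>..\<beta>}. \<rho> (\<gamma> t) * ennreal (hnorm m xs (\<gamma> t) (vector_derivative \<gamma> (at t))) \<partial>lborel)"

definition curve_family ::
  "('a::real_normed_vector \<Rightarrow> 'a \<Rightarrow> 'a) \<Rightarrow> 'a list \<Rightarrow> ('a \<Rightarrow> real) \<Rightarrow> real \<Rightarrow> real \<Rightarrow> ((real \<Rightarrow> 'a) \<times> real \<times> real) set" where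
  "curve_family m xs N a b =
     {(\<gamma>, \<alpha>, \<beta>). horizontal_curve m xs \<gamma> \<alpha> \<beta> \<and>
        curve_int m xs (\<lambda>_. 1) \<gamma> \<alpha> \<beta> < \<infinity> \<and>
        ((N (\<gamma> \<alpha>) = a \<and> N (\<gamma> \<beta>) = b) \<or> (N (\<gamma> \<alpha>) = b \<and> N (\<gamma> \<beta>) = a)) \<and>
        (\<forall>t\<in>{\<alpha><..<\<beta>}. a < N (\<gamma> t) \<and> N (\<gamma> t) < b)}"

definition epow :: "ennreal \<Rightarrow> real \<Rightarrow> ennreal" where
  "epow x p = (if x = \<infinity> then \<infinity> else ennreal (enn2real x powr p))"

definition modulus ::
  "('a::euclidean_space \<Rightarrow> 'a \<Rightarrow> 'a) \<Rightarrow> 'a list \<Rightarrow> real \<Rightarrow> ((real \<Rightarrow> 'a) \<times> real \<times> real) set \<Rightarrow> ennreal" where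
  "modulus m xs p \<Gamma> =
     (INF \<rho>\<in>{\<rho>. \<rho> \<in> borel_measurable borel \<and>
               (\<forall>(\<gamma>, \<alpha>, \<beta>)\<in>\<Gamma>. curve_int m xs \<rho> \<gamma> \<alpha> \<beta> \<ge> 1)}.
        \<integral>\<^sup>+ x. epow (\<rho> x) p \<partial>lborel)"

end

theory Submission
  imports Defs
begin

text \<open>
  Write \<open>q = (1 - Q) / (p - 1)\<close> and \<open>C\<close> for the integral of \<open>s powr q\<close> over \<open>[a, b]\<close>. The density
  \<open>\<sigma> = |grad N| N powr q / C\<close> on the ring is extremal. It is admissible because \<open>\<sigma> |\<gamma>'|\<close> dominates the
  derivative of \<open>\<Phi> (N \<gamma>) / C\<close>, where \<open>\<Phi>\<close> is an antiderivative of \<open>s powr q\<close>. Conversely an admissible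
  \<open>\<rho>\<close> has integral at least 1 along every radial curve, and the tangent inequality
  \<open>\<rho>\<^sup>p + (p - 1) \<sigma>\<^sup>p \<ge> p \<sigma>\<^sup>p\<^sup>-\<^sup>1 \<rho>\<close>, integrated in polar coordinates, shows that its energy is
  at least that of \<open>\<sigma>\<close>.

  All of this needs \<open>N\<close> to be smooth off 0, i.e. that the fundamental solution \<open>u\<close> has no zeros. Instead
  of the strong maximum principle we use the flow: as \<open>|grad N|\<close> is constant along a flow line, the
  line from \<open>0\<close> to \<open>x\<close> has length \<open>N / |grad N|\<close>, so \<open>|grad log N|\<close> is bounded on compact subsets of
  the complement of 0. By Gronwall the zero set of \<open>u\<close> is invariant under horizontal flows, hence
  under all left-invariant flows, hence open; but it is null by the polar formula.
\<close>

section \<open>Absolutely continuous functions and differential inequalities\<close>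

text \<open>The exponent \<open>q\<close> is dictated by the polar weight:
  \<open>(p - 1) * q + (Q - 1) = 0\<close> makes
  \<open>\<sigma> powr (p - 1) * s powr (Q - 1)\<close> constant along each flow line, so that
  pairing an admissible \<open>\<rho>\<close> with \<open>\<sigma> powr (p - 1)\<close> leaves the
  unweighted integral of \<open>\<rho>\<close> over radial curves, which admissibility bounds from
  below.

  The homogeneity of \<open>N\<close> along the flow and the constancy of |grad N| are derived, at
  first only where \<open>u\<close> is nonzero. The sign of \<open>u\<close> may vary there;
  \<open>powr\<close> depends only on the absolute value of its base, so \<open>N\<close> is still
  differentiable. The length bound has force because |u| grows like \<open>s powr (2 - Q)\<close> as
  \<open>s\<close> tends to 0, so a flow line must leave every set on which \<open>u\<close> is
  bounded.

  Invariance is harder in bracket directions than in horizontal ones: a commutator moves a point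
  only to second order, so the zero set is known to contain points close to the flow of a bracket,
  but not that flow itself. The tangency criterion \<open>subtangent_imp_loc_inv\<close> bridges
  this gap.\<close>

abbreviation nonoverlapping :: "real set \<Rightarrow> real \<Rightarrow> (real \<times> real) set \<Rightarrow> bool" where
  "nonoverlapping I \<delta> D \<equiv> finite D \<and> (\<forall>(s, t)\<in>D. s \<le> t \<and> {s..t} \<subseteq> I) \<and>
     (\<forall>(s, t)\<in>D. \<forall>(s', t')\<in>D. (s, t) \<noteq> (s', t') \<longrightarrow> {s<..<t} \<inter> {s'<..<t'} = {}) \<and>
     (\<Sum>(s, t)\<in>D. t - s) < \<delta>"

text \<open>The derivative may fail to exist on the null set \<open>E\<close>, so the gauge treats
  its points separately: intervals tagged in \<open>E\<close> are forced into an open set of measure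
  below \<delta>, where absolute continuity makes the increments of \<open>h\<close> small, while
  \<open>h'\<close> is 0 there and adds nothing to the Riemann sum. Intervals tagged elsewhere are
  handled by the definition of the derivative.\<close>

lemma abs_cont_on_FTC:
  fixes h :: "real \<Rightarrow> real"
  assumes "\<alpha> \<le> \<beta>" and ac: "abs_cont_on {\<alpha>..\<beta>} h" and E: "negligible E"
    and der: "\<And>t. t \<in> {\<alpha>..\<beta>} - E \<Longrightarrow> (h has_real_derivative h' t) (at t within {\<alpha>..\<beta>})"
    and zero: "\<And>t. t \<in> E \<Longrightarrow> h' t = 0"
  shows "(h' has_integral (h \<beta> - h \<alpha>)) {\<alpha>..\<beta>}"
  unfolding has_integral[of _ _ \<alpha> \<beta>, unfolded box_real]
proof (intro allI impI)
  fix e :: real assume e: "e > 0"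
  \<comment> \<open>Half of \<open>e\<close> is spread over the length of the interval; the summand
    1 covers the degenerate case \<open>\<alpha> = \<beta>\<close>.\<close>
  define e1 where "e1 = e / 2 / (\<beta> - \<alpha> + 1)"
  have e1: "e1 > 0" using e \<open>\<alpha> \<le> \<beta>\<close> by (simp add: e1_def)
  have "\<forall>x. \<exists>d>0. x \<in> {\<alpha>..\<beta>} - E \<longrightarrow>
         (\<forall>y\<in>{\<alpha>..\<beta>}. norm (y-x) < d \<longrightarrow> norm (h y - h x - (y-x) * h' x) \<le> e1 * norm (y-x))"
  proof
    fix x
    show "\<exists>d>0. x \<in> {\<alpha>..\<beta>} - E \<longrightarrow>
         (\<forall>y\<in>{\<alpha>..\<beta>}. norm (y-x) < d \<longrightarrow> norm (h y - h x - (y-x) * h' x) \<le> e1 * norm (y-x))"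
    proof (cases "x \<in> {\<alpha>..\<beta>} - E")
      case True
      from der[OF this] e1 show ?thesis
        unfolding has_field_derivative_def has_derivative_within_alt
        by (auto simp: mult.commute[of _ "h' x"])
    qed (auto intro: exI[of _ 1])
  qed
  then obtain d where d: "\<And>x. 0 < d x"
    "\<And>x y. \<lbrakk>x \<in> {\<alpha>..\<beta>} - E; y \<in> {\<alpha>..\<beta>}; norm (y-x) < d x\<rbrakk>
         \<Longrightarrow> norm (h y - h x - (y-x) * h' x) \<le> e1 * norm (y-x)"
    by metis
  obtain \<delta> where \<delta>: "\<delta> > 0" and ac1: "\<forall>D. nonoverlapping {\<alpha>..\<beta>} \<delta> D \<longrightarrow> (\<Sum>(s, t)\<in>D. norm (h t - h s)) < e / 2"
    using ac[unfolded abs_cont_on_def, THEN spec, THEN mp, OF half_gt_zero[OF e]] by (elim exE conjE)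
  note ac' = ac1[THEN spec, THEN mp, OF conjI[OF _ conjI[OF _ conjI]]]
  have "E \<in> sets lebesgue" by (simp add: E negligible_imp_sets)
  then obtain U where U: "open U" "E \<subseteq> U" "U - E \<in> lmeasurable" "emeasure lebesgue (U - E) < ennreal \<delta>"
    using sets_lebesgue_outer_open[of E \<delta>] \<delta> by auto
  have Um: "U \<in> lmeasurable" "measure lebesgue U < \<delta>"
  proof -
    have eq: "U = (U - E) \<union> E" using U by auto
    have "E \<in> lmeasurable" using E by (simp add: negligible_imp_measurable)
    then show m: "U \<in> lmeasurable" using U eq by (metis fmeasurable.Un)
    have "measure lebesgue (U - E) < \<delta>"
      using U(3,4) \<delta> by (simp add: emeasure_eq_measure2 ennreal_less_iff)
    moreover have "measure lebesgue U \<le> measure lebesgue (U - E) + measure lebesgue E"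
      using U(3) \<open>E \<in> lmeasurable\<close> by (subst eq, intro measure_Un_le) auto
    ultimately show "measure lebesgue U < \<delta>"
      using negligible_imp_measure0[OF E] by simp
  qed
  define g where "g = (\<lambda>x. if x \<in> E then U else ball x (d x))"
  show "\<exists>g. gauge g \<and> (\<forall>D. D tagged_division_of {\<alpha>..\<beta>} \<and> g fine D \<longrightarrow>
          norm ((\<Sum>(x, k)\<in>D. measure lborel k *\<^sub>R h' x) - (h \<beta> - h \<alpha>)) < e)"
  proof (intro exI conjI allI impI)
    show "gauge g"
      unfolding gauge_def g_def using d(1) U(1,2) by auto
    fix p assume "p tagged_division_of {\<alpha>..\<beta>} \<and> g fine p"
    then have ptag: "p tagged_division_of {\<alpha>..\<beta>}" and fin: "g fine p" by auto
    note pD = tagged_division_ofD[OF ptag]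
    define p1 where "p1 = {(x,K). (x,K) \<in> p \<and> x \<in> E}"
    define p2 where "p2 = {(x,K). (x,K) \<in> p \<and> x \<notin> E}"
    have pp: "p = p1 \<union> p2" "p1 \<inter> p2 = {}" "finite p1" "finite p2"
      using pD(1) by (auto simp: p1_def p2_def intro: finite_subset[of _ p])
    have KI: "\<exists>s t. s \<le> t \<and> K = {s..t} \<and> Sup K = t \<and> Inf K = s \<and> \<alpha> \<le> s \<and> t \<le> \<beta>" if "(x,K) \<in> p" for x K
    proof -
      from pD(4)[OF that] obtain s t where "K = {s..t}" by auto
      with pD(2,3)[OF that] show ?thesis by auto
    qed
    have ba: "h \<beta> - h \<alpha> = (\<Sum>(x,K)\<in>p. h(Sup K) - h(Inf K))" "\<beta> - \<alpha> = (\<Sum>(x,K)\<in>p. Sup K - Inf K)"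
      using additive_tagged_division_1[where f=h] additive_tagged_division_1[where f="\<lambda>x. x"] \<open>\<alpha> \<le> \<beta>\<close> ptag by auto
    have est2: "norm (\<Sum>(x,K)\<in>p2. measure lborel K *\<^sub>R h' x - (h(Sup K) - h(Inf K))) \<le> e1 * (\<beta> - \<alpha>)"
    proof -
      have "norm (\<Sum>(x,K)\<in>p2. measure lborel K *\<^sub>R h' x - (h(Sup K) - h(Inf K))) \<le> (\<Sum>(x,K)\<in>p2. e1 * (Sup K - Inf K))"
      proof (rule sum_norm_le, safe)
        fix x K assume xK: "(x,K) \<in> p2"
        then have xp: "(x,K) \<in> p" "x \<notin> E" by (auto simp: p2_def)
        from KI[OF xp(1)] obtain s t where st: "s \<le> t" "K = {s..t}" "Sup K = t" "Inf K = s" "\<alpha> \<le> s" "t \<le> \<beta>" by blast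
        have xK: "x \<in> {s..t}" using pD(2)[OF xp(1)] st by simp
        have "K \<subseteq> ball x (d x)" using fin xp unfolding fine_def g_def by fastforce
        then have b: "norm (s - x) < d x" "norm (t - x) < d x" using st by (auto simp: dist_real_def subset_iff)
        have "norm (h s - h x - (s-x) * h' x) \<le> e1 * norm (s-x)"
             "norm (h t - h x - (t-x) * h' x) \<le> e1 * norm (t-x)"
          using d(2)[of x s] d(2)[of x t] b xp(2) xK st by auto
        moreover have "measure lborel K *\<^sub>R h' x - (h t - h s) = (h s - h x - (s-x) * h' x) - (h t - h x - (t-x) * h' x)"
          using st by (simp add: algebra_simps)
        moreover have "norm (s-x) + norm (t-x) = t - s" using xK by auto
        ultimately have "norm (measure lborel K *\<^sub>R h' x - (h t - h s)) \<le> e1 * (t - s)"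
          unfolding real_norm_def by (smt (verit) distrib_left)
        then show "norm (measure lborel K *\<^sub>R h' x - (h (Sup K) - h (Inf K))) \<le> e1 * (Sup K - Inf K)"
          using st by simp
      qed
      also have "\<dots> \<le> (\<Sum>(x,K)\<in>p. e1 * (Sup K - Inf K))"
      proof (intro sum_mono2)
        fix b assume "b \<in> p - p2"
        then obtain x K where b: "b = (x,K)" "(x,K) \<in> p" by (cases b) auto
        from KI[OF b(2)] obtain s t where "s \<le> t" "Sup K = t" "Inf K = s" by blast
        then show "0 \<le> (case b of (x, K) \<Rightarrow> e1 * (Sup K - Inf K))" using b e1 by simp
      qed (auto simp: pp pD(1))
      also have "\<dots> = e1 * (\<beta> - \<alpha>)" unfolding ba(2) by (simp add: sum_distrib_left split_def)
      finally show ?thesis .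
    qed
    define F where "F = (\<lambda>(x::real,K::real set). (Inf K, Sup K))"
    have disj: "{s<..<t} \<inter> {s'<..<t'} = {}" if "(x,{s..t}) \<in> p" "(x',{s'..t'}) \<in> p" "(x,{s..t}) \<noteq> (x',{s'..t'})" for x x' s s' t t'
      using pD(5)[OF that] by (simp add: interior_atLeastAtMost_real)
    \<comment> \<open>\<open>abs_cont_on\<close> sums over a set of pairs, so no two tagged
      intervals may collapse to one pair. Equal intervals with disjoint interiors are single points,
      and then their tags agree as well.\<close>
    have inj: "inj_on F p1"
    proof (rule inj_onI, clarify)
      fix x K x' K' assume a: "(x,K) \<in> p1" "(x',K') \<in> p1" "F (x,K) = F (x',K')"
      then have p: "(x,K) \<in> p" "(x',K') \<in> p" by (auto simp: p1_def)
      from KI[OF p(1)] obtain s t where k: "K = {s..t}" "s \<le> t" by blast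
      from KI[OF p(2)] obtain s' t' where k': "K' = {s'..t'}" "s' \<le> t'" by blast
      have st: "K = {s..t}" "K' = {s..t}" "s \<le> t" using k k' a(3) by (auto simp: F_def)
      show "x = x' \<and> K = K'"
      proof (rule ccontr)
        assume neq: "\<not> ?thesis"
        then have "{s<..<t} \<inter> {s<..<t} = {}" using disj[of x s t x' s t] p st by auto
        then have "s = t" using st(3) by (simp add: not_less)
        then have "x = s" "x' = s" using pD(2)[OF p(1)] pD(2)[OF p(2)] st by auto
        then show False using neq st by auto
      qed
    qed
    have est1: "(\<Sum>(x,K)\<in>p1. norm (h(Sup K) - h(Inf K))) < e / 2"
    proof -
      have part: "p1 tagged_partial_division_of {\<alpha>..\<beta>}"
      proof (rule tagged_partial_division_subset)
        show "p tagged_partial_division_of {\<alpha>..\<beta>}" using ptag unfolding tagged_division_of_def by (rule conjunct1)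
        show "p1 \<subseteq> p" by (auto simp: p1_def)
      qed
      have dv: "(snd ` p1) division_of \<Union>(snd ` p1)"
        by (rule partial_division_of_tagged_division[OF part])
      \<comment> \<open>The total length is the measure of the union of the intervals, which the
        gauge keeps inside \<open>U\<close>.\<close>
      have "(\<Sum>(s, t)\<in>F ` p1. t - s) = (\<Sum>(x,K)\<in>p1. Sup K - Inf K)"
        by (subst sum.reindex[OF inj]) (simp add: F_def o_def split_def)
      also have "\<dots> = (\<Sum>(x,K)\<in>p1. measure lebesgue K)"
      proof (intro sum.cong refl, clarify)
        fix x K assume "(x,K) \<in> p1"
        then have "(x,K) \<in> p" by (auto simp: p1_def)
        from KI[OF this] obtain s t where "s \<le> t" "K = {s..t}" by blast
        then show "Sup K - Inf K = measure lebesgue K" by simp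
      qed
      also have "\<dots> = (\<Sum>K\<in>snd ` p1. measure lebesgue K)"
        using tagged_partial_division_of_Union_self[OF part]
        by (rule sum.over_tagged_division_lemma) (simp add: content_eq_0_interior)
      also have "\<dots> = measure lebesgue (\<Union>(snd ` p1))"
        by (rule content_division[OF dv])
      also have "\<dots> \<le> measure lebesgue U"
      proof (rule measure_mono_fmeasurable)
        show "\<Union>(snd ` p1) \<subseteq> U"
        proof -
          have "K \<subseteq> U" if "(x,K) \<in> p1" for x K
          proof -
            from that have "(x,K) \<in> p" "x \<in> E" by (auto simp: p1_def)
            then show ?thesis using fineD[OF fin, of x K] by (auto simp: g_def)
          qed
          then show ?thesis by fastforce
        qed
        show "\<Union>(snd ` p1) \<in> sets lebesgue"
          using dv by (metis fmeasurableD lmeasurable_division)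
      qed (rule Um)
      finally have less: "(\<Sum>(s, t)\<in>F ` p1. t - s) < \<delta>" using Um by simp
      have "(\<Sum>(s, t)\<in>F ` p1. norm (h t - h s)) < e / 2"
      proof (rule ac'[OF _ _ _ less])
        show "finite (F ` p1)" using pp by simp
        show "\<forall>(s, t)\<in>F ` p1. s \<le> t \<and> {s..t} \<subseteq> {\<alpha>..\<beta>}"
        proof clarify
          fix s t x K assume st: "(s,t) = F (x,K)" "(x,K) \<in> p1"
          then have "(x,K) \<in> p" by (auto simp: p1_def)
          from KI[OF this] obtain s' t' where "s' \<le> t'" "K = {s'..t'}" "\<alpha> \<le> s'" "t' \<le> \<beta>" by blast
          with st show "s \<le> t \<and> {s..t} \<subseteq> {\<alpha>..\<beta>}" by (simp add: F_def)
        qed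
        show "\<forall>(s, t)\<in>F ` p1. \<forall>(s', t')\<in>F ` p1. (s, t) \<noteq> (s', t') \<longrightarrow> {s<..<t} \<inter> {s'<..<t'} = {}"
        proof -
          have "{s<..<t} \<inter> {s'<..<t'} = {}" if st: "(s,t) \<in> F ` p1" "(s',t') \<in> F ` p1" "(s,t) \<noteq> (s',t')" for s t s' t'
          proof -
            from st obtain x K x' K' where k: "(s,t) = F (x,K)" "(x,K) \<in> p1" "(s',t') = F (x',K')" "(x',K') \<in> p1"
              by auto
            then have p: "(x,K) \<in> p" "(x',K') \<in> p" by (auto simp: p1_def)
            from KI[OF p(1)] KI[OF p(2)] k have "K = {s..t}" "K' = {s'..t'}" by (simp_all add: F_def)
            moreover have "(x,K) \<noteq> (x',K')" using k st(3) by metis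
            ultimately show ?thesis using disj p by blast
          qed
          then show ?thesis by blast
        qed
      qed
      then show ?thesis
        by (subst (asm) sum.reindex[OF inj]) (simp add: F_def o_def split_def)
    qed
    have z1: "(\<Sum>(x,K)\<in>p1. measure lborel K *\<^sub>R h' x - (h(Sup K) - h(Inf K))) = - (\<Sum>(x,K)\<in>p1. (h(Sup K) - h(Inf K)))"
      unfolding sum_negf[symmetric] by (rule sum.cong) (auto simp: p1_def zero)
    have "(\<Sum>(x, k)\<in>p. measure lborel k *\<^sub>R h' x) - (h \<beta> - h \<alpha>) = (\<Sum>(x,K)\<in>p. measure lborel K *\<^sub>R h' x - (h(Sup K) - h(Inf K)))"
      unfolding ba by (simp add: sum_subtractf split_def)
    also have "\<dots> = (\<Sum>(x,K)\<in>p1. measure lborel K *\<^sub>R h' x - (h(Sup K) - h(Inf K))) + (\<Sum>(x,K)\<in>p2. measure lborel K *\<^sub>R h' x - (h(Sup K) - h(Inf K)))"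
      unfolding pp(1) using pp by (intro sum.union_disjoint) auto
    finally have "norm ((\<Sum>(x, k)\<in>p. measure lborel k *\<^sub>R h' x) - (h \<beta> - h \<alpha>)) \<le>
        norm (\<Sum>(x,K)\<in>p1. (h(Sup K) - h(Inf K))) + e1 * (\<beta> - \<alpha>)"
      using est2 unfolding z1 real_norm_def by arith
    also have "norm (\<Sum>(x,K)\<in>p1. (h(Sup K) - h(Inf K))) \<le> (\<Sum>(x,K)\<in>p1. norm (h(Sup K) - h(Inf K)))"
      by (rule order_trans[OF norm_sum]) (simp add: split_def)
    also have "e1 * (\<beta> - \<alpha>) \<le> e / 2"
      using \<open>\<alpha> \<le> \<beta>\<close> e by (simp add: e1_def field_simps)
    finally show "norm ((\<Sum>(x, k)\<in>p. measure lborel k *\<^sub>R h' x) - (h \<beta> - h \<alpha>)) < e"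
      using est1 by simp
  qed
qed

lemma abs_cont_on_imp_continuous_on:
  fixes h :: "real \<Rightarrow> 'a::real_normed_vector"
  assumes "abs_cont_on {\<alpha>..\<beta>} h"
  shows "continuous_on {\<alpha>..\<beta>} h"
  unfolding continuous_on_iff
proof (intro ballI allI impI)
  fix x e :: real assume x: "x \<in> {\<alpha>..\<beta>}" and e: "e > 0"
  obtain d where d: "d > 0" and D: "\<forall>D::(real \<times> real) set.
        nonoverlapping {\<alpha>..\<beta>} d D \<longrightarrow> (\<Sum>(s, t)\<in>D. norm (h t - h s)) < e"
    using assms[unfolded abs_cont_on_def, THEN spec, THEN mp, OF e] by (elim exE conjE)
  have "dist (h y) (h x) < e" if y: "y \<in> {\<alpha>..\<beta>}" "dist y x < d" for y
  proof -
    have "norm (h (max x y) - h (min x y)) < e"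
      using D[THEN spec, of "{(min x y, max x y)}"] x y by (auto simp: dist_real_def)
    then show ?thesis by (auto simp: dist_norm max_def min_def norm_minus_commute split: if_splits)
  qed
  with d show "\<exists>d>0. \<forall>x'\<in>{\<alpha>..\<beta>}. dist x' x < d \<longrightarrow> dist (h x') (h x) < e" by blast
qed

text \<open>Serves to bound a curve integral from below by an increment. Since \<open>g\<close> is
  arbitrary, all measurability must come from the derivative, which is a pointwise limit of
  difference quotients of a continuous function.\<close>

lemma abs_cont_on_nn_integral_ge:
  fixes h h' :: "real \<Rightarrow> real" and g :: "real \<Rightarrow> ennreal"
  assumes ab: "\<alpha> < \<beta>" and ac: "abs_cont_on {\<alpha>..\<beta>} h"
    and ae: "AE t in lborel. t \<in> {\<alpha><..<\<beta>} \<longrightarrow> (h has_real_derivative h' t) (at t) \<and> ennreal \<bar>h' t\<bar> \<le> g t"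
  shows "ennreal \<bar>h \<beta> - h \<alpha>\<bar> \<le> (\<integral>\<^sup>+ t\<in>{\<alpha>..\<beta>}. g t \<partial>lborel)"
proof -
  from AE_E[OF ae] obtain E0 where E0: "{t \<in> space lborel. \<not> (t \<in> {\<alpha><..<\<beta>} \<longrightarrow> (h has_real_derivative h' t) (at t) \<and> ennreal \<bar>h' t\<bar> \<le> g t)} \<subseteq> E0"
    "emeasure lborel E0 = 0" "E0 \<in> sets lborel" by blast
  \<comment> \<open>The endpoints join the exceptional set because the hypothesis speaks of the open
    interval only.\<close>
  define E where "E = E0 \<union> {\<alpha>, \<beta>}"
  have "E0 \<in> null_sets lborel" using E0 by auto
  then have "E0 \<in> null_sets lebesgue" by (simp add: null_sets_completionI)
  then have nE: "negligible E" by (simp add: E_def negligible_iff_null_sets[symmetric])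
  have Es: "E \<in> sets borel" using E0(3) by (simp add: E_def)
  have good: "(h has_real_derivative h' t) (at t)" "ennreal \<bar>h' t\<bar> \<le> g t" "\<alpha> < t" "t < \<beta>" if "t \<in> {\<alpha>..\<beta>} - E" for t
  proof -
    from that have t: "\<alpha> < t" "t < \<beta>" "t \<notin> E0" by (auto simp: E_def)
    then show "\<alpha> < t" "t < \<beta>" by auto
    from t E0(1) have "(h has_real_derivative h' t) (at t) \<and> ennreal \<bar>h' t\<bar> \<le> g t" by auto
    then show "(h has_real_derivative h' t) (at t)" "ennreal \<bar>h' t\<bar> \<le> g t" by auto
  qed
  define D where "D = (\<lambda>t. if t \<in> {\<alpha>..\<beta>} - E then h' t else 0)"
  have hi: "(D has_integral (h \<beta> - h \<alpha>)) {\<alpha>..\<beta>}"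
  proof (rule abs_cont_on_FTC[OF _ ac nE])
    fix t assume "t \<in> {\<alpha>..\<beta>} - E"
    then show "(h has_real_derivative D t) (at t within {\<alpha>..\<beta>})"
      using good(1) by (auto simp: D_def intro: has_field_derivative_at_within)
  qed (use ab in \<open>auto simp: D_def\<close>)
  \<comment> \<open>Extending \<open>h\<close> by its boundary values makes the difference quotients
    continuous on the whole line, hence Borel.\<close>
  define hc where "hc = (\<lambda>t. h (max \<alpha> (min \<beta> t)))"
  have hc: "continuous_on UNIV hc"
    unfolding hc_def using ab
    by (intro continuous_on_compose2[OF abs_cont_on_imp_continuous_on[OF ac]] continuous_intros) auto
  have Dm: "D \<in> borel_measurable borel"
  proof (rule borel_measurable_LIMSEQ_real)
    fix i :: nat
    have [measurable]: "hc \<in> borel_measurable borel" using hc by (rule borel_measurable_continuous_onI)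
    show "(\<lambda>t. indicator ({\<alpha>..\<beta>} - E) t * (real (Suc i) * (hc (t + 1 / real (Suc i)) - hc t))) \<in> borel_measurable borel"
      using Es by measurable
  next
    fix t :: real
    show "(\<lambda>i. indicator ({\<alpha>..\<beta>} - E) t * (real (Suc i) * (hc (t + 1 / real (Suc i)) - hc t))) \<longlonglongrightarrow> D t"
    proof (cases "t \<in> {\<alpha>..\<beta>} - E")
      case True
      note gd = good[OF True]
      have "(hc has_real_derivative h' t) (at t)"
      proof (rule DERIV_cong_ev[THEN iffD1, OF refl _ refl gd(1)])
        have "eventually (\<lambda>x. x \<in> {\<alpha><..<\<beta>}) (nhds t)"
          using gd by (intro eventually_nhds_in_open) auto
        then show "\<forall>\<^sub>F x in nhds t. h x = hc x"
          by eventually_elim (auto simp: hc_def)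
      qed
      then have lim: "((\<lambda>d. (hc (t + d) - hc t) / d) \<longlongrightarrow> h' t) (at 0)"
        by (simp add: DERIV_def)
      have "filterlim (\<lambda>i. 1 / real (Suc i)) (at 0) sequentially"
        unfolding filterlim_at using LIMSEQ_inverse_real_of_nat
        by (simp add: eventually_sequentially inverse_eq_divide)
      from filterlim_compose[OF lim this]
      have "(\<lambda>i. real (Suc i) * (hc (t + 1 / real (Suc i)) - hc t)) \<longlonglongrightarrow> h' t"
        by (simp add: mult.commute)
      then show ?thesis using True by (simp add: D_def)
    qed (auto simp: D_def)
  qed
  have le: "(\<integral>\<^sup>+ t. ennreal \<bar>D t\<bar> \<partial>lborel) \<le> (\<integral>\<^sup>+ t\<in>{\<alpha>..\<beta>}. g t \<partial>lborel)"
    by (rule nn_integral_mono) (auto simp: D_def good(2) split: split_indicator)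
  \<comment> \<open>An infinite bound is trivial; a finite one makes \<open>D\<close> Lebesgue
    integrable, and then its gauge integral is its Lebesgue integral.\<close>
  show ?thesis
  proof (cases "(\<integral>\<^sup>+ t. ennreal \<bar>D t\<bar> \<partial>lborel) = \<infinity>")
    case True
    then show ?thesis using le by (simp add: top_unique)
  next
    case False
    have int: "integrable lborel D"
      using Dm False by (intro integrableI_bounded) (auto simp: less_top)
    have "(D has_integral (integral\<^sup>L lborel D)) UNIV"
      by (rule has_integral_integral_lborel[OF int])
    moreover have "(D has_integral (h \<beta> - h \<alpha>)) UNIV"
    proof -
      have "D = (\<lambda>t. if t \<in> {\<alpha>..\<beta>} then D t else 0)" by (auto simp: D_def)
      then show ?thesis using hi has_integral_restrict_UNIV[of "{\<alpha>..\<beta>}" D] by metis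
    qed
    ultimately have eq: "h \<beta> - h \<alpha> = integral\<^sup>L lborel D" by (metis has_integral_unique)
    have "ennreal \<bar>h \<beta> - h \<alpha>\<bar> \<le> (\<integral>\<^sup>+ t. ennreal \<bar>D t\<bar> \<partial>lborel)"
      unfolding eq using integral_norm_bound_ennreal[OF int] by simp
    with le show ?thesis by (rule order_trans[rotated])
  qed
qed

text \<open>Multiplying the square of \<open>f\<close> by \<open>exp (- (2 * M * t))\<close> gives a
  nonincreasing function that starts at 0; squaring removes the sign of \<open>f\<close> from the
  estimate.\<close>

lemma DERIV_abs_le_imp_zero:
  fixes f f' :: "real \<Rightarrow> real"
  assumes der: "\<And>t. t \<in> {0..r} \<Longrightarrow> (f has_real_derivative f' t) (at t)"
    and le: "\<And>t. t \<in> {0..r} \<Longrightarrow> \<bar>f' t\<bar> \<le> M * \<bar>f t\<bar>" and "f 0 = 0" and t: "t \<in> {0..r}"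
  shows "f t = 0"
proof -
  define k where "k = (\<lambda>t. (f t)\<^sup>2 * exp (- (2 * M * t)))"
  have "k t \<le> k 0"
  proof (rule DERIV_nonpos_imp_nonincreasing[of 0 t k])
    fix s assume s: "0 \<le> s" "s \<le> t"
    then have sr: "s \<in> {0..r}" using t by auto
    have d: "(k has_real_derivative (2 * (f s * f' s) - 2 * M * (f s)\<^sup>2) * exp (- (2 * M * s))) (at s)"
      unfolding k_def by (rule derivative_eq_intros der[OF sr] refl)+ (simp add: algebra_simps)
    have "f s * f' s \<le> \<bar>f s\<bar> * \<bar>f' s\<bar>" by (metis abs_ge_self abs_mult)
    also have "\<dots> \<le> \<bar>f s\<bar> * (M * \<bar>f s\<bar>)" using le[OF sr] by (simp add: mult_left_mono)
    also have "\<dots> = M * (f s)\<^sup>2" by (simp add: power2_eq_square)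
    finally have "(2 * (f s * f' s) - 2 * M * (f s)\<^sup>2) * exp (- (2 * M * s)) \<le> 0"
      by (intro mult_nonpos_nonneg) auto
    with d show "\<exists>y. (k has_real_derivative y) (at s) \<and> y \<le> 0" by blast
  qed (use t in auto)
  then have "(f t)\<^sup>2 * exp (- (2 * M * t)) \<le> 0" using assms(3) by (simp add: k_def)
  then show ?thesis by (simp add: mult_le_0_iff)
qed

text \<open>A Gronwall inequality for functions with only a one-sided upper difference bound, such
  as the distance from a moving point to a closed set. At the last moment when \<open>f\<close> lies
  below an exponential barrier, the one-step bound carries it below the barrier a little
  longer.\<close>

lemma Dini_Gronwall:
  fixes f :: "real \<Rightarrow> real"
  assumes cont: "continuous_on {0..r} f" and "f 0 = 0" and L: "L \<ge> 0"
    and dini: "\<And>t \<epsilon>. t \<in> {0..<r} \<Longrightarrow> \<epsilon> > 0 \<Longrightarrow> \<exists>\<delta>>0. \<forall>h. 0 < h \<and> h < \<delta> \<longrightarrow> f (t + h) \<le> f t + h * (L * f t + \<epsilon>)"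
    and t: "t \<in> {0..r}"
  shows "f t \<le> 0"
proof (rule ccontr)
  assume "\<not> f t \<le> 0"
  then have ft: "f t > 0" by simp
  \<comment> \<open>Chosen so that the barrier equals \<open>f t / 2\<close> at time
    \<open>t\<close>. Its rate \<open>L + 1\<close> exceeds \<open>L\<close> by 1 to absorb the
    error \<epsilon>, which never exceeds the barrier.\<close>
  define \<epsilon> where "\<epsilon> = f t / (2 * exp ((L + 1) * t))"
  have e: "\<epsilon> > 0" using ft by (simp add: \<epsilon>_def)
  define g where "g = (\<lambda>s. \<epsilon> * exp ((L + 1) * s))"
  have gt: "g t < f t" using ft by (simp add: g_def \<epsilon>_def)
  define K where "K = {s \<in> {0..t}. f s \<le> g s}"
  have "closed {s \<in> {0..t}. f s \<le> g s}"
    using t by (intro continuous_on_closed_Collect_le continuous_on_subset[OF cont]) (auto simp: g_def intro!: continuous_intros)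
  moreover have "bounded K" unfolding K_def by (rule bounded_subset[of "{0..t}"]) auto
  ultimately have "compact K" by (simp add: K_def compact_eq_bounded_closed)
  moreover have "0 \<in> K" using t e assms(2) by (simp add: K_def g_def)
  ultimately obtain c where c: "c \<in> K" "\<And>s. s \<in> K \<Longrightarrow> s \<le> c"
    using compact_attains_sup[of K] by blast
  have ct: "c < t" "0 \<le> c" "f c \<le> g c" using c(1) gt by (auto simp: K_def less_le)
  from dini[of c \<epsilon>] ct t e obtain \<delta> where \<delta>: "\<delta> > 0" "\<And>h. 0 < h \<Longrightarrow> h < \<delta> \<Longrightarrow> f (c + h) \<le> f c + h * (L * f c + \<epsilon>)"
    by auto
  define h where "h = min (\<delta> / 2) (t - c)"
  have h: "0 < h" "h < \<delta>" "c + h \<le> t" using \<delta> ct by (auto simp: h_def)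
  have gc: "\<epsilon> \<le> g c" using e ct L by (simp add: g_def)
  have "f (c + h) \<le> f c + h * (L * f c + \<epsilon>)" using \<delta> h by blast
  also have "\<dots> \<le> g c + h * (L * g c + g c)"
    using ct h L gc by (intro add_mono mult_left_mono) auto
  also have "\<dots> = g c * (1 + (L + 1) * h)" by (simp add: algebra_simps)
  also have "\<dots> \<le> g c * exp ((L + 1) * h)"
    using e gc by (intro mult_left_mono exp_ge_add_one_self) auto
  also have "\<dots> = g (c + h)" by (simp add: g_def exp_add distrib_left)
  finally have "c + h \<in> K" using h ct by (simp add: K_def)
  from c(2)[OF this] h show False by simp
qed

section \<open>Smooth functions\<close>

lemma iterD_append: "iterD (vs @ ws) f = iterD vs (iterD ws f)"
  by (induction vs) auto

lemma smooth_on_dirD: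
  assumes "smooth_on U f"
  shows "smooth_on U (dirD v f)"
  unfolding smooth_on_def
proof (intro conjI allI ballI)
  fix vs
  have eq: "iterD vs (dirD v f) = iterD (vs @ [v]) f" by (simp add: iterD_append)
  show "continuous_on U (iterD vs (dirD v f))"
    unfolding eq using assms by (simp add: smooth_on_def)
  show "(\<lambda>t::real. iterD vs (dirD v f) (x + t *\<^sub>R w)) differentiable (at 0)" if "x \<in> U" for w x
    unfolding eq using assms that by (simp add: smooth_on_def)
qed (use assms in \<open>simp add: smooth_on_def\<close>)

lemma smooth_on_continuous_on: "smooth_on U f \<Longrightarrow> continuous_on U f"
  unfolding smooth_on_def by (metis iterD.simps(1))

lemma smooth_on_open: "smooth_on U f \<Longrightarrow> open U"
  by (simp add: smooth_on_def)

lemma smooth_on_DERIV_line: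
  assumes f: "smooth_on U f" and x: "x + s *\<^sub>R v \<in> U"
  shows "((\<lambda>t. f (x + t *\<^sub>R v)) has_real_derivative dirD v f (x + s *\<^sub>R v)) (at s)"
proof -
  have "(\<lambda>t::real. f ((x + s *\<^sub>R v) + t *\<^sub>R v)) differentiable (at 0)"
    using f x unfolding smooth_on_def by (metis iterD.simps(1))
  then have "((\<lambda>t::real. f ((x + s *\<^sub>R v) + t *\<^sub>R v)) has_real_derivative dirD v f (x + s *\<^sub>R v)) (at 0)"
    unfolding dirD_def by (simp add: DERIV_deriv_iff_real_differentiable)
  then show ?thesis
    using DERIV_shift[of "\<lambda>t. f (x + t *\<^sub>R v)" _ 0 s] by (simp add: algebra_simps)
qed

text \<open>\<open>smooth_on\<close> only speaks of directional derivatives. Continuity of the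
  partial derivatives upgrades them to a Frechet derivative: coordinates are switched on one at a
  time, and the mean value theorem along the new axis bounds each increment.\<close>

lemma smooth_on_has_derivative:
  fixes f :: "'a::euclidean_space \<Rightarrow> real"
  assumes f: "smooth_on U f" and x: "x \<in> U"
  shows "(f has_derivative (\<lambda>h. \<Sum>b\<in>Basis. (h \<bullet> b) * dirD b f x)) (at x)"
proof -
  have "((\<lambda>h. f (x + (\<Sum>b\<in>S. (h \<bullet> b) *\<^sub>R b))) has_derivative (\<lambda>h. \<Sum>b\<in>S. (h \<bullet> b) * dirD b f x)) (at 0)"
    if "finite S" "S \<subseteq> Basis" for S :: "'a set"
    using that
  proof (induction S)
    case empty
    show ?case by (simp add: has_derivative_const)
  next
    case (insert c S)
    define P where "P = (\<lambda>h. \<Sum>b\<in>S. (h \<bullet> b) *\<^sub>R b)"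
    define R where "R = (\<lambda>h. f (x + P h + (h \<bullet> c) *\<^sub>R c) - f (x + P h))"
    have P0: "P 0 = 0" by (simp add: P_def)
    have c1: "norm c = 1" using insert by auto
    have nP: "norm (P h) \<le> card S * norm h" for h
    proof -
      have "norm (P h) \<le> (\<Sum>b\<in>S. norm h)" unfolding P_def
        using insert by (intro sum_norm_le) (auto simp: subset_iff intro: Basis_le_norm)
      then show ?thesis by simp
    qed
    have "(R has_derivative (\<lambda>h. (h \<bullet> c) * dirD c f x)) (at 0)"
      unfolding has_derivative_at_alt
    proof (intro conjI allI impI)
      show "bounded_linear (\<lambda>h. (h \<bullet> c) * dirD c f x)"
        by (intro bounded_linear_intros)
      fix e :: real assume e: "e > 0"
      have "continuous_on U (dirD c f)" by (rule smooth_on_continuous_on[OF smooth_on_dirD[OF f]])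
      then have "isCont (dirD c f) x" using x smooth_on_open[OF f] by (simp add: continuous_on_eq_continuous_at)
      then obtain r1 where r1: "r1 > 0" "\<And>z. dist z x < r1 \<Longrightarrow> dist (dirD c f z) (dirD c f x) < e"
        using e unfolding continuous_at_eps_delta by blast
      obtain r2 where r2: "r2 > 0" "ball x r2 \<subseteq> U" using smooth_on_open[OF f] x open_contains_ball by blast
      define r where "r = min r1 r2"
      have r: "r > 0" "ball x r \<subseteq> U" "\<And>z. z \<in> ball x r \<Longrightarrow> \<bar>dirD c f z - dirD c f x\<bar> \<le> e"
        using r1 r2 by (auto simp: r_def dist_commute dist_real_def less_imp_le)
      \<comment> \<open>All points met have offset at most \<open>(card S + 1) * norm y\<close> from
        \<open>x\<close>: up to \<open>card S * norm y\<close> from the old coordinates and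
        \<open>norm y\<close> from the new one.\<close>
      define d where "d = r / (card S + 1)"
      have d: "d > 0" using r by (simp add: d_def)
      have "norm (R y - R 0 - (y - 0) \<bullet> c * dirD c f x) \<le> e * norm (y - 0)" if y: "norm (y - 0) < d" for y
      proof -
        define k where "k = (\<lambda>t. f ((x + P y) + t *\<^sub>R c) - t * dirD c f x)"
        have inb: "(x + P y) + t *\<^sub>R c \<in> ball x r" if t: "t \<in> closed_segment 0 (y \<bullet> c)" for t
        proof -
          have "\<bar>t\<bar> \<le> \<bar>y \<bullet> c\<bar>" using t by (auto simp: closed_segment_eq_real_ivl split: if_splits)
          also have "\<dots> \<le> norm y" using insert by (auto intro: Basis_le_norm)
          finally have "norm (P y + t *\<^sub>R c) \<le> card S * norm y + norm y"
            using nP[of y] c1 by (intro order_trans[OF norm_triangle_ineq] add_mono) auto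
          also have "\<dots> = (card S + 1) * norm y" by (simp add: algebra_simps)
          also have "\<dots> < r" using y by (simp add: d_def field_simps)
          finally show ?thesis
            using norm_minus_cancel[of "P y + t *\<^sub>R c"] by (simp add: dist_norm algebra_simps)
        qed
        have "norm (k (y \<bullet> c) - k 0) \<le> e * norm (y \<bullet> c - 0)"
        proof (rule field_differentiable_bound)
          fix t assume t: "t \<in> closed_segment 0 (y \<bullet> c)"
          have "((\<lambda>t. f ((x + P y) + t *\<^sub>R c)) has_real_derivative dirD c f ((x + P y) + t *\<^sub>R c)) (at t)"
            using inb[OF t] r(2) by (intro smooth_on_DERIV_line[OF f]) auto
          then have "(k has_real_derivative dirD c f ((x + P y) + t *\<^sub>R c) - dirD c f x) (at t)"
            unfolding k_def by (auto intro!: derivative_eq_intros)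
          then show "(k has_field_derivative dirD c f ((x + P y) + t *\<^sub>R c) - dirD c f x) (at t within closed_segment 0 (y \<bullet> c))"
            by (rule has_field_derivative_at_within)
          show "norm (dirD c f ((x + P y) + t *\<^sub>R c) - dirD c f x) \<le> e" using r(3)[OF inb[OF t]] by simp
        qed auto
        also have "\<dots> \<le> e * norm y"
          using insert e by (intro mult_left_mono) (auto intro: Basis_le_norm)
        finally show ?thesis by (simp add: R_def P0 k_def algebra_simps)
      qed
      with d show "\<exists>d>0. \<forall>y. norm (y - 0) < d \<longrightarrow> norm (R y - R 0 - (y - 0) \<bullet> c * dirD c f x) \<le> e * norm (y - 0)"
        by blast
    qed
    moreover have "((\<lambda>h. f (x + P h)) has_derivative (\<lambda>h. \<Sum>b\<in>S. (h \<bullet> b) * dirD b f x)) (at 0)"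
      using insert by (simp add: P_def)
    ultimately have "((\<lambda>h. R h + f (x + P h)) has_derivative (\<lambda>h. (h \<bullet> c) * dirD c f x + (\<Sum>b\<in>S. (h \<bullet> b) * dirD b f x))) (at 0)"
      by (rule has_derivative_add)
    moreover have "R h + f (x + P h) = f (x + (\<Sum>b\<in>insert c S. (h \<bullet> b) *\<^sub>R b))" for h
      using insert by (simp add: R_def P_def add_ac)
    ultimately show ?case using insert by simp
  qed
  from this[of Basis] have "((\<lambda>h. f (x + h)) has_derivative (\<lambda>h. \<Sum>b\<in>Basis. (h \<bullet> b) * dirD b f x)) (at 0)"
    by (simp add: euclidean_representation)
  then show ?thesis
    unfolding has_derivative_at by simp
qed

lemma smooth_on_dirD_eq_sum:
  fixes f :: "'a::euclidean_space \<Rightarrow> real"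
  assumes f: "smooth_on U f" and x: "x \<in> U"
  shows "dirD v f x = (\<Sum>b\<in>Basis. (v \<bullet> b) * dirD b f x)"
proof -
  have "((\<lambda>t. f (x + t *\<^sub>R v)) has_real_derivative dirD v f x) (at 0)"
    using smooth_on_DERIV_line[OF f, of x 0 v] x by simp
  moreover have "((\<lambda>t. f (x + t *\<^sub>R v)) has_derivative (\<lambda>t. \<Sum>b\<in>Basis. ((t *\<^sub>R v) \<bullet> b) * dirD b f x)) (at 0)"
  proof (rule has_derivative_compose[of "\<lambda>t. x + t *\<^sub>R v" "\<lambda>t. t *\<^sub>R v"])
    show "((\<lambda>t. x + t *\<^sub>R v) has_derivative (\<lambda>t. t *\<^sub>R v)) (at 0)" by (auto intro!: derivative_eq_intros)
    show "(f has_derivative (\<lambda>h. \<Sum>b\<in>Basis. h \<bullet> b * dirD b f x)) (at (x + 0 *\<^sub>R v))"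
      using smooth_on_has_derivative[OF f x] by simp
  qed
  then have "((\<lambda>t. f (x + t *\<^sub>R v)) has_real_derivative (\<Sum>b\<in>Basis. (v \<bullet> b) * dirD b f x)) (at 0)"
    unfolding has_field_derivative_def by (rule has_derivative_eq_rhs) (simp add: fun_eq_iff sum_distrib_left algebra_simps)
  ultimately show ?thesis by (rule DERIV_unique)
qed

text \<open>The partial derivatives are bounded on a compact convex ball. This yields the Lipschitz
  bound on left-invariant fields that the invariance criterion requires.\<close>

lemma smooth_on_lipschitz_cball:
  fixes f :: "'a::euclidean_space \<Rightarrow> real"
  assumes f: "smooth_on U f" and x: "x \<in> U"
  obtains r L where "r > 0" "L-lipschitz_on (cball x r) f" "cball x r \<subseteq> U"
proof -
  obtain r where r: "r > 0" "cball x r \<subseteq> U" using smooth_on_open[OF f] x open_contains_cball by blast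
  have "\<exists>B. \<forall>z\<in>cball x r. \<bar>dirD b f z\<bar> \<le> B" for b
  proof -
    have "continuous_on (cball x r) (dirD b f)"
      using continuous_on_subset[OF smooth_on_continuous_on[OF smooth_on_dirD[OF f]] r(2)] .
    then have "bounded (dirD b f ` cball x r)"
      by (intro compact_imp_bounded compact_continuous_image) auto
    then show ?thesis by (auto simp: bounded_iff)
  qed
  then obtain B where B: "\<And>b z. z \<in> cball x r \<Longrightarrow> \<bar>dirD b f z\<bar> \<le> B b" by metis
  define L where "L = (\<Sum>b\<in>(Basis::'a set). \<bar>B b\<bar>)"
  have "norm (f y - f z) \<le> L * norm (y - z)" if yz: "y \<in> cball x r" "z \<in> cball x r" for y z
  proof (rule differentiable_bound[OF convex_cball _ _ yz])
    fix w assume w: "w \<in> cball x r"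
    show "(f has_derivative (\<lambda>h. \<Sum>b\<in>Basis. (h \<bullet> b) * dirD b f w)) (at w within cball x r)"
      using smooth_on_has_derivative[OF f] w r(2) by (blast intro: has_derivative_at_withinI)
    show "onorm (\<lambda>h. \<Sum>b\<in>Basis. (h \<bullet> b) * dirD b f w) \<le> L"
    proof (rule onorm_le)
      fix h :: 'a
      have "norm (\<Sum>b\<in>Basis. (h \<bullet> b) * dirD b f w) \<le> (\<Sum>b\<in>(Basis::'a set). norm h * \<bar>B b\<bar>)"
        using order_trans[OF B[OF w] abs_ge_self]
        by (intro sum_norm_le) (auto simp: abs_mult Basis_le_norm intro!: mult_mono)
      then show "norm (\<Sum>b\<in>Basis. (h \<bullet> b) * dirD b f w) \<le> L * norm h"
        by (simp add: L_def sum_distrib_right sum_distrib_left mult.commute)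
    qed
  qed
  then have "L-lipschitz_on (cball x r) f"
    by (intro lipschitz_onI) (auto simp: dist_norm L_def sum_nonneg)
  with r show thesis using that by blast
qed

section \<open>Carnot groups\<close>

text \<open>Taylor's formula with \<open>c'\<close> differentiable at 0: the mean value inequality
  is applied to \<open>c\<close> minus its quadratic part. It serves to show that the limit defining
  \<open>bracket\<close> exists.\<close>

lemma second_order_tendsto:
  fixes c :: "real \<Rightarrow> 'a::real_normed_vector"
  assumes c: "\<And>t. (c has_vector_derivative c' t) (at t)" and c': "(c' has_vector_derivative d) (at 0)"
    and "c 0 = 0" "c' 0 = 0"
  shows "((\<lambda>t. (1 / t\<^sup>2) *\<^sub>R c t) \<longlongrightarrow> (1 / 2) *\<^sub>R d) (at 0)"
proof (rule LIM_I)
  fix e :: real assume e: "e > 0"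
  have "\<forall>e>0. \<exists>\<delta>>0. \<forall>y. norm (y - 0) < \<delta> \<longrightarrow> norm (c' y - c' 0 - (y - 0) *\<^sub>R d) \<le> e * norm (y - 0)"
    using c' unfolding has_vector_derivative_def has_derivative_at_alt by blast
  from this[rule_format, of "e/2"] e obtain \<delta> where \<delta>: "\<delta> > 0" "\<And>t. \<bar>t\<bar> < \<delta> \<Longrightarrow> norm (c' t - t *\<^sub>R d) \<le> e/2 * \<bar>t\<bar>"
    using assms(4) by auto
  have "norm ((1 / t\<^sup>2) *\<^sub>R c t - (1 / 2) *\<^sub>R d) < e" if t: "t \<noteq> 0" "\<bar>t\<bar> < \<delta>" for t
  proof -
    define k where "k = (\<lambda>t. c t - (t\<^sup>2 / 2) *\<^sub>R d)"
    have "norm (k t - k 0) \<le> (e/2 * \<bar>t\<bar>) * norm (t - 0)"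
    proof (rule differentiable_bound[where S="closed_segment 0 t"])
      fix s assume "s \<in> closed_segment 0 t"
      then have s: "\<bar>s\<bar> \<le> \<bar>t\<bar>" by (auto simp: closed_segment_eq_real_ivl split: if_splits)
      have "(k has_vector_derivative (c' s - s *\<^sub>R d)) (at s within closed_segment 0 t)"
        unfolding k_def by (auto intro!: derivative_eq_intros has_vector_derivative_at_within[OF c])
      then show "(k has_derivative (\<lambda>h. h *\<^sub>R (c' s - s *\<^sub>R d))) (at s within closed_segment 0 t)"
        by (simp add: has_vector_derivative_def)
      have "norm (c' s - s *\<^sub>R d) \<le> e/2 * \<bar>t\<bar>"
        using \<delta>(2)[of s] s t e by (smt (verit) mult_left_mono half_gt_zero)
      then show "onorm (\<lambda>h. h *\<^sub>R (c' s - s *\<^sub>R d)) \<le> e/2 * \<bar>t\<bar>"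
        by (intro onorm_le) (simp only: norm_scaleR real_norm_def mult.commute[of "\<bar>_\<bar>"] mult_right_mono abs_ge_zero)
    qed auto
    then have "norm (k t) \<le> e/2 * t\<^sup>2" using assms(3) by (simp add: k_def power2_eq_square mult.assoc)
    moreover have "(1 / t\<^sup>2) *\<^sub>R c t - (1 / 2) *\<^sub>R d = (1 / t\<^sup>2) *\<^sub>R k t"
      using t by (simp add: k_def algebra_simps)
    ultimately have "norm ((1 / t\<^sup>2) *\<^sub>R c t - (1 / 2) *\<^sub>R d) \<le> e/2"
      using t by (simp add: field_simps)
    then show ?thesis using e by simp
  qed
  then show "\<exists>s>0. \<forall>x. x \<noteq> 0 \<and> norm (x - 0) < s \<longrightarrow> norm ((1 / x\<^sup>2) *\<^sub>R c x - (1 / 2) *\<^sub>R d) < e"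
    using \<delta>(1) by (intro exI[of _ \<delta>]) auto
qed

locale carnot =
  fixes m :: "'a::euclidean_space \<Rightarrow> 'a \<Rightarrow> 'a" and V :: "nat \<Rightarrow> 'a set" and l :: nat and xs :: "'a list"
  assumes carnot: "carnot_group m V l xs"
begin

lemma assoc: "m (m x y) z = m x (m y z)"
  and m_zero [simp]: "m 0 x = x" "m x 0 = x"
  and m_line: "m (s *\<^sub>R v) (t *\<^sub>R v) = (s + t) *\<^sub>R v"
  and m_smooth: "b \<in> Basis \<Longrightarrow> smooth_on UNIV (\<lambda>(x, y). m x y \<bullet> b)"
  using carnot unfolding carnot_group_def by blast+

lemma m_neg [simp]: "m x (- x) = 0" "m (- x) x = 0"
  using m_line[of 1 x "-1"] m_line[of "-1" x 1] by auto

lemma m_neg_cancel [simp]: "m (- x) (m x y) = y" "m x (m (- x) y) = y"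
  by (simp_all add: assoc[symmetric])

lemma m_inverse_unique: "m x y = 0 \<Longrightarrow> y = - x"
  by (metis m_neg_cancel(1) m_zero(2))

text \<open>The Frechet derivative of the group law at \<open>p\<close>, built coordinate by
  coordinate because \<open>smooth_on\<close> concerns real functions.\<close>

definition Dm :: "'a \<times> 'a \<Rightarrow> 'a \<times> 'a \<Rightarrow> 'a" where
  "Dm p q = (\<Sum>b\<in>Basis. dirD q (\<lambda>(x, y). m x y \<bullet> b) p *\<^sub>R b)"

lemma Dm_eq: "Dm p q = (\<Sum>B\<in>Basis. (q \<bullet> B) *\<^sub>R Dm p B)"
proof -
  have "Dm p q = (\<Sum>b\<in>Basis. \<Sum>B\<in>Basis. ((q \<bullet> B) * dirD B (\<lambda>(x, y). m x y \<bullet> b) p) *\<^sub>R b)"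
    unfolding Dm_def
    by (intro sum.cong refl, subst smooth_on_dirD_eq_sum[OF m_smooth]) (auto simp: scaleR_sum_left)
  also have "\<dots> = (\<Sum>B\<in>Basis. \<Sum>b\<in>Basis. ((q \<bullet> B) * dirD B (\<lambda>(x, y). m x y \<bullet> b) p) *\<^sub>R b)"
    by (rule sum.swap)
  also have "\<dots> = (\<Sum>B\<in>Basis. (q \<bullet> B) *\<^sub>R Dm p B)"
    by (simp add: Dm_def scaleR_sum_right)
  finally show ?thesis .
qed

lemma m_has_derivative: "((\<lambda>(x, y). m x y) has_derivative Dm p) (at p)"
proof (subst has_derivative_componentwise_within, intro ballI)
  fix b :: 'a assume b: "b \<in> Basis"
  have "Dm p q \<bullet> b = (\<Sum>B\<in>Basis. (q \<bullet> B) * dirD B (\<lambda>(x, y). m x y \<bullet> b) p)" for q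
    using b smooth_on_dirD_eq_sum[OF m_smooth[OF b], of p q]
    by (simp add: Dm_def inner_sum_left inner_Basis if_distrib cong: if_cong)
  then show "((\<lambda>x. (case x of (x, y) \<Rightarrow> m x y) \<bullet> b) has_derivative (\<lambda>x. Dm p x \<bullet> b)) (at p)"
    using smooth_on_has_derivative[OF m_smooth[OF b], of p] by (simp add: split_def)
qed

lemma linear_Dm: "linear (Dm p)"
  using m_has_derivative has_derivative_linear by blast

lemma Dm_differentiable: "(\<lambda>p. Dm p q) differentiable (at p)"
  unfolding Dm_def
proof (intro differentiable_sum differentiable_scaleR differentiable_const finite_Basis ballI)
  fix b :: 'a assume b: "b \<in> Basis"
  show "dirD q (\<lambda>(x, y). m x y \<bullet> b) differentiable at p"
    using smooth_on_has_derivative[OF smooth_on_dirD[OF m_smooth[OF b]], of p] differentiable_def by blast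
qed

lemma Dm_compose_differentiable:
  fixes p q :: "'b::real_normed_vector \<Rightarrow> 'a \<times> 'a"
  assumes "p differentiable (at t)" "q differentiable (at t)"
  shows "(\<lambda>t. Dm (p t) (q t)) differentiable (at t)"
proof -
  have "(\<lambda>t. Dm (p t) B) differentiable (at t)" for B
    using differentiable_chain_at[OF assms(1) Dm_differentiable[of B "p t"]] by (simp add: o_def)
  moreover have "(\<lambda>t. q t \<bullet> B) differentiable (at t)" for B
    using assms(2) by (intro differentiable_inner) auto
  ultimately show ?thesis
    by (subst Dm_eq) (intro differentiable_sum differentiable_scaleR ballI finite_Basis)
qed

lemma m_vector_derivative:
  assumes "(c has_vector_derivative c') (at t)" "(d has_vector_derivative d') (at t)"
  shows "((\<lambda>t. m (c t) (d t)) has_vector_derivative Dm (c t, d t) (c', d')) (at t)"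
proof -
  have 1: "((\<lambda>t. (c t, d t)) has_derivative (\<lambda>h. (h *\<^sub>R c', h *\<^sub>R d'))) (at t)"
    using assms unfolding has_vector_derivative_def by (rule has_derivative_Pair)
  have "((\<lambda>t. (\<lambda>(x,y). m x y) (c t, d t)) has_derivative (\<lambda>h. Dm (c t, d t) (h *\<^sub>R c', h *\<^sub>R d'))) (at t)"
    by (rule has_derivative_compose[OF 1 m_has_derivative])
  moreover have "Dm (c t, d t) (h *\<^sub>R c', h *\<^sub>R d') = h *\<^sub>R Dm (c t, d t) (c', d')" for h
    by (simp add: linear_scale[OF linear_Dm, symmetric])
  ultimately show ?thesis
    unfolding has_vector_derivative_def by simp
qed

lemma continuous_on_m:
  assumes "continuous_on S f" "continuous_on S g"
  shows "continuous_on S (\<lambda>x. m (f x) (g x))"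
proof -
  have "continuous_on UNIV (\<lambda>(x,y). m x y)"
    by (meson continuous_at_imp_continuous_on has_derivative_continuous m_has_derivative)
  from continuous_on_compose2[OF this continuous_on_Pair[OF assms]] show ?thesis by simp
qed

text \<open>Both \<open>m x 0 = x\<close> and \<open>m 0 x = x\<close> make the partial
  differentials at the identity trivial. This is why a group commutator has no first-order
  term.\<close>

lemma Dm_00: "Dm (0, 0) (h, k) = h + k"
proof -
  have line: "((\<lambda>t. t *\<^sub>R h) has_vector_derivative h) (at 0)" for h :: 'a
    by (auto intro!: derivative_eq_intros)
  have "((\<lambda>t. m (t *\<^sub>R h) 0) has_vector_derivative Dm (0, 0) (h, 0)) (at 0)"
    using m_vector_derivative[OF line[of h], of "\<lambda>_. 0" 0] by simp
  then have 1: "Dm (0, 0) (h, 0) = h" using line[of h] vector_derivative_unique_at by fastforce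
  have "((\<lambda>t. m 0 (t *\<^sub>R k)) has_vector_derivative Dm (0, 0) (0, k)) (at 0)"
    using m_vector_derivative[of "\<lambda>_. 0" 0 0, OF _ line[of k]] by simp
  then have 2: "Dm (0, 0) (0, k) = k" using line[of k] vector_derivative_unique_at by fastforce
  show ?thesis using linear_add[OF linear_Dm, of "(0,0)" "(h,0)" "(0,k)"] 1 2 by simp
qed

section \<open>Left-invariant vector fields and horizontal coordinates\<close>

lemma hvec_eq: "hvec m x v = Dm (x, 0) (0, v)"
  and hvec_DERIV0: "((\<lambda>t. m x (t *\<^sub>R v)) has_vector_derivative hvec m x v) (at 0)"
proof -
  have "((\<lambda>t. t *\<^sub>R v) has_vector_derivative v) (at 0)" by (auto intro!: derivative_eq_intros)
  from m_vector_derivative[of "\<lambda>_. x" 0 0, OF _ this]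
  have *: "((\<lambda>t. m x (t *\<^sub>R v)) has_vector_derivative Dm (x, 0) (0, v)) (at 0)" by simp
  then show "hvec m x v = Dm (x, 0) (0, v)" unfolding hvec_def by (rule vector_derivative_at)
  with * show "((\<lambda>t. m x (t *\<^sub>R v)) has_vector_derivative hvec m x v) (at 0)" by simp
qed

lemma m_add_line: "m x ((s + t) *\<^sub>R v) = m (m x (s *\<^sub>R v)) (t *\<^sub>R v)"
  by (simp add: assoc m_line)

text \<open>Associativity turns a shift of time into a change of base point, so the derivative at 0
  determines all others: these curves are the integral curves of the left-invariant field.\<close>

lemma hvec_DERIV: "((\<lambda>t. m x (t *\<^sub>R v)) has_vector_derivative hvec m (m x (s *\<^sub>R v)) v) (at s)"
proof -
  have "((\<lambda>t. m (m x (s *\<^sub>R v)) ((t - s) *\<^sub>R v)) has_vector_derivative (1 *\<^sub>R hvec m (m x (s *\<^sub>R v)) v)) (at s)"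
  proof (rule vector_diff_chain_at[of "\<lambda>t. t - s" 1 s, unfolded o_def])
    show "((\<lambda>t. t - s) has_vector_derivative 1) (at s)" by (auto intro!: derivative_eq_intros)
    show "((\<lambda>t. m (m x (s *\<^sub>R v)) (t *\<^sub>R v)) has_vector_derivative hvec m (m x (s *\<^sub>R v)) v) (at (s - s))"
      using hvec_DERIV0 by simp
  qed
  moreover have "m (m x (s *\<^sub>R v)) ((t - s) *\<^sub>R v) = m x (t *\<^sub>R v)" for t
    using m_add_line[of x s "t - s" v] by simp
  ultimately show ?thesis by simp
qed

lemma linear_hvec: "linear (hvec m x)"
proof -
  have "linear (\<lambda>v::'a. (0::'a, v))" by (auto intro!: linearI)
  from linear_compose[OF this linear_Dm[of "(x,0)"]] show ?thesis
    by (simp add: o_def hvec_eq[abs_def])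
qed

lemma hvec_differentiable: "(\<lambda>x. hvec m x v) differentiable (at x)"
  unfolding hvec_eq
  by (intro Dm_compose_differentiable) (auto intro!: derivative_intros simp: differentiable_def intro: has_derivative_Pair has_derivative_ident has_derivative_const)

lemma continuous_on_hvec: "continuous_on S (\<lambda>x. hvec m x v)"
  by (intro continuous_at_imp_continuous_on ballI differentiable_imp_continuous_within hvec_differentiable)

lemma hvec_lipschitz_cball:
  obtains r L where "r > 0" "L \<ge> 0" "\<And>y z. y \<in> cball x r \<Longrightarrow> z \<in> cball x r \<Longrightarrow> norm (hvec m y v - hvec m z v) \<le> L * norm (y - z)"
proof -
  have "\<exists>r L. r > 0 \<and> L-lipschitz_on (cball (x, 0) r) (dirD (0, v) (\<lambda>(x, y). m x y \<bullet> b))" if b: "b \<in> Basis" for b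
    using smooth_on_lipschitz_cball[OF smooth_on_dirD[OF m_smooth[OF b]], of "(x,0)" "(0,v)"] by (metis UNIV_I)
  then obtain r L where rL: "\<And>b. b \<in> Basis \<Longrightarrow> r b > 0"
    "\<And>b. b \<in> Basis \<Longrightarrow> (L b)-lipschitz_on (cball (x, 0) (r b)) (dirD (0, v) (\<lambda>(x, y). m x y \<bullet> b))"
    by metis
  define R where "R = Min (r ` Basis)"
  have R: "R > 0" "\<And>b. b \<in> Basis \<Longrightarrow> R \<le> r b" using rL(1) by (auto simp: R_def)
  define K where "K = (\<Sum>b\<in>(Basis::'a set). L b)"
  have Lb: "L b \<ge> 0" if "b \<in> Basis" for b using rL(2)[OF that] lipschitz_on_nonneg by blast
  have "norm (hvec m y v - hvec m z v) \<le> K * norm (y - z)" if yz: "y \<in> cball x R" "z \<in> cball x R" for y z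
  proof -
    have "hvec m y v - hvec m z v = (\<Sum>b\<in>Basis. (dirD (0,v) (\<lambda>(x, y). m x y \<bullet> b) (y,0) - dirD (0,v) (\<lambda>(x, y). m x y \<bullet> b) (z,0)) *\<^sub>R b)"
      by (simp add: hvec_eq Dm_def sum_subtractf scaleR_diff_left)
    also have "norm \<dots> \<le> (\<Sum>b\<in>(Basis::'a set). L b * norm (y - z))"
    proof (rule sum_norm_le)
      fix b :: 'a assume b: "b \<in> Basis"
      have "(y,0) \<in> cball (x,0) (r b)" "(z,0) \<in> cball (x,0) (r b)"
        using yz R(2)[OF b] by (auto simp: dist_Pair_Pair)
      from lipschitz_onD[OF rL(2)[OF b] this] show
        "norm ((dirD (0,v) (\<lambda>(x, y). m x y \<bullet> b) (y,0) - dirD (0,v) (\<lambda>(x, y). m x y \<bullet> b) (z,0)) *\<^sub>R b) \<le> L b * norm (y - z)"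
        using b by (simp add: dist_Pair_Pair dist_norm)
    qed
    finally show ?thesis by (simp add: K_def sum_distrib_right)
  qed
  with R(1) show thesis using that[of R K] Lb by (simp add: K_def sum_nonneg)
qed

text \<open>Left translation by \<open>- x\<close> inverts left translation by \<open>x\<close>, so
  the differential of the latter is injective. Hence horizontal coordinates are unique, as the
  description in \<open>hcoef\<close> demands.\<close>

lemma hvec_eq_0_iff: "hvec m x v = 0 \<longleftrightarrow> v = 0"
proof
  assume h: "hvec m x v = 0"
  have "((\<lambda>t. m (- x) (m x (t *\<^sub>R v))) has_vector_derivative Dm (- x, x) (0, hvec m x v)) (at 0)"
    using m_vector_derivative[of "\<lambda>_. - x" 0 0, OF _ hvec_DERIV0[of x v]] by simp
  then have "((\<lambda>t. t *\<^sub>R v) has_vector_derivative 0) (at 0)"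
    using h linear_0[OF linear_Dm] by (simp add: zero_prod_def[symmetric])
  moreover have "((\<lambda>t. t *\<^sub>R v) has_vector_derivative v) (at 0)" by (auto intro!: derivative_eq_intros)
  ultimately show "v = 0" using vector_derivative_unique_at by blast
qed (simp add: linear_0[OF linear_hvec])

lemma xs_props: "distinct xs" "independent (set xs)" "span (set xs) = V 1"
  using carnot unfolding carnot_group_def by blast+

lemma hcoef_eq:
  assumes "\<And>i. i \<ge> length xs \<Longrightarrow> c i = 0"
  shows "hcoef m xs g (\<Sum>i<length xs. c i *\<^sub>R hvec m g (xs ! i)) = c"
  unfolding hcoef_def
proof (rule the_equality)
  fix d assume d: "(\<forall>i\<ge>length xs. d i = 0) \<and> (\<Sum>i<length xs. c i *\<^sub>R hvec m g (xs ! i)) = (\<Sum>i<length xs. d i *\<^sub>R hvec m g (xs ! i))"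
  then have "hvec m g (\<Sum>i<length xs. (c i - d i) *\<^sub>R xs ! i) = 0"
    by (simp add: linear_diff[OF linear_hvec] linear_sum[OF linear_hvec] linear_scale[OF linear_hvec] scaleR_diff_left sum_subtractf)
  then have z: "(\<Sum>i<length xs. (c i - d i) *\<^sub>R xs ! i) = 0" by (simp add: hvec_eq_0_iff)
  have bij: "bij_betw (\<lambda>i. xs ! i) {..<length xs} (set xs)"
    using xs_props(1) by (rule bij_betw_nth) auto
  \<comment> \<open>Independence is a statement about coefficients on a set of vectors, so the
    coefficients are carried over from indices to list entries.\<close>
  define e where "e = (\<lambda>x. let i = (SOME i. i < length xs \<and> xs ! i = x) in c i - d i)"
  have e: "e (xs ! i) = c i - d i" if "i < length xs" for i
  proof -
    have "(SOME j. j < length xs \<and> xs ! j = xs ! i) = i"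
      by (rule some_equality) (use that xs_props(1) nth_eq_iff_index_eq in auto)
    then show ?thesis by (simp add: e_def)
  qed
  have "(\<Sum>x\<in>set xs. e x *\<^sub>R x) = (\<Sum>i<length xs. e (xs ! i) *\<^sub>R xs ! i)"
    using sum.reindex_bij_betw[OF bij, of "\<lambda>x. e x *\<^sub>R x"] by simp
  also have "\<dots> = 0" using z e by simp
  finally have "e (xs ! i) = 0" if "i < length xs" for i
    using independentD[OF xs_props(2), of "set xs" e "xs ! i"] that by auto
  then have "c i = d i" for i using e d assms by (cases "i < length xs") (auto simp: not_less)
  then show "d = c" by auto
qed (use assms in auto)

lemma hnorm_eq:
  "hnorm m xs g (\<Sum>i<length xs. c i *\<^sub>R hvec m g (xs ! i)) = sqrt (\<Sum>i<length xs. (c i)\<^sup>2)"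
proof -
  \<comment> \<open>\<open>hcoef\<close> requires coefficients past the end of \<open>xs\<close> to
    be 0.\<close>
  define d where "d = (\<lambda>i. if i < length xs then c i else 0)"
  have "(\<Sum>i<length xs. c i *\<^sub>R hvec m g (xs ! i)) = (\<Sum>i<length xs. d i *\<^sub>R hvec m g (xs ! i))"
    by (simp add: d_def)
  then show ?thesis using hcoef_eq[of d g] by (simp add: hnorm_def d_def)
qed

end

section \<open>Sets invariant under left-invariant flows\<close>

context carnot
begin

text \<open>The group commutator of the one-parameter subgroups of \<open>v\<close> and
  \<open>w\<close>, since negatives are inverses.\<close>

definition bcomm :: "'a \<Rightarrow> 'a \<Rightarrow> real \<Rightarrow> 'a" where
  "bcomm v w t = m (m (t *\<^sub>R v) (t *\<^sub>R w)) (m (- (t *\<^sub>R v)) (- (t *\<^sub>R w)))"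

text \<open>\<open>bracket\<close> is a \<open>Lim\<close>, which carries information only once
  convergence is known. The commutator vanishes at 0 and so does its derivative, where the
  contributions \<open>v + w\<close> and \<open>- v - w\<close> cancel; what remains is half of its
  second derivative.\<close>

lemma bracket_tendsto: "((\<lambda>t. (1 / t\<^sup>2) *\<^sub>R bcomm v w t) \<longlongrightarrow> bracket m v w) (at 0)"
proof -
  have lin: "((\<lambda>t. t *\<^sub>R h) has_vector_derivative h) (at t)" for h :: 'a and t
    by (auto intro!: derivative_eq_intros)
  have linm: "((\<lambda>t. - (t *\<^sub>R h)) has_vector_derivative - h) (at t)" for h :: 'a and t
    by (auto intro!: derivative_eq_intros)
  define P where "P = (\<lambda>t. m (t *\<^sub>R v) (t *\<^sub>R w))"
  define P' where "P' = (\<lambda>t. Dm (t *\<^sub>R v, t *\<^sub>R w) (v, w))"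
  define R where "R = (\<lambda>t. m (- (t *\<^sub>R v)) (- (t *\<^sub>R w)))"
  define R' where "R' = (\<lambda>t. Dm (- (t *\<^sub>R v), - (t *\<^sub>R w)) (- v, - w))"
  have P: "(P has_vector_derivative P' t) (at t)" for t
    unfolding P_def P'_def by (rule m_vector_derivative[OF lin lin])
  have R: "(R has_vector_derivative R' t) (at t)" for t
    unfolding R_def R'_def by (rule m_vector_derivative[OF linm linm])
  have F: "(bcomm v w has_vector_derivative Dm (P t, R t) (P' t, R' t)) (at t)" for t
    using m_vector_derivative[OF P[of t] R[of t]] by (simp add: bcomm_def[abs_def] P_def R_def)
  have pair: "(\<lambda>t. (f t, g t)) differentiable (at t)" if "f differentiable (at t)" "g differentiable (at t)"
    for f g :: "real \<Rightarrow> 'a" and t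
    using that unfolding differentiable_def by (blast intro: has_derivative_Pair)
  have vd: "f differentiable (at t)" if "(f has_vector_derivative f') (at t)" for f :: "real \<Rightarrow> 'a" and f' t
    using that unfolding differentiable_def has_vector_derivative_def by blast
  have P'd: "P' differentiable (at t)" for t
    unfolding P'_def by (intro Dm_compose_differentiable pair vd[OF lin] differentiable_const)
  have R'd: "R' differentiable (at t)" for t
    unfolding R'_def by (intro Dm_compose_differentiable pair vd[OF linm] differentiable_const)
  have "(\<lambda>t. Dm (P t, R t) (P' t, R' t)) differentiable (at 0)"
    by (intro Dm_compose_differentiable pair vd[OF P] vd[OF R] P'd R'd)
  then obtain d where d: "((\<lambda>t. Dm (P t, R t) (P' t, R' t)) has_vector_derivative d) (at 0)"
    using vector_derivative_works by blast
  have "((\<lambda>t. (1 / t\<^sup>2) *\<^sub>R bcomm v w t) \<longlongrightarrow> (1/2) *\<^sub>R d) (at 0)"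
  proof (rule second_order_tendsto[OF F d])
    show "bcomm v w 0 = 0" by (simp add: bcomm_def)
    show "Dm (P 0, R 0) (P' 0, R' 0) = 0" by (simp add: P_def R_def P'_def R'_def Dm_00)
  qed
  moreover have "bracket m v w = (1/2) *\<^sub>R d"
    unfolding bracket_def using calculation by (intro tendsto_Lim) (auto simp: bcomm_def)
  ultimately show ?thesis by simp
qed

text \<open>Exchanging the arguments inverts the commutator, and inverses are negatives. This
  supplies the bracket with the opposite sign while time still runs forwards.\<close>

lemma bcomm_swap: "bcomm w v t = - bcomm v w t"
proof (rule m_inverse_unique)
  show "m (bcomm v w t) (bcomm w v t) = 0"
    by (simp add: bcomm_def assoc)
qed

lemma m_left_has_derivative: "(m y has_derivative hvec m y) (at 0)"
proof -
  have 1: "((\<lambda>h. (y, h)) has_derivative (\<lambda>h. (0, h))) (at 0)"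
    by (auto intro!: derivative_eq_intros)
  from has_derivative_compose[OF 1 m_has_derivative] show ?thesis
    by (simp add: hvec_eq[abs_def])
qed

lemma line_expansion:
  assumes "e > 0"
  obtains d where "d > 0" "\<And>h. \<bar>h\<bar> < d \<Longrightarrow> norm (m x (h *\<^sub>R v) - x - h *\<^sub>R hvec m x v) \<le> e * \<bar>h\<bar>"
proof -
  have "\<forall>e>0. \<exists>d>0. \<forall>h. norm (h - 0) < d \<longrightarrow> norm (m x (h *\<^sub>R v) - m x (0 *\<^sub>R v) - (h - 0) *\<^sub>R hvec m x v) \<le> e * norm (h - 0)"
    using hvec_DERIV0[of x v] unfolding has_vector_derivative_def has_derivative_at_alt by blast
  from this[rule_format, OF assms] show thesis using that by auto
qed

lemma m_line_near:
  assumes "e > 0"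
  obtains r where "r > 0" "\<And>y t. y \<in> ball z r \<Longrightarrow> \<bar>t\<bar> \<le> r \<Longrightarrow> m y (t *\<^sub>R v) \<in> ball z e"
proof -
  have "continuous_on UNIV (\<lambda>p. m (fst p) (snd p *\<^sub>R v))"
    by (intro continuous_on_m continuous_intros)
  then have "isCont (\<lambda>p. m (fst p) (snd p *\<^sub>R v)) (z, 0::real)"
    by (simp add: continuous_on_eq_continuous_at)
  then obtain d where d: "d > 0" "\<And>p. dist p (z, 0::real) < d \<Longrightarrow> dist (m (fst p) (snd p *\<^sub>R v)) z < e"
    using assms unfolding continuous_at_eps_delta by fastforce
  show thesis
  proof (rule that[of "d/2"])
    fix y and t :: real assume "y \<in> ball z (d/2)" "\<bar>t\<bar> \<le> d/2"
    then have "dist (y, t) (z, 0) < d"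
      using sqrt_sum_squares_le_sum[of "dist y z" "\<bar>t\<bar>"]
      by (simp add: dist_Pair_Pair dist_commute power2_abs)
    from d(2)[OF this] show "m y (t *\<^sub>R v) \<in> ball z e" by (simp add: dist_commute)
  qed (use d in simp)
qed

text \<open>Membership in \<open>A\<close> persists for a locally uniform time under the flow
  \<open>y \<mapsto> y exp (t v)\<close> of the left-invariant field \<open>v\<close>.\<close>

definition loc_inv :: "'a set \<Rightarrow> 'a \<Rightarrow> bool" where
  "loc_inv A v \<longleftrightarrow> (\<forall>z. z \<noteq> 0 \<longrightarrow> (\<exists>r>0. \<forall>y\<in>A \<inter> ball z r. \<forall>t\<in>{0..r}. m y (t *\<^sub>R v) \<in> A))"

text \<open>A Nagumo-type criterion: flow lines that start in \<open>A\<close> stay there if at each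
  point of \<open>A\<close> the flow departs from \<open>A\<close> slower than linearly. The flow
  line is compared with the motion of its nearest point in \<open>A\<close>; since the field is
  locally Lipschitz, the distance satisfies the hypothesis of \<open>Dini_Gronwall\<close>.\<close>

lemma subtangent_imp_loc_inv:
  assumes cl: "closed (insert 0 A)"
    and sub: "\<And>y \<epsilon>. y \<in> A \<Longrightarrow> \<epsilon> > 0 \<Longrightarrow> \<exists>\<delta>>0. \<forall>t. 0 < t \<and> t < \<delta> \<longrightarrow> (\<exists>a\<in>A. norm (m y (t *\<^sub>R v) - a) \<le> \<epsilon> * t)"
  shows "loc_inv A v"
  unfolding loc_inv_def
proof (intro allI impI)
  have tri1: "norm (a - p) \<le> norm (q - a) + norm (q - p - w) + norm w" for a p q w :: 'a
    by norm
  have tri2: "norm (p1 - p2 + p3 + p4 + p5) \<le> norm p1 + norm p2 + norm p3 + norm p4 + norm p5" for p1 p2 p3 p4 p5 :: 'a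
    by norm
  fix z :: 'a assume z: "z \<noteq> 0"
  obtain r0 L where r0: "r0 > 0" "L \<ge> 0"
    and Lip: "\<And>y y'. y \<in> cball z r0 \<Longrightarrow> y' \<in> cball z r0 \<Longrightarrow> norm (hvec m y v - hvec m y' v) \<le> L * norm (y - y')"
    using hvec_lipschitz_cball[of z v] by blast
  \<comment> \<open>The closed ball of radius \<open>R\<close> about \<open>z\<close> misses 0, so
    \<open>A\<close> is closed inside it.\<close>
  define R where "R = min r0 (norm z / 2)"
  have R: "R > 0" "R \<le> r0" "R < norm z" using r0 z by (auto simp: R_def min_def)
  define K where "K = A \<inter> cball z R"
  have "K = insert 0 A \<inter> cball z R" using R by (auto simp: K_def)
  then have K: "closed K" using cl by (simp add: closed_Int)
  obtain r1 where r1: "r1 > 0" "\<And>y t. y \<in> ball z r1 \<Longrightarrow> \<bar>t\<bar> \<le> r1 \<Longrightarrow> m y (t *\<^sub>R v) \<in> ball z (R/4)"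
    using m_line_near[of "R/4" z v] R by auto
  show "\<exists>r>0. \<forall>y\<in>A \<inter> ball z r. \<forall>t\<in>{0..r}. m y (t *\<^sub>R v) \<in> A"
  proof (intro exI[of _ r1] conjI ballI)
    fix y t assume y: "y \<in> A \<inter> ball z r1" and t: "t \<in> {0..r1}"
    have yR: "y \<in> ball z (R/4)" using r1(2)[of y 0] y r1(1) by simp
    then have yK: "y \<in> K" using y R by (auto simp: K_def)
    define f where "f = (\<lambda>t. infdist (m y (t *\<^sub>R v)) K)"
    have "f t \<le> 0"
    proof (rule Dini_Gronwall[OF _ _ r0(2) _ t])
      show "continuous_on {0..r1} f"
        unfolding f_def by (intro continuous_on_infdist continuous_on_m continuous_intros)
      show "f 0 = 0" using yK by (simp add: f_def)
    next
      fix s e :: real assume s: "s \<in> {0..<r1}" and e: "e > 0"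
      define g where "g = m y (s *\<^sub>R v)"
      have gR: "g \<in> ball z (R/4)" using r1(2)[of y s] y s by (auto simp: g_def)
      \<comment> \<open>The nearest point is at most as far from \<open>g\<close> as
        \<open>y\<close> is, hence within \<open>3 * R / 4\<close> of \<open>z\<close>; the
        remaining quarter leaves room for the approximating point \<open>a\<close> below.\<close>
      obtain p where p: "p \<in> K" "f s = dist g p"
        using infdist_attains_inf[OF K, of g] yK by (auto simp: f_def g_def)
      have "dist g p \<le> dist g y" using infdist_le[OF yK, of g] p by (simp add: f_def g_def)
      then have pz: "dist z p < 3 * R / 4"
        using gR yR dist_triangle[of z p g] dist_triangle[of g y z] by (simp add: dist_commute)
      obtain d1 where d1: "d1 > 0" "\<And>h. \<bar>h\<bar> < d1 \<Longrightarrow> norm (m g (h *\<^sub>R v) - g - h *\<^sub>R hvec m g v) \<le> e/3 * \<bar>h\<bar>"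
        using line_expansion[of "e/3" g v] e by auto
      obtain d2 where d2: "d2 > 0" "\<And>h. \<bar>h\<bar> < d2 \<Longrightarrow> norm (m p (h *\<^sub>R v) - p - h *\<^sub>R hvec m p v) \<le> e/3 * \<bar>h\<bar>"
        using line_expansion[of "e/3" p v] e by auto
      have pA: "p \<in> A" using p by (simp add: K_def)
      obtain d3 where d3: "d3 > 0" "\<And>h. 0 < h \<Longrightarrow> h < d3 \<Longrightarrow> \<exists>a\<in>A. norm (m p (h *\<^sub>R v) - a) \<le> e/3 * h"
        using sub[OF pA, of "e/3"] e by auto
      \<comment> \<open>\<open>c\<close> bounds the speed at which \<open>a\<close> departs from
        \<open>p\<close>; together with the last bound in \<open>d\<close> it keeps \<open>a\<close>
        in \<open>K\<close>.\<close>
      define c where "c = e + norm (hvec m p v) + 1"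
      have c: "c > 0" using e by (simp add: c_def add_pos_nonneg)
      define d where "d = min (min d1 d2) (min d3 (R / 4 / c))"
      have d: "d > 0" "d \<le> d1" "d \<le> d2" "d \<le> d3" "d \<le> R / 4 / c" using d1 d2 d3 R c by (auto simp: d_def)
      have "f (s + h) \<le> f s + h * (L * f s + e)" if h: "0 < h" "h < d" for h
      proof -
        obtain a where a: "a \<in> A" "norm (m p (h *\<^sub>R v) - a) \<le> e/3 * h" using d3(2)[of h] h d by auto
        have e1: "norm (m g (h *\<^sub>R v) - g - h *\<^sub>R hvec m g v) \<le> e/3 * h" using d1(2)[of h] h d by auto
        have e2: "norm (m p (h *\<^sub>R v) - p - h *\<^sub>R hvec m p v) \<le> e/3 * h" using d2(2)[of h] h d by auto
        have "norm (a - p) \<le> norm (m p (h *\<^sub>R v) - a) + norm (m p (h *\<^sub>R v) - p - h *\<^sub>R hvec m p v) + norm (h *\<^sub>R hvec m p v)"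
          by (rule tri1)
        also have "\<dots> \<le> e/3 * h + e/3 * h + h * norm (hvec m p v)" using a e2 h by simp
        also have "\<dots> \<le> h * c" using h e by (simp add: c_def algebra_simps)
        also have "\<dots> < R / 4" using less_le_trans[OF h(2) d(5)] c by (simp add: pos_less_divide_eq)
        finally have "dist z a \<le> R"
          using pz dist_triangle[of z a p] by (simp add: dist_norm norm_minus_commute)
        then have aK: "a \<in> K" using a by (simp add: K_def)
        have gp: "g \<in> cball z r0" "p \<in> cball z r0" using gR pz R by auto
        have "f (s + h) \<le> dist (m g (h *\<^sub>R v)) a"
          unfolding f_def m_add_line g_def[symmetric] by (rule infdist_le[OF aK])
        \<comment> \<open>Three errors of at most \<open>e/3 * h\<close>, the old distance, and the
          difference of the field at \<open>g\<close> and \<open>p\<close>, which the Lipschitz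
          bound turns into \<open>h * (L * f s)\<close>.\<close>
        also have "\<dots> = norm ((m g (h *\<^sub>R v) - g - h *\<^sub>R hvec m g v) - (m p (h *\<^sub>R v) - p - h *\<^sub>R hvec m p v)
            + (m p (h *\<^sub>R v) - a) + (g - p) + h *\<^sub>R (hvec m g v - hvec m p v))"
          by (simp add: dist_norm algebra_simps)
        also have "\<dots> \<le> norm (m g (h *\<^sub>R v) - g - h *\<^sub>R hvec m g v) + norm (m p (h *\<^sub>R v) - p - h *\<^sub>R hvec m p v)
            + norm (m p (h *\<^sub>R v) - a) + norm (g - p) + norm (h *\<^sub>R (hvec m g v - hvec m p v))"
          by (rule tri2)
        also have "\<dots> \<le> e/3 * h + e/3 * h + e/3 * h + f s + h * (L * f s)"
          using e1 e2 a(2) Lip[OF gp] h p(2) by (intro add_mono) (auto simp: dist_norm intro!: mult_left_mono)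
        also have "\<dots> = f s + h * (L * f s + e)" by (simp add: algebra_simps)
        finally show ?thesis .
      qed
      with d(1) show "\<exists>\<delta>>0. \<forall>h. 0 < h \<and> h < \<delta> \<longrightarrow> f (s + h) \<le> f s + h * (L * f s + e)" by blast
    qed
    then have "infdist (m y (t *\<^sub>R v)) K = 0" unfolding f_def using infdist_nonneg by (metis order_antisym)
    then have "m y (t *\<^sub>R v) \<in> K" using in_closed_iff_infdist_zero[OF K] yK by blast
    then show "m y (t *\<^sub>R v) \<in> A" by (simp add: K_def)
  qed (rule r1)
qed

lemma loc_inv_scale:
  assumes "loc_inv A v" "c \<ge> 0"
  shows "loc_inv A (c *\<^sub>R v)"
  unfolding loc_inv_def
proof (intro allI impI)
  fix z :: 'a assume "z \<noteq> 0"
  with assms obtain r where r: "r > 0" "\<And>y t. y \<in> A \<inter> ball z r \<Longrightarrow> t \<in> {0..r} \<Longrightarrow> m y (t *\<^sub>R v) \<in> A"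
    unfolding loc_inv_def by blast
  show "\<exists>r>0. \<forall>y\<in>A \<inter> ball z r. \<forall>t\<in>{0..r}. m y (t *\<^sub>R c *\<^sub>R v) \<in> A"
  \<comment> \<open>This radius is at most \<open>r\<close> and also gives
    \<open>t * c \<le> r\<close>; the summand 1 covers \<open>c = 0\<close>.\<close>
  proof (intro exI[of _ "r / (c + 1)"] conjI ballI)
    fix y t assume y: "y \<in> A \<inter> ball z (r / (c + 1))" and t: "t \<in> {0..r / (c + 1)}"
    have "r / (c + 1) \<le> r" using r assms by (simp add: field_simps)
    moreover have "t * c \<le> r"
    proof -
      have "t * (c + 1) \<le> r" using t assms(2) by (simp add: pos_le_divide_eq)
      then show ?thesis using t by (simp add: distrib_left)
    qed
    ultimately show "m y (t *\<^sub>R c *\<^sub>R v) \<in> A" using r(2)[of y "t * c"] y t assms by auto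
  qed (use r assms in auto)
qed

lemma Dm_fst: "Dm (y, 0) (h, 0) = h"
proof -
  have "((\<lambda>t. y + t *\<^sub>R h) has_vector_derivative h) (at 0)" by (auto intro!: derivative_eq_intros)
  from this m_vector_derivative[OF this, of "\<lambda>_. 0" 0] show ?thesis
    using vector_derivative_unique_at by fastforce
qed

text \<open>Following \<open>v\<close> and then \<open>w\<close> keeps a point in \<open>A\<close>
  and agrees with following \<open>v + w\<close> up to an error that is o(t), which is all that
  \<open>subtangent_imp_loc_inv\<close> asks.\<close>

lemma loc_inv_add:
  assumes cl: "closed (insert 0 A)" "0 \<notin> A" and v: "loc_inv A v" and w: "loc_inv A w"
  shows "loc_inv A (v + w)"
proof (rule subtangent_imp_loc_inv[OF cl(1)])
  fix y and e :: real assume y: "y \<in> A" and e: "e > 0"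
  then have y0: "y \<noteq> 0" using cl by auto
  obtain r1 where r1: "r1 > 0" "\<And>y' t. y' \<in> A \<inter> ball y r1 \<Longrightarrow> t \<in> {0..r1} \<Longrightarrow> m y' (t *\<^sub>R v) \<in> A"
    using v y0 unfolding loc_inv_def by blast
  obtain r2 where r2: "r2 > 0" "\<And>y' t. y' \<in> A \<inter> ball y r2 \<Longrightarrow> t \<in> {0..r2} \<Longrightarrow> m y' (t *\<^sub>R w) \<in> A"
    using w y0 unfolding loc_inv_def by blast
  obtain r3 where r3: "r3 > 0" "\<And>y' t. y' \<in> ball y r3 \<Longrightarrow> \<bar>t\<bar> \<le> r3 \<Longrightarrow> m y' (t *\<^sub>R v) \<in> ball y r2"
    using m_line_near[OF r2(1)] by blast
  define k where "k = (\<lambda>t. m y (t *\<^sub>R (v + w)) - m (m y (t *\<^sub>R v)) (t *\<^sub>R w))"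
  have lin: "((\<lambda>t. t *\<^sub>R w) has_vector_derivative w) (at 0)" by (auto intro!: derivative_eq_intros)
  have "((\<lambda>t. m (m y (t *\<^sub>R v)) (t *\<^sub>R w)) has_vector_derivative Dm (y, 0) (hvec m y v, w)) (at 0)"
    using m_vector_derivative[OF hvec_DERIV0[of y v] lin] by simp
  moreover have "Dm (y, 0) (hvec m y v, w) = hvec m y (v + w)"
    using linear_add[OF linear_Dm, of "(y,0)" "(hvec m y v, 0)" "(0, w)"]
    by (simp add: Dm_fst hvec_eq[symmetric] linear_add[OF linear_hvec])
  ultimately have "(k has_vector_derivative 0) (at 0)"
    unfolding k_def using has_vector_derivative_diff[OF hvec_DERIV0[of y "v + w"]] by fastforce
  then have "\<forall>e>0. \<exists>d>0. \<forall>h. norm (h - 0) < d \<longrightarrow> norm (k h - k 0 - (h - 0) *\<^sub>R 0) \<le> e * norm (h - 0)"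
    unfolding has_vector_derivative_def has_derivative_at_alt by blast
  then obtain d where d: "d > 0" "\<And>t. \<bar>t\<bar> < d \<Longrightarrow> norm (k t) \<le> e * \<bar>t\<bar>"
    using e by (fastforce simp: k_def)
  show "\<exists>\<delta>>0. \<forall>t. 0 < t \<and> t < \<delta> \<longrightarrow> (\<exists>a\<in>A. norm (m y (t *\<^sub>R (v + w)) - a) \<le> e * t)"
  proof (intro exI[of _ "min d (min r1 (min r2 r3))"] conjI allI impI)
    fix t assume "0 < t \<and> t < min d (min r1 (min r2 r3))"
    then have t: "0 < t" "t < d" "t < r1" "t < r2" "t < r3" by auto
    have "m y (t *\<^sub>R v) \<in> A" using r1 y t by auto
    moreover have "m y (t *\<^sub>R v) \<in> ball y r2" using r3(2)[of y t] r3(1) t by simp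
    ultimately have "m (m y (t *\<^sub>R v)) (t *\<^sub>R w) \<in> A" using r2(2)[of "m y (t *\<^sub>R v)" t] t by simp
    moreover have "norm (k t) \<le> e * t" using d(2)[of t] t by simp
    ultimately show "\<exists>a\<in>A. norm (m y (t *\<^sub>R (v + w)) - a) \<le> e * t" unfolding k_def by blast
  qed (use d r1 r2 r3 in auto)
qed

text \<open>Running \<open>F\<close> at parameter \<open>sqrt t\<close> turns a displacement of
  second order into one of first order: \<open>F (sqrt t)\<close> is \<open>t *\<^sub>R B\<close> up
  to o(t). So the direction \<open>B\<close> becomes subtangent.\<close>

lemma loc_inv_second_order:
  assumes cl: "closed (insert 0 A)"
    and F: "((\<lambda>t. (1 / t\<^sup>2) *\<^sub>R F t) \<longlongrightarrow> B) (at 0)"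
    and mem: "\<And>y. y \<in> A \<Longrightarrow> eventually (\<lambda>t. m y (F t) \<in> A) (at_right 0)"
  shows "loc_inv A B"
proof (rule subtangent_imp_loc_inv[OF cl(1)])
  fix y and e :: real assume y: "y \<in> A" and e: "e > 0"
  \<comment> \<open>With \<open>e2 \<le> 1/2\<close> below, both \<open>F s\<close> and
    \<open>t *\<^sub>R B\<close> have norm at most \<open>t * (C / 2)\<close>; the linearisation
    errors then add up to \<open>e * t / 2\<close>, and \<open>e2 * K \<le> e/2\<close> accounts for
    the other half.\<close>
  define C where "C = 2 * norm B + 1"
  have C: "C > 0" by (simp add: C_def add_nonneg_pos)
  obtain K where K: "K > 0" "\<And>h. norm (hvec m y h) \<le> norm h * K"
    using bounded_linear.pos_bounded[OF linear_conv_bounded_linear[THEN iffD1, OF linear_hvec]] by blast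
  have "\<forall>e>0. \<exists>d>0. \<forall>h. norm (h - 0) < d \<longrightarrow> norm (m y h - m y 0 - hvec m y (h - 0)) \<le> e * norm (h - 0)"
    using m_left_has_derivative[of y] unfolding has_derivative_at_alt by blast
  from this[rule_format, of "e / (2 * C)"] e C
  obtain d1 where d1: "d1 > 0" "\<And>h. norm h < d1 \<Longrightarrow> norm (m y h - y - hvec m y h) \<le> e / (2 * C) * norm h"
    by auto
  define e2 where "e2 = min (1/2) (e / (2 * K))"
  have e2: "e2 > 0" "e2 \<le> 1/2" "e2 * K \<le> e/2" using e K by (auto simp: e2_def min_def field_simps)
  have "eventually (\<lambda>t. norm ((1 / t\<^sup>2) *\<^sub>R F t - B) < e2) (at_right 0)"
    using tendstoD[OF F e2(1)] by (auto simp: dist_norm eventually_at_split)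
  from eventually_conj[OF this mem[OF y]]
  obtain d2 where d2: "d2 > 0" "\<And>t. 0 < t \<Longrightarrow> t < d2 \<Longrightarrow> norm ((1 / t\<^sup>2) *\<^sub>R F t - B) < e2"
      "\<And>t. 0 < t \<Longrightarrow> t < d2 \<Longrightarrow> m y (F t) \<in> A"
    by (auto simp: eventually_at_right_field)
  show "\<exists>\<delta>>0. \<forall>t. 0 < t \<and> t < \<delta> \<longrightarrow> (\<exists>a\<in>A. norm (m y (t *\<^sub>R B) - a) \<le> e * t)"
  proof (intro exI[of _ "min (d2\<^sup>2) (d1 / C)"] conjI allI impI)
    fix t assume "0 < t \<and> t < min (d2\<^sup>2) (d1 / C)"
    then have t: "0 < t" "t < d2\<^sup>2" "t < d1 / C" by auto
    define s where "s = sqrt t"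
    have s: "0 < s" "s < d2" "s\<^sup>2 = t" using t d2(1) real_sqrt_less_mono[OF t(2)] by (auto simp: s_def)
    have "F s - t *\<^sub>R B = t *\<^sub>R ((1 / s\<^sup>2) *\<^sub>R F s - B)" using s t by (simp add: algebra_simps)
    then have FB: "norm (F s - t *\<^sub>R B) \<le> t * e2"
      using d2(2)[OF s(1,2)] t by (simp add: less_imp_le)
    have nF: "norm (F s) \<le> t * (C / 2)"
    proof -
      have "norm (F s) \<le> t * e2 + t * norm B" using FB t norm_triangle_ineq2[of "F s" "t *\<^sub>R B"] by simp
      also have "\<dots> \<le> t * (C / 2)" unfolding C_def using e2(2) t by (simp add: field_simps)
      finally show ?thesis .
    qed
    have nB: "norm (t *\<^sub>R B) \<le> t * (C / 2)" using t by (simp add: C_def field_simps)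
    have tC: "t * C < d1" using t C by (simp add: field_simps)
    have lt: "t * (C / 2) < d1" using tC mult_pos_pos[OF t(1) C] by simp
    have "norm (m y (t *\<^sub>R B) - m y (F s)) =
        norm ((m y (t *\<^sub>R B) - y - hvec m y (t *\<^sub>R B)) - (m y (F s) - y - hvec m y (F s)) - hvec m y (F s - t *\<^sub>R B))"
      by (simp add: linear_diff[OF linear_hvec])
    also have "\<dots> \<le> norm (m y (t *\<^sub>R B) - y - hvec m y (t *\<^sub>R B)) + norm (m y (F s) - y - hvec m y (F s)) + norm (hvec m y (F s - t *\<^sub>R B))"
      by (meson add_mono norm_triangle_ineq4 order_refl order_trans)
    also have "\<dots> \<le> e / (2 * C) * (t * (C / 2)) + e / (2 * C) * (t * (C / 2)) + t * e2 * K"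
    proof (intro add_mono)
      show "norm (m y (t *\<^sub>R B) - y - hvec m y (t *\<^sub>R B)) \<le> e / (2 * C) * (t * (C / 2))"
        using d1(2)[of "t *\<^sub>R B"] nB lt e C by (intro order_trans[OF _ mult_left_mono[OF nB]]) auto
      show "norm (m y (F s) - y - hvec m y (F s)) \<le> e / (2 * C) * (t * (C / 2))"
        using d1(2)[of "F s"] nF lt e C by (intro order_trans[OF _ mult_left_mono[OF nF]]) auto
      show "norm (hvec m y (F s - t *\<^sub>R B)) \<le> t * e2 * K"
        using K(1) by (intro order_trans[OF K(2)] mult_right_mono FB) auto
    qed
    also have "\<dots> \<le> e * t"
    proof -
      have "t * e2 * K \<le> t * (e/2)" using e2(3) t by (simp add: mult.assoc)
      moreover have "e / (2 * C) * (t * (C / 2)) = e * t / 4" using C by (simp add: field_simps)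
      ultimately show ?thesis by (simp add: mult.commute)
    qed
    finally have "norm (m y (t *\<^sub>R B) - m y (F s)) \<le> e * t" .
    then show "\<exists>a\<in>A. norm (m y (t *\<^sub>R B) - a) \<le> e * t" using d2(3)[OF s(1,2)] by blast
  qed (use d1 d2 C in auto)
qed

end

section \<open>Brackets of invariant directions, and openness of fully invariant sets\<close>

context carnot
begin

text \<open>The base point \<open>q t\<close> may move with \<open>t\<close>, and both conclusions
  have the form of the assumptions, so the four factors of a commutator can be applied one after the
  other.\<close>

lemma loc_inv_eventually:
  assumes v: "loc_inv A v" and "y \<noteq> 0" and q: "(q \<longlongrightarrow> y) (at_right 0)" and qA: "eventually (\<lambda>t. q t \<in> A) (at_right 0)"
  shows "eventually (\<lambda>t. m (q t) (t *\<^sub>R v) \<in> A) (at_right 0)"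
    and "((\<lambda>t. m (q t) (t *\<^sub>R v)) \<longlongrightarrow> y) (at_right 0)"
proof -
  obtain r where r: "r > 0" "\<And>y' t. y' \<in> A \<inter> ball y r \<Longrightarrow> t \<in> {0..r} \<Longrightarrow> m y' (t *\<^sub>R v) \<in> A"
    using v assms(2) unfolding loc_inv_def by blast
  have "eventually (\<lambda>t. q t \<in> ball y r) (at_right 0)"
    using tendstoD[OF q r(1)] by eventually_elim (simp add: dist_commute)
  moreover have "eventually (\<lambda>t::real. t \<in> {0..r}) (at_right 0)"
    using r(1) by (auto simp: eventually_at_right_field)
  ultimately show "eventually (\<lambda>t. m (q t) (t *\<^sub>R v) \<in> A) (at_right 0)"
    using qA by eventually_elim (use r(2) in auto)
  have "continuous_on UNIV (\<lambda>p. m (fst p) (snd p *\<^sub>R v))"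
    by (intro continuous_on_m continuous_intros)
  then have "isCont (\<lambda>p. m (fst p) (snd p *\<^sub>R v)) (y, 0::real)"
    by (simp add: continuous_on_eq_continuous_at)
  moreover have "((\<lambda>t. (q t, t)) \<longlongrightarrow> (y, 0)) (at_right 0)" by (intro tendsto_intros q)
  ultimately show "((\<lambda>t. m (q t) (t *\<^sub>R v)) \<longlongrightarrow> y) (at_right 0)"
    using isCont_tendsto_compose by fastforce
qed

lemma eventually_bcomm:
  assumes "0 \<notin> A" "y \<in> A" and "loc_inv A v" "loc_inv A w" "loc_inv A (- v)" "loc_inv A (- w)"
  shows "eventually (\<lambda>t. m y (bcomm v w t) \<in> A) (at_right 0)"
proof -
  have y: "y \<noteq> 0" using assms by auto
  note 1 = loc_inv_eventually[OF assms(3) y tendsto_const, simplified, OF assms(2)]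
  note 2 = loc_inv_eventually[OF assms(4) y 1(2,1)]
  note 3 = loc_inv_eventually[OF assms(5) y 2(2,1)]
  note 4 = loc_inv_eventually[OF assms(6) y 3(2,1)]
  show ?thesis using 4(1) by (simp add: bcomm_def assoc)
qed

lemma loc_inv_bracket:
  assumes cl: "closed (insert 0 A)" "0 \<notin> A"
    and "loc_inv A v" "loc_inv A w" "loc_inv A (- v)" "loc_inv A (- w)"
  shows "loc_inv A (bracket m v w)" "loc_inv A (- bracket m v w)"
proof -
  show "loc_inv A (bracket m v w)"
    by (rule loc_inv_second_order[OF cl(1) bracket_tendsto eventually_bcomm[OF cl(2)]]) (use assms in auto)
  have "((\<lambda>t. (1 / t\<^sup>2) *\<^sub>R bcomm w v t) \<longlongrightarrow> - bracket m v w) (at 0)"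
    using tendsto_minus[OF bracket_tendsto[of v w]] by (simp add: bcomm_swap[of w v])
  from loc_inv_second_order[OF cl(1) this eventually_bcomm[OF cl(2)]] assms
  show "loc_inv A (- bracket m v w)" by blast
qed

lemma loc_inv_zero: "loc_inv A 0"
  unfolding loc_inv_def by (auto intro: exI[of _ 1])

text \<open>\<open>loc_inv\<close> alone yields only a cone, because time runs forwards; demanding
  both signs makes it symmetric.\<close>

lemma subspace_loc_inv:
  assumes cl: "closed (insert 0 A)" "0 \<notin> A"
  shows "subspace {v. loc_inv A v \<and> loc_inv A (- v)}"
proof (rule subspaceI; clarsimp simp: loc_inv_zero)
  fix x y assume "loc_inv A x" "loc_inv A (- x)" "loc_inv A y" "loc_inv A (- y)"
  then show "loc_inv A (x + y) \<and> loc_inv A (- x - y)"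
    using loc_inv_add[OF cl, of x y] loc_inv_add[OF cl, of "- x" "- y"] by simp
next
  fix c :: real and x assume "loc_inv A x" "loc_inv A (- x)"
  then show "loc_inv A (c *\<^sub>R x) \<and> loc_inv A (- (c *\<^sub>R x))"
    using loc_inv_scale[of A x c] loc_inv_scale[of A x "- c"] loc_inv_scale[of A "- x" c] loc_inv_scale[of A "- x" "- c"]
    by (cases "c \<ge> 0") auto
qed

lemma layers:
  shows "1 \<le> l" "i \<in> {1..l} \<Longrightarrow> subspace (V i)" "span (\<Union>i\<in>{1..l}. V i) = UNIV"
    "(\<Sum>i=1..l. dim (V i)) = DIM('a)"
    "j \<in> {1..l} \<Longrightarrow> j < l \<Longrightarrow> span {bracket m v w | v w. v \<in> V 1 \<and> w \<in> V j} = V (Suc j)"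
  using carnot unfolding carnot_group_def by (blast, blast, blast, blast, auto)

text \<open>The first layer generates, so invariance under horizontal directions spreads to all directions.\<close>

lemma loc_inv_all:
  assumes cl: "closed (insert 0 A)" "0 \<notin> A" and gen: "\<And>x. x \<in> set xs \<Longrightarrow> loc_inv A x \<and> loc_inv A (- x)"
  shows "loc_inv A v"
proof -
  define H where "H = {v. loc_inv A v \<and> loc_inv A (- v)}"
  have H: "subspace H" unfolding H_def by (rule subspace_loc_inv[OF cl])
  have V1: "V 1 \<subseteq> H"
    unfolding xs_props(3)[symmetric] using gen by (intro span_minimal[OF _ H]) (auto simp: H_def)
  have "V j \<subseteq> H" if "1 \<le> j" "j \<le> l" for j
    using that
  proof (induction j rule: dec_induct)
    case base
    show ?case by (rule V1)
  next
    case (step j)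
    then have "V (Suc j) = span {bracket m v w | v w. v \<in> V 1 \<and> w \<in> V j}" using layers(5)[of j] by auto
    also have "\<dots> \<subseteq> H"
    proof (rule span_minimal[OF _ H], clarify)
      fix v w assume "v \<in> V 1" "w \<in> V j"
      then have "v \<in> H" "w \<in> H" using V1 step by auto
      then show "bracket m v w \<in> H" using loc_inv_bracket[OF cl, of v w] by (simp add: H_def)
    qed
    finally show ?case .
  qed
  then have "span (\<Union>i\<in>{1..l}. V i) \<subseteq> H" by (intro span_minimal[OF _ H] UN_least) auto
  then show ?thesis using layers(3) by (auto simp: H_def)
qed

text \<open>Every point near \<open>x\<close> is \<open>m x v\<close> with small \<open>v\<close>.
  Along the curve to that point, membership in \<open>A\<close> is an open condition by invariance
  in both directions and a closed one because the curve avoids 0.\<close>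

lemma loc_inv_imp_open:
  assumes cl: "closed (insert 0 A)" "0 \<notin> A" and inv: "\<And>v. loc_inv A v" and x: "x \<in> A"
  shows "\<exists>e>0. ball x e \<subseteq> A"
proof -
  have x0: "x \<noteq> 0" using cl x by auto
  have cm: "continuous_on UNIV (m y)" for y
    using continuous_on_m[of UNIV "\<lambda>_. y" "\<lambda>x. x"] by (simp add: continuous_on_id)
  have "open (m x -` (- {0}))" by (rule open_vimage) (auto simp: cm)
  moreover have "0 \<in> m x -` (- {0})" using x0 by simp
  ultimately obtain d where d: "d > 0" "ball 0 d \<subseteq> m x -` (- {0})"
    using open_contains_ball by blast
  have mem: "m x v \<in> A" if v: "v \<in> ball 0 d" for v
  proof -
    define T where "T = {t \<in> {0..1}. m x (t *\<^sub>R v) \<in> A}"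
    have nz: "m x (t *\<^sub>R v) \<noteq> 0" if "t \<in> {0..1}" for t
    proof -
      have "norm (t *\<^sub>R v) \<le> norm v" using that by (simp add: mult_left_le_one_le)
      then have "t *\<^sub>R v \<in> ball 0 d" using v by simp
      with d(2) have "t *\<^sub>R v \<in> m x -` (- {0})" by blast
      then show ?thesis by simp
    qed
    have "closedin (top_of_set {0..1}) T"
    proof -
      have "T = {0..1} \<inter> (\<lambda>t. m x (t *\<^sub>R v)) -` (insert 0 A)" using nz by (auto simp: T_def)
      moreover have "continuous_on {0..1} (\<lambda>t. m x (t *\<^sub>R v))"
        by (intro continuous_on_m continuous_intros)
      ultimately show ?thesis using continuous_closedin_preimage cl(1) by metis
    qed
    moreover have "openin (top_of_set {0..1}) T"
      unfolding openin_euclidean_subtopology_iff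
    proof (intro conjI ballI)
      fix t assume t: "t \<in> T"
      define z where "z = m x (t *\<^sub>R v)"
      have z: "z \<in> A" "z \<noteq> 0" using t nz by (auto simp: z_def T_def)
      obtain r1 where r1: "r1 > 0" "\<And>y' t. y' \<in> A \<inter> ball z r1 \<Longrightarrow> t \<in> {0..r1} \<Longrightarrow> m y' (t *\<^sub>R v) \<in> A"
        using inv[of v] z(2) unfolding loc_inv_def by blast
      obtain r2 where r2: "r2 > 0" "\<And>y' t. y' \<in> A \<inter> ball z r2 \<Longrightarrow> t \<in> {0..r2} \<Longrightarrow> m y' (t *\<^sub>R (- v)) \<in> A"
        using inv[of "- v"] z(2) unfolding loc_inv_def by blast
      have "s \<in> T" if s: "s \<in> {0..1}" "dist s t < min r1 r2" for s
      proof -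
        have eq: "m x (s *\<^sub>R v) = m z ((s - t) *\<^sub>R v)" using m_add_line[of x t "s - t" v] by (simp add: z_def)
        have "m z ((s - t) *\<^sub>R v) \<in> A"
        proof (cases "s \<ge> t")
          case True
          then show ?thesis using r1(2)[of z "s - t"] s z r1(1) by (simp add: dist_real_def)
        next
          case False
          then show ?thesis using r2(2)[of z "t - s"] s z r2(1) by (simp add: dist_real_def algebra_simps)
        qed
        then show ?thesis using s eq by (simp add: T_def)
      qed
      then show "\<exists>e>0. \<forall>x'\<in>{0..1}. dist x' t < e \<longrightarrow> x' \<in> T" using r1(1) r2(1)
        by (intro exI[of _ "min r1 r2"]) auto
    qed (auto simp: T_def)
    moreover have "0 \<in> T" using x by (simp add: T_def)
    ultimately have "T = {0..1}" using connected_clopen[of "{0..1::real}"] by auto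
    then have "1 \<in> T" by auto
    then show ?thesis by (simp add: T_def)
  qed
  have "open (m (- x) -` ball 0 d)" by (rule open_vimage) (auto simp: cm)
  moreover have "x \<in> m (- x) -` ball 0 d" using d by simp
  ultimately obtain e where e: "e > 0" "ball x e \<subseteq> m (- x) -` ball 0 d"
    using open_contains_ball by blast
  have "ball x e \<subseteq> A"
  proof
    fix y assume "y \<in> ball x e"
    then have "m (- x) y \<in> ball 0 d" using e by auto
    from mem[OF this] show "y \<in> A" by simp
  qed
  with e(1) show ?thesis by blast
qed

end

section \<open>The radial flow\<close>

lemma powr_abs_base: "\<bar>x\<bar> powr a = x powr (a::real)"
  by (simp add: powr_def ln_real_def)

text \<open>\<open>powr\<close> is even in its base, so negative bases reduce to positive ones. This
  allows \<open>N\<close> to be differentiated while the sign of \<open>u\<close> is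
  unknown.\<close>

lemma has_real_derivative_powr_nonzero:
  fixes y k :: real
  assumes "y \<noteq> 0"
  shows "((\<lambda>y. y powr k) has_real_derivative k * y powr k / y) (at y)"
proof (cases "y > 0")
  case True
  then show ?thesis
    by (auto intro!: derivative_eq_intros simp: powr_diff)
next
  case False
  then have y: "- y > 0" using assms by simp
  have "((\<lambda>y. (- y) powr k) has_real_derivative (k * (- y) powr k / y)) (at y)"
    using y by (auto intro!: derivative_eq_intros simp: powr_diff)
  moreover have "(- z) powr k = z powr k" for z :: real
    by (metis abs_minus_cancel powr_abs_base)
  ultimately show ?thesis by simp
qed

context carnot
begin

lemma Xf_eq:
  assumes "(f has_derivative f') (at g)"
  shows "Xf m w f g = f' (hvec m g w)"
proof -
  have "((\<lambda>t. f (m g (t *\<^sub>R w))) has_derivative (\<lambda>t. f' (t *\<^sub>R hvec m g w))) (at 0)"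
    using has_derivative_compose[OF hvec_DERIV0[of g w, unfolded has_vector_derivative_def], of f f'] assms by simp
  then have "((\<lambda>t. f (m g (t *\<^sub>R w))) has_real_derivative f' (hvec m g w)) (at 0)"
    unfolding has_field_derivative_def
    by (rule has_derivative_eq_rhs) (simp add: fun_eq_iff linear_scale[OF has_derivative_linear[OF assms]] mult.commute)
  then show ?thesis unfolding Xf_def by (rule DERIV_imp_deriv)
qed

abbreviation hcomb :: "(nat \<Rightarrow> real) \<Rightarrow> 'a \<Rightarrow> 'a" where
  "hcomb c g \<equiv> \<Sum>i<length xs. c i *\<^sub>R hvec m g (xs ! i)"

lemma horizontal_chain:
  assumes f: "(f has_derivative f') (at (c t))"
    and c: "(c has_vector_derivative (hcomb a (c t))) (at t)"
  shows "((\<lambda>t. f (c t)) has_real_derivative (\<Sum>i<length xs. a i * Xf m (xs ! i) f (c t))) (at t)"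
proof -
  note lin = has_derivative_linear[OF f]
  have "((\<lambda>t. f (c t)) has_derivative (\<lambda>h. f' (h *\<^sub>R (hcomb a (c t))))) (at t)"
    by (rule has_derivative_compose[OF c[unfolded has_vector_derivative_def] f])
  then show ?thesis
    unfolding has_field_derivative_def
    by (rule has_derivative_eq_rhs)
       (simp add: fun_eq_iff linear_scale[OF lin] linear_sum[OF lin] Xf_eq[OF f] mult.commute)
qed

end

locale polar_carnot = carnot m V l xs
  for m :: "'a::euclidean_space \<Rightarrow> 'a \<Rightarrow> 'a" and V :: "nat \<Rightarrow> 'a set" and l :: nat and xs :: "'a list" +
  fixes u :: "'a \<Rightarrow> real" and \<phi> :: "real \<Rightarrow> 'a \<Rightarrow> 'a" and v :: "'a measure"
  assumes Q_gt: "real (hdim V l) > 2"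
    and fund: "fundamental_solution m V l xs u"
    and polz: "polarizable m xs (normG (real (hdim V l)) u)"
    and flow: "radial_flow m xs (normG (real (hdim V l)) u) \<phi>"
    and polm: "polar_measure (normG (real (hdim V l)) u) (Zset m xs (normG (real (hdim V l)) u)) \<phi> (real (hdim V l)) v"
begin

abbreviation Q :: real where "Q \<equiv> real (hdim V l)"
abbreviation N :: "'a \<Rightarrow> real" where "N \<equiv> normG Q u"
abbreviation Z :: "'a set" where "Z \<equiv> Zset m xs N"
abbreviation X :: "nat \<Rightarrow> ('a \<Rightarrow> real) \<Rightarrow> 'a \<Rightarrow> real" where "X i \<equiv> Xf m (xs ! i)"
abbreviation grad2 :: "'a \<Rightarrow> real" where "grad2 \<equiv> hgrad_sq m xs N"

text \<open>Where \<open>N\<close> can be differentiated at the outset; \<open>W_eq\<close> finally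
  identifies it with the complement of 0.\<close>

definition W :: "'a set" where "W = {x. x \<noteq> 0 \<and> u x \<noteq> 0}"

definition \<kappa> :: real where "\<kappa> = 1 / (2 - Q)"

lemma \<kappa>_neg: "\<kappa> < 0" using Q_gt by (simp add: \<kappa>_def)

lemma u_smooth: "smooth_on (- {0}) u"
  using fund by (simp add: fundamental_solution_def)

lemma u_homogeneous: "r > 0 \<Longrightarrow> x \<noteq> 0 \<Longrightarrow> u (dil V l r x) = r powr (2 - Q) * u x"
  using fund by (simp add: fundamental_solution_def)

lemma u_cont: "continuous_on (- {0}) u"
  by (rule smooth_on_continuous_on[OF u_smooth])

lemma u_isCont: "x \<noteq> 0 \<Longrightarrow> isCont u x"
  using u_cont by (simp add: continuous_on_eq_continuous_at open_Compl)

lemma W_open: "open W"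
proof -
  have "W = (- {0}) \<inter> u -` (- {0})" by (auto simp: W_def)
  then show ?thesis using continuous_open_preimage[OF u_cont] by (simp add: open_Compl)
qed

lemma N_eq: "x \<noteq> 0 \<Longrightarrow> N x = u x powr \<kappa>"
  by (simp add: normG_def \<kappa>_def)

lemma N_pos: "x \<in> W \<Longrightarrow> N x > 0"
  by (simp add: W_def N_eq)

text \<open>\<open>0 powr \<kappa>\<close> is 0 even though \<kappa> is negative, so
  \<open>N\<close> vanishes wherever \<open>u\<close> does. In particular the unit sphere of
  \<open>N\<close> lies in \<open>W\<close>.\<close>

lemma N_pos_iff: "N x > 0 \<longleftrightarrow> x \<in> W"
  by (auto simp: W_def normG_def)

lemma N_nonneg: "N x \<ge> 0"
  by (simp add: normG_def)

definition Du :: "'a \<Rightarrow> 'a \<Rightarrow> real" where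
  "Du x h = (\<Sum>b\<in>Basis. (h \<bullet> b) * dirD b u x)"

lemma u_has_derivative: "x \<noteq> 0 \<Longrightarrow> (u has_derivative Du x) (at x)"
  using smooth_on_has_derivative[OF u_smooth] by (simp add: Du_def[abs_def])

lemma N_has_derivative:
  assumes "x \<in> W"
  shows "(N has_derivative (\<lambda>h. \<kappa> * N x / u x * Du x h)) (at x)"
proof -
  have x: "x \<noteq> 0" "u x \<noteq> 0" using assms by (auto simp: W_def)
  have "((\<lambda>x. u x powr \<kappa>) has_derivative (\<lambda>h. \<kappa> * u x powr \<kappa> / u x * Du x h)) (at x)"
    using has_derivative_compose[OF u_has_derivative[OF x(1)] has_real_derivative_powr_nonzero[OF x(2), unfolded has_field_derivative_def]]
    by simp
  then have "(N has_derivative (\<lambda>h. \<kappa> * u x powr \<kappa> / u x * Du x h)) (at x)"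
    by (rule has_derivative_transform_within_open[of _ _ _ _ "- {0}"]) (use x in \<open>auto simp: N_eq open_Compl\<close>)
  then show ?thesis using x by (simp add: N_eq)
qed

lemma N_isCont: "x \<in> W \<Longrightarrow> isCont N x"
  using N_has_derivative has_derivative_continuous by blast

lemma X_u: "x \<noteq> 0 \<Longrightarrow> Xf m w u x = Du x (hvec m x w)"
  by (rule Xf_eq[OF u_has_derivative])

lemma X_N: "x \<in> W \<Longrightarrow> Xf m w N x = \<kappa> * N x / u x * Xf m w u x"
  by (subst Xf_eq[OF N_has_derivative], assumption, subst X_u) (auto simp: W_def)

lemma X_u_differentiable:
  assumes "x \<noteq> 0"
  shows "Xf m w u differentiable (at x)"
proof -
  have "(\<lambda>x. \<Sum>b\<in>Basis. (hvec m x w \<bullet> b) * dirD b u x) differentiable (at x)"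
  proof (intro differentiable_sum finite_Basis ballI differentiable_mult)
    fix b :: 'a
    show "(\<lambda>x. hvec m x w \<bullet> b) differentiable (at x)"
      by (intro differentiable_inner hvec_differentiable differentiable_const)
    show "dirD b u differentiable (at x)"
      using smooth_on_has_derivative[OF smooth_on_dirD[OF u_smooth], of x b] assms differentiable_def by blast
  qed
  then obtain D where "((\<lambda>x. \<Sum>b\<in>Basis. (hvec m x w \<bullet> b) * dirD b u x) has_derivative D) (at x)"
    by (auto simp: differentiable_def)
  then have "(Xf m w u has_derivative D) (at x)"
    by (rule has_derivative_transform_within_open[of _ _ _ _ "- {0}"]) (use assms in \<open>auto simp: X_u Du_def open_Compl\<close>)
  then show ?thesis by (auto simp: differentiable_def)
qed

lemma X_u_isCont: "x \<noteq> 0 \<Longrightarrow> isCont (Xf m w u) x"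
  using X_u_differentiable differentiable_imp_continuous_within by blast

lemma grad2_eq: "x \<in> W \<Longrightarrow> grad2 x = (\<kappa> * N x / u x)\<^sup>2 * (\<Sum>i<length xs. (X i u x)\<^sup>2)"
  by (simp add: hgrad_sq_def X_N sum_distrib_left power_mult_distrib power_divide)

lemma grad2_nonneg: "grad2 x \<ge> 0"
  by (simp add: hgrad_sq_def sum_nonneg)

lemma grad2_differentiable:
  assumes "x \<in> W"
  shows "grad2 differentiable (at x)"
proof -
  have x: "x \<noteq> 0" "u x \<noteq> 0" using assms by (auto simp: W_def)
  have uN: "u differentiable (at x)" "N differentiable (at x)"
    using u_has_derivative[OF x(1)] N_has_derivative[OF assms] differentiable_def by blast+
  have "(\<lambda>x. (\<kappa> * N x / u x)\<^sup>2 * (\<Sum>i<length xs. (X i u x)\<^sup>2)) differentiable (at x)"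
    by (intro differentiable_mult differentiable_power differentiable_divide differentiable_sum uN ballI
        differentiable_const finite_lessThan X_u_differentiable x)
  then obtain D where "((\<lambda>x. (\<kappa> * N x / u x)\<^sup>2 * (\<Sum>i<length xs. (X i u x)\<^sup>2)) has_derivative D) (at x)"
    by (auto simp: differentiable_def)
  then have "(grad2 has_derivative D) (at x)"
    by (rule has_derivative_transform_within_open[OF _ W_open assms]) (simp add: grad2_eq)
  then show ?thesis by (auto simp: differentiable_def)
qed

lemma grad2_isCont: "x \<in> W \<Longrightarrow> isCont grad2 x"
  using grad2_differentiable differentiable_imp_continuous_within by blast

lemma grad2_pos: "x \<notin> Z \<Longrightarrow> grad2 x > 0"
proof -
  assume "x \<notin> Z"
  then obtain i where i: "i < length xs" "X i N x \<noteq> 0" by (auto simp: Zset_def)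
  have "0 < (X i N x)\<^sup>2" using i by simp
  also have "\<dots> \<le> grad2 x" unfolding hgrad_sq_def by (rule member_le_sum) (use i in auto)
  finally show ?thesis .
qed

lemma grad2_Z: "x \<in> Z \<Longrightarrow> x \<noteq> 0 \<Longrightarrow> grad2 x = 0"
  by (auto simp: Zset_def hgrad_sq_def)

text \<open>The velocity of the flow line through \<open>x\<close>, in the frame of horizontal
  fields.\<close>

definition coef :: "real \<Rightarrow> 'a \<Rightarrow> nat \<Rightarrow> real" where
  "coef s x i = N (\<phi> s x) / (s * grad2 (\<phi> s x)) * X i N (\<phi> s x)"

lemma flow_props:
  assumes "x \<notin> Z"
  shows flow_1: "\<phi> 1 x = x" and flow_Z: "s > 0 \<Longrightarrow> \<phi> s x \<notin> Z"
    and flow_deriv: "s > 0 \<Longrightarrow> ((\<lambda>s. \<phi> s x) has_vector_derivative (hcomb (coef s x) (\<phi> s x))) (at s)"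
  using flow assms unfolding radial_flow_def coef_def by (auto simp: scaleR_sum_right)

lemma flow_nonzero: "x \<notin> Z \<Longrightarrow> s > 0 \<Longrightarrow> \<phi> s x \<noteq> 0"
  using flow_Z[of x s] by (auto simp: Zset_def)

lemma flow_isCont: "x \<notin> Z \<Longrightarrow> s > 0 \<Longrightarrow> isCont (\<lambda>s. \<phi> s x) s"
  using flow_deriv has_vector_derivative_continuous by blast

text \<open>The flow equation gives \<open>u\<close> the logarithmic derivative
  \<open>(2 - Q) / s\<close>, but only where \<open>u\<close> is nonzero, since \<open>N\<close>
  need not be differentiable elsewhere. The rescaled function \<open>k\<close> is therefore shown to
  keep its nonzero initial value by a connectedness argument.\<close>

lemma flow_u:
  assumes x: "x \<notin> Z" "x \<in> W" and s: "s > 0"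
  shows "u (\<phi> s x) = s powr (2 - Q) * u x"
proof -
  define k where "k = (\<lambda>s. u (\<phi> s x) * s powr (Q - 2))"
  have k_cont: "continuous_on {0<..} k"
  proof (rule continuous_at_imp_continuous_on, rule ballI)
    fix s :: real assume "s \<in> {0<..}"
    then have s: "s > 0" by simp
    have "isCont (\<lambda>s. u (\<phi> s x)) s"
      by (rule isCont_o2[OF flow_isCont[OF x(1) s] u_isCont[OF flow_nonzero[OF x(1) s]]])
    moreover have "isCont (\<lambda>s. s powr (Q - 2)) s" using s by (intro continuous_intros) auto
    ultimately show "isCont k s" unfolding k_def by (rule continuous_mult)
  qed
  have k_deriv: "(k has_real_derivative 0) (at s)" if s: "s > 0" and ks: "k s \<noteq> 0" for s
  proof -
    have W: "\<phi> s x \<in> W" using ks s flow_nonzero[OF x(1)] by (auto simp: k_def W_def)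
    note g = grad2_pos[OF flow_Z[OF x(1) s]]
    define y where "y = \<phi> s x"
    have y: "y \<in> W" "u y \<noteq> 0" "y \<noteq> 0" "N y > 0" "grad2 y > 0" using W g N_pos by (auto simp: y_def W_def)
    have Xu: "X i u y = (u y / (\<kappa> * N y)) * X i N y" for i
      using y \<kappa>_neg by (simp add: X_N)
    have "((\<lambda>s. u (\<phi> s x)) has_real_derivative (\<Sum>i<length xs. coef s x i * X i u y)) (at s)"
      unfolding y_def by (rule horizontal_chain[OF u_has_derivative flow_deriv]) (use x s y in \<open>auto simp: y_def\<close>)
    also have "(\<Sum>i<length xs. coef s x i * X i u y) = N y / (s * grad2 y) * (u y / (\<kappa> * N y)) * grad2 y"
    proof -
      have "coef s x i * X i u y = N y / (s * grad2 y) * (u y / (\<kappa> * N y)) * (X i N y)\<^sup>2" for i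
        unfolding Xu coef_def y_def[symmetric] power2_eq_square by (simp only: mult_ac)
      then have "(\<Sum>i<length xs. coef s x i * X i u y) =
          N y / (s * grad2 y) * (u y / (\<kappa> * N y)) * (\<Sum>i<length xs. (X i N y)\<^sup>2)"
        by (simp only: sum_distrib_left)
      then show ?thesis by (simp only: hgrad_sq_def)
    qed
    also have "\<dots> = (2 - Q) * u y / s"
    proof -
      have "n / (s * g) * (w / (1 / q * n)) * g = q * w / s" if "n > 0" "g > 0" "q \<noteq> 0" for n g w q :: real
        using that s by simp
      then show ?thesis using y Q_gt unfolding \<kappa>_def by simp
    qed
    finally have d: "((\<lambda>s. u (\<phi> s x)) has_real_derivative (2 - Q) * u y / s) (at s)" .
    have "(k has_real_derivative (2 - Q) * u y / s * s powr (Q - 2) + (Q - 2) * s powr (Q - 2 - 1) * u (\<phi> s x)) (at s)"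
      unfolding k_def by (rule DERIV_mult[OF d has_real_derivative_powr[OF s]])
    moreover have "(2 - Q) * u y / s * s powr (Q - 2) + (Q - 2) * s powr (Q - 2 - 1) * u (\<phi> s x) = 0"
    proof -
      have p: "s powr (Q - 2 - 1) = s powr (Q - 2) / s" using s powr_diff[of s "Q - 2" 1] by simp
      have "(2 - q) * U / s * P + (q - 2) * (P / s) * U = 0" for q U P :: real
        by (simp add: left_diff_distrib diff_divide_distrib)
      then show ?thesis unfolding p y_def .
    qed
    ultimately show ?thesis by simp
  qed
  define c where "c = k 1"
  have c: "c \<noteq> 0" using x flow_1[OF x(1)] by (simp add: c_def k_def W_def)
  \<comment> \<open>Near a point of \<open>T\<close> the function \<open>k\<close> is nonzero, hence
    locally constant; so \<open>T\<close> is open as well as closed in the half-line.\<close>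
  define T where "T = {s \<in> {0<..}. k s = c}"
  have "closedin (top_of_set {0<..}) T"
    unfolding T_def using continuous_closedin_preimage_constant[OF k_cont] .
  moreover have "openin (top_of_set {0<..}) T"
    unfolding openin_euclidean_subtopology_iff
  proof (intro conjI ballI)
    fix t assume t: "t \<in> T"
    have "open ({0<..} \<inter> k -` (- {0}))"
      by (rule continuous_open_preimage[OF k_cont]) (auto simp: open_Compl)
    moreover have "t \<in> {0<..} \<inter> k -` (- {0})" using t c by (simp add: T_def)
    ultimately obtain e where e: "e > 0" "ball t e \<subseteq> {0<..} \<inter> k -` (- {0})"
      using open_contains_ball by blast
    have "\<exists>c. \<forall>s\<in>ball t e. k s = c"
    proof (rule has_field_derivative_zero_constant[OF convex_ball])
      fix s assume "s \<in> ball t e"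
      then have "s > 0" "k s \<noteq> 0" using e(2) by auto
      then show "(k has_field_derivative 0) (at s within ball t e)"
        by (intro has_field_derivative_at_within[OF k_deriv])
    qed
    then have "k s = k t" if "s \<in> ball t e" for s using that e(1) by (metis centre_in_ball)
    moreover have "k t = c" using t by (simp add: T_def)
    ultimately have "k s = c" if "s \<in> ball t e" for s using that by blast
    then show "\<exists>e>0. \<forall>x'\<in>{0<..}. dist x' t < e \<longrightarrow> x' \<in> T"
      using e(1) by (intro exI[of _ e]) (auto simp: T_def dist_commute)
  qed (auto simp: T_def)
  moreover have "1 \<in> T" by (simp add: T_def c_def)
  ultimately have "T = {0<..}" using connected_clopen[of "{0::real<..}"] connected_Ioi by blast
  then have "s \<in> T" using s by simp
  then have "u (\<phi> s x) * s powr (Q - 2) = u x" using flow_1[OF x(1)] by (simp add: T_def c_def k_def)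
  then have "s powr (2 - Q) * u x = u (\<phi> s x) * (s powr (Q - 2) * s powr (2 - Q))" by (simp add: mult_ac)
  also have "s powr (Q - 2) * s powr (2 - Q) = 1" using s by (simp add: powr_add[symmetric])
  finally show ?thesis by simp
qed

lemma flow_W: "x \<notin> Z \<Longrightarrow> x \<in> W \<Longrightarrow> s > 0 \<Longrightarrow> \<phi> s x \<in> W"
  using flow_u[of x s] flow_nonzero[of x s] by (simp add: W_def)

lemma flow_N: 
  assumes x: "x \<notin> Z" "x \<in> W" and s: "s > 0"
  shows "N (\<phi> s x) = s * N x"
proof -
  have "N (\<phi> s x) = \<bar>s powr (2 - Q) * u x\<bar> powr \<kappa>"
    using flow_nonzero[OF x(1) s] flow_u[OF x s] by (simp add: N_eq powr_abs_base)
  also have "\<dots> = (s powr (2 - Q)) powr \<kappa> * \<bar>u x\<bar> powr \<kappa>" by (simp add: abs_mult powr_mult)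
  also have "(s powr (2 - Q)) powr \<kappa> = s" using s Q_gt by (simp add: powr_powr \<kappa>_def)
  finally show ?thesis using x by (simp add: N_eq W_def powr_abs_base)
qed

text \<open>Polarizability says exactly that \<open>grad2\<close> has zero derivative in the
  direction of the horizontal gradient of \<open>N\<close>, which is the direction of the
  flow.\<close>

lemma flow_grad2:
  assumes x: "x \<notin> Z" "x \<in> W" and s: "s > 0"
  shows "grad2 (\<phi> s x) = grad2 x"
proof -
  have "\<exists>c. \<forall>s\<in>{0<..}. grad2 (\<phi> s x) = c"
  proof (rule has_field_derivative_zero_constant)
    fix s :: real assume "s \<in> {0<..}"
    then have s: "s > 0" by simp
    obtain D where D: "(grad2 has_derivative D) (at (\<phi> s x))"
      using grad2_differentiable[OF flow_W[OF x s]] by (auto simp: differentiable_def)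
    have "((\<lambda>s. grad2 (\<phi> s x)) has_real_derivative (\<Sum>i<length xs. coef s x i * X i grad2 (\<phi> s x))) (at s)"
      by (rule horizontal_chain[OF D flow_deriv[OF x(1) s]])
    also have "(\<Sum>i<length xs. coef s x i * X i grad2 (\<phi> s x)) =
        N (\<phi> s x) / (s * grad2 (\<phi> s x)) * (\<Sum>i<length xs. X i grad2 (\<phi> s x) * X i N (\<phi> s x))"
      by (simp add: coef_def sum_distrib_left mult_ac)
    also have "\<dots> = 0" using polz flow_nonzero[OF x(1) s] by (simp add: polarizable_def)
    finally show "((\<lambda>s. grad2 (\<phi> s x)) has_field_derivative 0) (at s within {0<..})"
      by (rule has_field_derivative_at_within)
  qed auto
  then obtain c where c: "\<forall>s\<in>{0<..}. grad2 (\<phi> s x) = c" ..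
  have "grad2 (\<phi> s x) = c" "grad2 (\<phi> 1 x) = c" using bspec[OF c, of s] bspec[OF c, of 1] s by simp_all
  then show ?thesis unfolding flow_1[OF x(1)] by (rule trans[OF _ sym])
qed

text \<open>The speed of a flow line is \<open>N x / sqrt (grad2 x)\<close> at all times: the factor
  \<open>s\<close> in \<open>N (\<phi> s x)\<close> cancels against the \<open>s\<close> in the
  denominator of \<open>coef\<close>.\<close>

lemma coef_sq_sum:
  assumes x: "x \<notin> Z" "x \<in> W" and s: "s > 0"
  shows "(\<Sum>i<length xs. (coef s x i)\<^sup>2) = (N x)\<^sup>2 / grad2 x"
proof -
  have g: "grad2 x > 0" using grad2_pos[OF x(1)] .
  have "(\<Sum>i<length xs. (coef s x i)\<^sup>2) = (N x / grad2 x)\<^sup>2 * (\<Sum>i<length xs. (X i N (\<phi> s x))\<^sup>2)"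
    unfolding sum_distrib_left
  proof (rule sum.cong[OF refl])
    fix i
    have "coef s x i = (N x / grad2 x) * X i N (\<phi> s x)"
      unfolding coef_def flow_N[OF x s] flow_grad2[OF x s] using s by simp
    then show "(coef s x i)\<^sup>2 = (N x / grad2 x)\<^sup>2 * (X i N (\<phi> s x))\<^sup>2" by (simp only: power_mult_distrib)
  qed
  moreover have "(\<Sum>i<length xs. (X i N (\<phi> s x))\<^sup>2) = grad2 x"
    using flow_grad2[OF x s] by (simp add: hgrad_sq_def)
  moreover have "(N x / grad2 x)\<^sup>2 * grad2 x = (N x)\<^sup>2 / grad2 x"
    using g by (simp add: power_divide power2_eq_square)
  ultimately show ?thesis by simp
qed

end

section \<open>The fundamental solution does not vanish\<close>

context polar_carnot
begin

lemma space_v: "space v = {x. N x = 1} - Z"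
proof -
  have "sets v = sets (restrict_space lborel ({x. N x = 1} - Z))" using polm by (simp add: polar_measure_def)
  from sets_eq_imp_space_eq[OF this] show ?thesis by (simp add: space_restrict_space)
qed

lemma space_vD: "\<xi> \<in> space v \<Longrightarrow> \<xi> \<notin> Z" "\<xi> \<in> space v \<Longrightarrow> N \<xi> = 1" "\<xi> \<in> space v \<Longrightarrow> \<xi> \<in> W"
  using N_pos_iff[of \<xi>] by (auto simp: space_v)

lemma polar_formula:
  assumes "integrable lborel f"
  shows "(\<integral>x. f x \<partial>lborel) = (\<integral>\<xi>. (LINT s:{0<..}|lborel. f (\<phi> s \<xi>) * s powr (Q - 1)) \<partial>v)"
  using polm assms unfolding polar_measure_def by blast

definition A :: "'a set" where "A = {x. x \<noteq> 0 \<and> u x = 0}"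

lemma A_closed: "closed (insert 0 A)"
proof -
  have "insert 0 A = - W" by (auto simp: A_def W_def)
  then show ?thesis using W_open by (simp add: closed_Compl)
qed

text \<open>The radial flow never meets \<open>A\<close>, so by the polar formula \<open>A\<close> carries no mass.\<close>

lemma A_no_ball:
  assumes "e > 0"
  shows "\<not> ball x e \<subseteq> A"
proof
  assume sub: "ball x e \<subseteq> A"
  define f where "f = (indicat_real (ball x e))"
  have "integrable lborel f" unfolding f_def by (rule integrable_real_indicator) (use emeasure_lborel_ball_finite[of x e] in auto)
  from polar_formula[OF this]
  have "measure lborel (ball x e) = (\<integral>\<xi>. (LINT s:{0<..}|lborel. f (\<phi> s \<xi>) * s powr (Q - 1)) \<partial>v)"
    by (simp add: f_def)
  also have "\<dots> = (\<integral>\<xi>. 0 \<partial>v)"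
  proof (rule Bochner_Integration.integral_cong[OF refl])
    fix \<xi> assume xi: "\<xi> \<in> space v"
    have "f (\<phi> s \<xi>) = 0" if "s > 0" for s
      using flow_W[OF space_vD(1,3)[OF xi] that] sub by (auto simp: f_def W_def A_def indicator_def)
    then have "(\<lambda>s. indicat_real {0<..} s *\<^sub>R (f (\<phi> s \<xi>) * s powr (Q - 1))) = (\<lambda>s. 0)"
      by (auto simp: fun_eq_iff indicator_def)
    then show "(LINT s:{0<..}|lborel. f (\<phi> s \<xi>) * s powr (Q - 1)) = 0"
      unfolding set_lebesgue_integral_def by simp
  qed
  finally have "measure lborel (ball x e) = 0" by simp
  then show False using content_ball_pos[OF assms, of x] by simp
qed

text \<open>Followed backwards from \<open>x\<close>, the flow line must leave the ball of radius
  \<rho> about \<open>x\<close> because |u| blows up along it, so it covers a Euclidean distance of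
  at least \<rho> in parameter time less than 1. Its horizontal speed is
  \<open>N x / sqrt (grad2 x)\<close>, so this quotient cannot be too small.\<close>

lemma grad_le_N:
  assumes z: "z \<noteq> 0"
  obtains M where "M \<ge> 0" "\<And>x. x \<in> W \<Longrightarrow> x \<in> ball z (norm z / 4) \<Longrightarrow> sqrt (grad2 x) \<le> M * N x"
proof -
  define \<rho> where "\<rho> = norm z / 4"
  have \<rho>: "\<rho> > 0" using z by (simp add: \<rho>_def)
  define B where "B = cball z (2 * \<rho>)"
  have B0: "0 \<notin> B" using z by (simp add: B_def \<rho>_def)
  have B: "compact B" by (simp add: B_def)
  have "\<exists>h. \<forall>y\<in>B. norm (hvec m y w) \<le> h" for w
  proof -
    have "bounded ((\<lambda>y. hvec m y w) ` B)"
      by (intro compact_imp_bounded compact_continuous_image continuous_on_hvec B)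
    then show ?thesis by (auto simp: bounded_iff)
  qed
  then obtain h where h: "\<And>w y. y \<in> B \<Longrightarrow> norm (hvec m y w) \<le> h w" by metis
  define H where "H = (\<Sum>i<length xs. \<bar>h (xs ! i)\<bar>)"
  have H: "H \<ge> 0" by (simp add: H_def sum_nonneg)
  have "bounded (u ` B)"
    by (intro compact_imp_bounded compact_continuous_image continuous_on_subset[OF u_cont] B) (use B0 in auto)
  then obtain Ub where Ub: "\<And>y. y \<in> B \<Longrightarrow> \<bar>u y\<bar> \<le> Ub" by (auto simp: bounded_iff)
  have zB: "z \<in> B" using \<rho> by (simp add: B_def)
  have Ub0: "Ub \<ge> 0" using Ub[OF zB] by linarith
  have main: "sqrt (grad2 x) \<le> H / \<rho> * N x" if xW: "x \<in> W" and xz: "x \<in> ball z \<rho>" for x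
  proof (cases "x \<in> Z")
    case True
    then have "grad2 x = 0" using xW grad2_Z by (auto simp: W_def)
    then show ?thesis using H \<rho> N_nonneg[of x] by simp
  next
    case xZ: False
    have g: "grad2 x > 0" by (rule grad2_pos[OF xZ])
    define L0 where "L0 = N x / sqrt (grad2 x)"
    have L0: "L0 \<ge> 0" using N_nonneg[of x] grad2_nonneg[of x] by (simp add: L0_def)
    have ux: "\<bar>u x\<bar> > 0" using xW by (simp add: W_def)
    have dB: "y \<in> B" if "dist y x < \<rho>" for y
      using that xz dist_triangle[of z y x] by (simp add: B_def dist_commute)
    \<comment> \<open>\<open>q\<close> and \<open>s1\<close> solve
      \<open>s1 powr (2 - Q) * \<bar>u x\<bar> = Ub + \<bar>u x\<bar> + 1\<close>, a value that |u|
      does not reach on \<open>B\<close>; the extra terms ensure \<open>q < 1\<close>, so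
      \<open>s1\<close> lies before time 1.\<close>
    define q where "q = \<bar>u x\<bar> / (Ub + \<bar>u x\<bar> + 1)"
    have q: "0 < q" "q < 1" using ux Ub0 by (auto simp: q_def)
    define s1 where "s1 = q powr (1 / (Q - 2))"
    have s1: "0 < s1" "s1 < 1" using q Q_gt powr_less_mono2[of "1 / (Q - 2)" q 1] by (auto simp: s1_def)
    have "(1 / (Q - 2)) * (2 - Q) = - 1" using Q_gt by (simp add: field_simps)
    then have s1p: "s1 powr (2 - Q) = 1 / q" using q by (simp add: s1_def powr_powr powr_minus_divide)
    have "\<bar>u (\<phi> s1 x)\<bar> = Ub + \<bar>u x\<bar> + 1"
      unfolding flow_u[OF xZ xW s1(1)] s1p using ux Ub0 by (simp add: q_def abs_mult)
    then have "\<phi> s1 x \<notin> B" using Ub[of "\<phi> s1 x"] ux by fastforce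
    then have far: "dist (\<phi> s1 x) x \<ge> \<rho>" using dB[of "\<phi> s1 x"] by fastforce
    have pc: "continuous_on {s1..1} (\<lambda>s. \<phi> s x)"
      using s1 by (intro continuous_at_imp_continuous_on ballI flow_isCont[OF xZ]) auto
    \<comment> \<open>The largest element \<open>c\<close> of \<open>K\<close> is the last time at
      distance \<rho> or more from \<open>x\<close>; after it the line stays in \<open>B\<close>,
      where the fields are bounded.\<close>
    define K where "K = {s \<in> {s1..1}. \<rho> \<le> dist (\<phi> s x) x}"
    have "closed K" unfolding K_def
      by (intro continuous_on_closed_Collect_le continuous_on_const continuous_on_dist pc) auto
    moreover have "bounded K" unfolding K_def by (rule bounded_subset[of "{s1..1}"]) auto
    ultimately have "compact K" by (simp add: compact_eq_bounded_closed)
    moreover have "s1 \<in> K" using s1 far by (simp add: K_def)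
    ultimately obtain c where c: "c \<in> K" "\<And>s. s \<in> K \<Longrightarrow> s \<le> c"
      using compact_attains_sup[of K] by blast
    have "c \<noteq> 1" using c(1) \<rho> flow_1[OF xZ] by (auto simp: K_def)
    then have c1: "s1 \<le> c" "c < 1" "\<rho> \<le> dist (\<phi> c x) x" using c(1) by (auto simp: K_def)
    define D where "D = (\<lambda>s. \<Sum>i<length xs. coef s x i *\<^sub>R hvec m (\<phi> s x) (xs ! i))"
    have "\<exists>s\<in>{c<..<1}. norm (\<phi> 1 x - \<phi> c x) \<le> norm ((1 - c) *\<^sub>R D s)"
    proof (rule mvt_general[OF c1(2)])
      show "continuous_on {c..1} (\<lambda>s. \<phi> s x)" using c1 by (intro continuous_on_subset[OF pc]) auto
      fix s assume "c < s" "s < 1"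
      then show "((\<lambda>s. \<phi> s x) has_derivative (\<lambda>h. h *\<^sub>R D s)) (at s)"
        using flow_deriv[OF xZ, of s] c1 s1 by (simp add: has_vector_derivative_def D_def)
    qed
    then obtain s where s: "c < s" "s < 1" "norm (\<phi> 1 x - \<phi> c x) \<le> norm ((1 - c) *\<^sub>R D s)" by auto
    have s0: "s > 0" using s c1 s1 by simp
    have "s \<notin> K" using c(2)[of s] s by fastforce
    then have "\<phi> s x \<in> B" using s c1 by (intro dB) (auto simp: K_def)
    note hB = h[OF this]
    have "norm (D s) \<le> (\<Sum>i<length xs. L0 * \<bar>h (xs ! i)\<bar>)"
      unfolding D_def
    proof (rule sum_norm_le)
      fix i assume i: "i \<in> {..<length xs}"
      have "(coef s x i)\<^sup>2 \<le> (\<Sum>i<length xs. (coef s x i)\<^sup>2)"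
        by (rule member_le_sum) (use i in auto)
      also have "\<dots> = L0\<^sup>2" unfolding coef_sq_sum[OF xZ xW s0] using g by (simp add: L0_def power_divide)
      finally have "\<bar>coef s x i\<bar> \<le> L0" using L0 by (simp add: abs_le_square_iff[symmetric])
      moreover have "norm (hvec m (\<phi> s x) (xs ! i)) \<le> \<bar>h (xs ! i)\<bar>" using hB[of "xs ! i"] by linarith
      ultimately show "norm (coef s x i *\<^sub>R hvec m (\<phi> s x) (xs ! i)) \<le> L0 * \<bar>h (xs ! i)\<bar>"
        using L0 by (simp add: mult_mono)
    qed
    then have DH: "norm (D s) \<le> L0 * H" by (simp add: H_def sum_distrib_left)
    have "\<rho> \<le> norm (\<phi> 1 x - \<phi> c x)" using c1(3) flow_1[OF xZ] by (simp add: dist_norm norm_minus_commute)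
    also have "\<dots> \<le> (1 - c) * norm (D s)" using s(3) c1 by simp
    also have "\<dots> \<le> 1 * (L0 * H)" using c1 s1 DH by (intro mult_mono) auto
    finally have "\<rho> \<le> N x * H / sqrt (grad2 x)" by (simp add: L0_def)
    then have "\<rho> * sqrt (grad2 x) \<le> N x * H" using g by (simp add: pos_le_divide_eq)
    then show ?thesis using \<rho> by (simp add: pos_le_divide_eq mult_ac)
  qed
  show thesis
    by (rule that[of "H / \<rho>"]) (use H \<rho> main in \<open>auto simp: \<rho>_def\<close>)
qed

text \<open>On \<open>W\<close> this rewrites \<open>grad_le_N\<close> in terms of \<open>u\<close>.
  In general both sides are continuous, so a violation would spread over a ball; that ball would lie
  in \<open>A\<close>, which contains none.\<close>

lemma X_u_le:
  assumes z: "z \<noteq> 0"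
  obtains M where "\<And>x i. x \<in> ball z (norm z / 4) \<Longrightarrow> i < length xs \<Longrightarrow> \<bar>X i u x\<bar> \<le> M * \<bar>u x\<bar>"
proof -
  obtain M where M: "M \<ge> 0" "\<And>x. x \<in> W \<Longrightarrow> x \<in> ball z (norm z / 4) \<Longrightarrow> sqrt (grad2 x) \<le> M * N x"
    using grad_le_N[OF z] by blast
  define C where "C = M / \<bar>\<kappa>\<bar>"
  have inW: "\<bar>X i u x\<bar> \<le> C * \<bar>u x\<bar>" if x: "x \<in> W" "x \<in> ball z (norm z / 4)" and i: "i < length xs" for x i
  proof -
    have "(X i N x)\<^sup>2 \<le> grad2 x" unfolding hgrad_sq_def by (rule member_le_sum) (use i in auto)
    then have "\<bar>X i N x\<bar> \<le> sqrt (grad2 x)" by (simp add: real_le_rsqrt)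
    then have "\<bar>X i N x\<bar> \<le> M * N x" using M(2)[OF x] by simp
    moreover have "\<bar>X i N x\<bar> = \<bar>\<kappa>\<bar> * N x / \<bar>u x\<bar> * \<bar>X i u x\<bar>"
      using N_nonneg[of x] by (simp add: X_N[OF x(1)] abs_mult)
    ultimately have "\<bar>\<kappa>\<bar> * N x / \<bar>u x\<bar> * \<bar>X i u x\<bar> \<le> M * N x" by simp
    then have "\<bar>\<kappa>\<bar> * \<bar>X i u x\<bar> \<le> M * \<bar>u x\<bar>"
      using N_pos[OF x(1)] x(1) by (simp add: W_def field_simps)
    then show ?thesis using \<kappa>_neg by (simp add: C_def field_simps)
  qed
  have "\<bar>X i u x\<bar> \<le> C * \<bar>u x\<bar>" if x: "x \<in> ball z (norm z / 4)" and i: "i < length xs" for x i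
  proof (rule ccontr)
    assume neg: "\<not> ?thesis"
    have nz: "y \<noteq> 0" if "y \<in> ball z (norm z / 4)" for y
      using that z by auto
    have cont: "continuous_on (ball z (norm z / 4)) (\<lambda>y. C * \<bar>u y\<bar>)" "continuous_on (ball z (norm z / 4)) (\<lambda>y. \<bar>X i u y\<bar>)"
      by (auto intro!: continuous_at_imp_continuous_on continuous_intros u_isCont X_u_isCont nz)
    have "open {y \<in> ball z (norm z / 4). C * \<bar>u y\<bar> < \<bar>X i u y\<bar>}"
    proof -
      have "{y \<in> ball z (norm z / 4). C * \<bar>u y\<bar> < \<bar>X i u y\<bar>} =
          ball z (norm z / 4) \<inter> (\<lambda>y. \<bar>X i u y\<bar> - C * \<bar>u y\<bar>) -` {0<..}" by auto
      then show ?thesis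
        using continuous_open_preimage[OF continuous_on_diff[OF cont(2,1)], of "{0<..}"] by auto
    qed
    moreover have "x \<in> {y \<in> ball z (norm z / 4). C * \<bar>u y\<bar> < \<bar>X i u y\<bar>}" using x neg by simp
    ultimately obtain e where e: "e > 0" "ball x e \<subseteq> {y \<in> ball z (norm z / 4). C * \<bar>u y\<bar> < \<bar>X i u y\<bar>}"
      using open_contains_ball by blast
    have "ball x e \<subseteq> A"
    proof
      fix y assume "y \<in> ball x e"
      then have y: "y \<in> ball z (norm z / 4)" "C * \<bar>u y\<bar> < \<bar>X i u y\<bar>" using e by auto
      then have "y \<notin> W" using inW[OF _ y(1) i] by force
      then show "y \<in> A" using nz[OF y(1)] by (simp add: A_def W_def)
    qed
    with A_no_ball[OF e(1)] show False by blast
  qed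
  with that show thesis by blast
qed

lemma X_u_scale: "y \<noteq> 0 \<Longrightarrow> Xf m (c *\<^sub>R w) u y = c * Xf m w u y"
  by (simp add: X_u linear_scale[OF linear_hvec] linear_scale[OF has_derivative_linear[OF u_has_derivative]])

text \<open>The bound of \<open>X_u_le\<close> makes \<open>u\<close> satisfy a linear differential
  inequality along horizontal flow lines, so a zero persists. The sign \<open>\<sigma>\<close>
  covers both time directions.\<close>

lemma loc_inv_A:
  assumes i: "i < length xs" and \<sigma>: "\<bar>\<sigma>\<bar> = 1"
  shows "loc_inv A (\<sigma> *\<^sub>R xs ! i)"
  unfolding loc_inv_def
proof (intro allI impI)
  fix z :: 'a assume z: "z \<noteq> 0"
  define w where "w = \<sigma> *\<^sub>R xs ! i"
  obtain M where M: "\<And>x i. x \<in> ball z (norm z / 4) \<Longrightarrow> i < length xs \<Longrightarrow> \<bar>X i u x\<bar> \<le> M * \<bar>u x\<bar>"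
    using X_u_le[OF z] by blast
  obtain r where r: "r > 0" "\<And>y t. y \<in> ball z r \<Longrightarrow> \<bar>t\<bar> \<le> r \<Longrightarrow> m y (t *\<^sub>R w) \<in> ball z (norm z / 4)"
    using m_line_near[of "norm z / 4" z w] z by auto
  have nz: "y \<noteq> 0" if "y \<in> ball z (norm z / 4)" for y using that z by auto
  have "m y (t *\<^sub>R w) \<in> A" if y: "y \<in> A \<inter> ball z r" and t: "t \<in> {0..r}" for y t
  proof -
    have yb: "m y (s *\<^sub>R w) \<in> ball z (norm z / 4)" if "s \<in> {0..r}" for s using r(2)[of y s] y that by auto
    have "u (m y (t *\<^sub>R w)) = 0"
    proof (rule DERIV_abs_le_imp_zero[where f="\<lambda>s. u (m y (s *\<^sub>R w))" and M=M, OF _ _ _ t])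
      fix s assume s: "s \<in> {0..r}"
      note nzs = nz[OF yb[OF s]]
      note lin = has_derivative_linear[OF u_has_derivative[OF nzs]]
      have "((\<lambda>s. u (m y (s *\<^sub>R w))) has_derivative (\<lambda>h. Du (m y (s *\<^sub>R w)) (h *\<^sub>R hvec m (m y (s *\<^sub>R w)) w))) (at s)"
        by (rule has_derivative_compose[OF hvec_DERIV[unfolded has_vector_derivative_def] u_has_derivative[OF nzs]])
      then show "((\<lambda>s. u (m y (s *\<^sub>R w))) has_real_derivative Xf m w u (m y (s *\<^sub>R w))) (at s)"
        unfolding has_field_derivative_def
        by (rule has_derivative_eq_rhs) (simp add: fun_eq_iff linear_scale[OF lin] X_u[OF nzs] mult.commute)
      have "Xf m w u (m y (s *\<^sub>R w)) = \<sigma> * X i u (m y (s *\<^sub>R w))"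
        unfolding w_def[symmetric] by (subst (1) w_def) (rule X_u_scale[OF nzs])
      then show "\<bar>Xf m w u (m y (s *\<^sub>R w))\<bar> \<le> M * \<bar>u (m y (s *\<^sub>R w))\<bar>"
        using M[OF yb[OF s] i] \<sigma> by (simp add: abs_mult)
    next
      show "u (m y (0 *\<^sub>R w)) = 0" using y by (simp add: A_def)
    qed
    then show ?thesis using nz[OF yb[OF t]] by (simp add: A_def)
  qed
  then show "\<exists>r>0. \<forall>y\<in>A \<inter> ball z r. \<forall>t\<in>{0..r}. m y (t *\<^sub>R \<sigma> *\<^sub>R xs ! i) \<in> A"
    using r(1) unfolding w_def by blast
qed

theorem u_nonzero: "x \<noteq> 0 \<Longrightarrow> u x \<noteq> 0"
proof
  assume "x \<noteq> 0" "u x = 0"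
  then have x: "x \<in> A" by (simp add: A_def)
  have A0: "0 \<notin> A" by (simp add: A_def)
  have "loc_inv A w" for w
  proof (rule loc_inv_all[OF A_closed A0])
    fix y assume "y \<in> set xs"
    then obtain i where "i < length xs" "y = xs ! i" by (auto simp: in_set_conv_nth)
    then show "loc_inv A y \<and> loc_inv A (- y)" using loc_inv_A[of i 1] loc_inv_A[of i "-1"] by simp
  qed
  from loc_inv_imp_open[OF A_closed A0 this x] A_no_ball show False by blast
qed

lemma W_eq: "W = - {0}"
  using u_nonzero by (auto simp: W_def)

end

section \<open>Dilations\<close>

context carnot
begin

text \<open>The definition expresses directness of the sum of layers by a dimension count. Bases of
  the layers together span the space and have at most as many elements as its dimension, so they
  form a basis; \<open>d\<close> records the layer of each element.\<close>

lemma graded_basis: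
  obtains B :: "'a set" and d :: "'a \<Rightarrow> nat" where "finite B" "independent B" "span B = UNIV"
    "\<And>b. b \<in> B \<Longrightarrow> 1 \<le> d b" "\<And>i w. i \<in> {1..l} \<Longrightarrow> w \<in> V i \<Longrightarrow> w \<in> span {b \<in> B. d b = i}"
proof -
  have "\<exists>C. C \<subseteq> V i \<and> independent C \<and> V i \<subseteq> span C \<and> card C = dim (V i)" for i
    using basis_exists[of "V i"] by metis
  then obtain C where C: "\<And>i. C i \<subseteq> V i" "\<And>i. independent (C i)" "\<And>i. V i \<subseteq> span (C i)" "\<And>i. card (C i) = dim (V i)"
    by metis
  have fin: "finite (C i)" for i using C(2) by (rule independent_imp_finite)
  define B where "B = (\<Union>i\<in>{1..l}. C i)"
  have finB: "finite B" using fin by (simp add: B_def)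
  have spB: "span B = UNIV"
  proof -
    have "(\<Union>i\<in>{1..l}. V i) \<subseteq> span B"
    proof (rule UN_least)
      fix i assume "i \<in> {1..l}"
      then have "span (C i) \<subseteq> span B" by (intro span_mono) (auto simp: B_def)
      then show "V i \<subseteq> span B" using C(3) by blast
    qed
    then have "span (\<Union>i\<in>{1..l}. V i) \<subseteq> span B" by (simp add: span_minimal)
    then show ?thesis using layers(3) by auto
  qed
  have dimU: "DIM('a) \<le> card B"
    using dim_le_card[of "UNIV :: 'a set" B] spB finB by (simp add: dim_UNIV)
  have card_le: "card (\<Union>i\<in>{1..l}. C' i) \<le> (\<Sum>i=1..l. card (C' i))" for C' :: "nat \<Rightarrow> 'a set"
    by (rule card_UN_le) simp
  have sumC: "(\<Sum>i=1..l. card (C i)) = DIM('a)" using layers(4) C(4) by simp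
  have "card B \<le> DIM('a)" using card_le[of C] sumC by (simp add: B_def)
  then have ind: "independent B"
    using card_le_dim_spanning[of B "UNIV :: 'a set"] spB finB by (simp add: dim_UNIV)
  have disj: "i = j" if b: "b \<in> C i" "b \<in> C j" and ij: "i \<in> {1..l}" "j \<in> {1..l}" for b i j
  proof (rule ccontr)
    assume neq: "i \<noteq> j"
    \<comment> \<open>Counting a shared element \<open>b\<close> only once would leave a spanning
      set with fewer elements than the dimension.\<close>
    define C' where "C' = (\<lambda>k. if k = j then C j - {b} else C k)"
    have "B = (\<Union>k\<in>{1..l}. C' k)"
    proof
      show "B \<subseteq> (\<Union>k\<in>{1..l}. C' k)"
      proof
        fix x assume "x \<in> B"
        then obtain k where k: "k \<in> {1..l}" "x \<in> C k" by (auto simp: B_def)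
        show "x \<in> (\<Union>k\<in>{1..l}. C' k)"
        proof (cases "k = j \<and> x = b")
          case True
          then show ?thesis using b ij neq by (intro UN_I[of i]) (auto simp: C'_def)
        next
          case False
          then show ?thesis using k by (intro UN_I[of k]) (auto simp: C'_def)
        qed
      qed
    qed (auto simp: B_def C'_def split: if_splits)
    then have "card B \<le> (\<Sum>k=1..l. card (C' k))" using card_le[of C'] by simp
    also have "\<dots> < (\<Sum>k=1..l. card (C k))"
    proof (rule sum_strict_mono_ex1)
      show "\<forall>k\<in>{1..l}. card (C' k) \<le> card (C k)" by (simp add: C'_def card_Diff1_le)
      show "\<exists>k\<in>{1..l}. card (C' k) < card (C k)"
        using card_Diff1_less[OF fin b(2)] ij by (intro bexI[of _ j]) (simp_all add: C'_def)
    qed simp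
    finally show False using dimU sumC by simp
  qed
  define d where "d = (\<lambda>b. SOME i. i \<in> {1..l} \<and> b \<in> C i)"
  have d: "d b \<in> {1..l} \<and> b \<in> C (d b)" if "b \<in> B" for b
  proof -
    have "\<exists>i. i \<in> {1..l} \<and> b \<in> C i" using that by (auto simp: B_def)
    from someI_ex[OF this] show ?thesis unfolding d_def .
  qed
  have dC: "d b = i" if "b \<in> C i" "i \<in> {1..l}" for b i
  proof -
    have "b \<in> B" using that by (auto simp: B_def)
    from d[OF this] have "d b \<in> {1..l}" "b \<in> C (d b)" by auto
    then show ?thesis using disj[of b "d b" i] that by simp
  qed
  show thesis
  proof (rule that[of B d])
    fix i w assume i: "i \<in> {1..l}" and w: "w \<in> V i"
    have "C i \<subseteq> {b \<in> B. d b = i}" 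
    proof
      fix b assume "b \<in> C i"
      then show "b \<in> {b \<in> B. d b = i}" using i dC[of b i] unfolding B_def by blast
    qed
    from span_mono[OF this] show "w \<in> span {b \<in> B. d b = i}" using C(3)[of i] w by (meson subsetD)
  next
    fix b assume "b \<in> B"
    from d[OF this] show "1 \<le> d b" by simp
  qed (use finB ind spB in auto)
qed

text \<open>\<open>dil\<close> is a definite description; the diagonal map \<open>D\<close> in the
  graded basis is the one linear map that fits it. In coordinates a dilation therefore acts by
  powers of \<open>r\<close>.\<close>

lemma dil_representation:
  obtains B :: "'a set" and d :: "'a \<Rightarrow> nat" and c :: "'a \<Rightarrow> 'a \<Rightarrow> real" where
    "finite B" "\<And>b. b \<in> B \<Longrightarrow> 1 \<le> d b" "\<And>b. b \<in> B \<Longrightarrow> linear (c b)"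
    "\<And>x. (\<Sum>b\<in>B. c b x *\<^sub>R b) = x"
    "\<And>r b x. b \<in> B \<Longrightarrow> c b (dil V l r x) = r ^ d b * c b x"
proof -
  obtain B :: "'a set" and d :: "'a \<Rightarrow> nat" where B: "finite B" "independent B" "span B = UNIV"
    and d1: "\<And>b. b \<in> B \<Longrightarrow> 1 \<le> d b" and sp: "\<And>i w. i \<in> {1..l} \<Longrightarrow> w \<in> V i \<Longrightarrow> w \<in> span {b \<in> B. d b = i}"
    using graded_basis by blast
  define c where "c = (\<lambda>b x. representation B x b)"
  have lin: "linear (c b)" for b
    using B by (intro linearI) (auto simp: c_def representation_add representation_scale)
  have rep: "(\<Sum>b\<in>B. c b x *\<^sub>R b) = x" for x
    unfolding c_def using B by (intro sum_representation_eq) auto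
  have cb: "c b b' = (if b' = b then 1 else 0)" if "b' \<in> B" for b b'
    using representation_basis[OF B(2) that] by (simp add: c_def)
  define D where "D = (\<lambda>r x. \<Sum>b\<in>B. (r ^ d b * c b x) *\<^sub>R b)"
  have linD: "linear (D r)" for r
    by (intro linearI)
       (simp_all add: D_def linear_add[OF lin] linear_scale[OF lin] algebra_simps sum.distrib scaleR_sum_right)
  have Db: "D r b = r ^ d b *\<^sub>R b" if "b \<in> B" for r b
  proof -
    have "D r b = (\<Sum>b'\<in>B. if b' = b then r ^ d b *\<^sub>R b else 0)"
      unfolding D_def by (rule sum.cong) (auto simp: cb that)
    then show ?thesis using that B(1) by simp
  qed
  have DV: "D r w = r ^ i *\<^sub>R w" if "i \<in> {1..l}" "w \<in> V i" for r i w
  proof (rule linear_eq_on[OF linD _ sp[OF that]])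
    show "linear (\<lambda>w. r ^ i *\<^sub>R w)" by (intro linearI) (auto simp: algebra_simps)
  qed (auto simp: Db)
  have dil: "dil V l r = D r" for r
    unfolding dil_def
  proof (rule the_equality)
    fix f assume f: "linear f \<and> (\<forall>i\<in>{1..l}. \<forall>v\<in>V i. f v = r ^ i *\<^sub>R v)"
    show "f = D r"
    proof
      fix x
      have "x \<in> span (\<Union>i\<in>{1..l}. V i)" using layers(3) by simp
      then show "f x = D r x"
        by (rule linear_eq_on[of f "D r", rotated 2]) (use f linD DV in auto)
    qed
  qed (use linD DV in auto)
  have cD: "c b (D r x) = r ^ d b * c b x" if b: "b \<in> B" for b r x
  proof -
    have "c b (D r x) = (\<Sum>b'\<in>B. (r ^ d b' * c b' x) * c b b')"
      by (simp add: D_def linear_sum[OF lin] linear_scale[OF lin])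
    also have "\<dots> = (\<Sum>b'\<in>B. if b' = b then r ^ d b * c b x else 0)"
      by (rule sum.cong) (auto simp: cb)
    finally show ?thesis using b B(1) by simp
  qed
  show thesis
    by (rule that[of B d c]) (use B d1 lin rep cD dil in auto)
qed

lemma dil_props:
  shows dil_one: "x \<noteq> 0 \<Longrightarrow> \<exists>r>0. norm (dil V l r x) = 1"
    and dil_bound: "\<exists>K>0. \<forall>r x. 0 \<le> r \<and> r \<le> R \<longrightarrow> norm (dil V l r x) \<le> K * norm x"
    and dil_inverse: "r > 0 \<Longrightarrow> dil V l (1 / r) (dil V l r x) = x"
proof -
  obtain B :: "'a set" and d :: "'a \<Rightarrow> nat" and c :: "'a \<Rightarrow> 'a \<Rightarrow> real" where
    B: "finite B" "\<And>b. b \<in> B \<Longrightarrow> 1 \<le> d b" and lin: "\<And>b. b \<in> B \<Longrightarrow> linear (c b)"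
    and rep: "\<And>x. (\<Sum>b\<in>B. c b x *\<^sub>R b) = x"
    and cd: "\<And>r b x. b \<in> B \<Longrightarrow> c b (dil V l r x) = r ^ d b * c b x"
    by (rule dil_representation) (rule that)
  have rd: "dil V l r x = (\<Sum>b\<in>B. (r ^ d b * c b x) *\<^sub>R b)" for r x
    using rep[of "dil V l r x"] by (simp add: cd)
  have "\<exists>C>0. \<forall>x. \<bar>c b x\<bar> \<le> norm x * C" if "b \<in> B" for b
    using bounded_linear.pos_bounded[OF linear_conv_bounded_linear[THEN iffD1, OF lin[OF that]]] by auto
  then obtain C where C: "\<And>b. b \<in> B \<Longrightarrow> C b > 0" "\<And>b x. b \<in> B \<Longrightarrow> \<bar>c b x\<bar> \<le> norm x * C b" by metis
  show "dil V l (1 / r) (dil V l r x) = x" if "r > 0" for r x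
  proof -
    have "dil V l (1 / r) (dil V l r x) = (\<Sum>b\<in>B. ((1 / r) ^ d b * c b (dil V l r x)) *\<^sub>R b)" by (rule rd)
    also have "\<dots> = (\<Sum>b\<in>B. c b x *\<^sub>R b)"
      using that by (intro sum.cong refl) (simp add: cd power_one_over)
    finally show ?thesis using rep[of x] by simp
  qed
  show "\<exists>K>0. \<forall>r x. 0 \<le> r \<and> r \<le> R \<longrightarrow> norm (dil V l r x) \<le> K * norm x" for R
  proof (intro exI conjI allI impI)
    define K where "K = (\<Sum>b\<in>B. \<bar>R\<bar> ^ d b * C b * norm b) + 1"
    have "(\<Sum>b\<in>B. \<bar>R\<bar> ^ d b * C b * norm b) \<ge> 0" using C(1) by (intro sum_nonneg) (simp add: less_imp_le)
    then show "K > 0" by (simp add: K_def)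
    fix r x assume r: "0 \<le> r \<and> r \<le> R"
    have "norm (dil V l r x) \<le> (\<Sum>b\<in>B. \<bar>R\<bar> ^ d b * C b * norm b * norm x)"
      unfolding rd
    proof (rule sum_norm_le)
      fix b assume b: "b \<in> B"
      have "r ^ d b * \<bar>c b x\<bar> * norm b \<le> \<bar>R\<bar> ^ d b * (norm x * C b) * norm b"
        using r C(2)[OF b] C(1)[OF b]
        by (intro mult_mono power_mono mult_nonneg_nonneg zero_le_power) (auto simp: less_imp_le)
      then show "norm ((r ^ d b * c b x) *\<^sub>R b) \<le> \<bar>R\<bar> ^ d b * C b * norm b * norm x"
        using r by (simp add: abs_mult mult_ac)
    qed
    also have "\<dots> = (K - 1) * norm x" by (simp add: K_def sum_distrib_right)
    also have "\<dots> \<le> K * norm x" by (simp add: left_diff_distrib)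
    finally show "norm (dil V l r x) \<le> K * norm x" .
  qed
  show "\<exists>r>0. norm (dil V l r x) = 1" if x: "x \<noteq> 0" for x
  proof -
    have "\<exists>b\<in>B. c b x \<noteq> 0"
    proof (rule ccontr)
      assume "\<not> ?thesis"
      then have "(\<Sum>b\<in>B. c b x *\<^sub>R b) = 0" by (intro sum.neutral) auto
      with rep[of x] x show False by simp
    qed
    then obtain b where b: "b \<in> B" "c b x \<noteq> 0" by blast
    \<comment> \<open>At this factor the coordinate along \<open>b\<close> alone forces norm at
      least 1; as the norm is 0 at factor 0, some factor in between gives norm 1.\<close>
    define R where "R = max 1 (C b / \<bar>c b x\<bar>)"
    have R: "R \<ge> 1" "C b \<le> R * \<bar>c b x\<bar>" using b by (auto simp: R_def max_def field_simps)
    have "C b \<le> R * \<bar>c b x\<bar>" by (rule R)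
    also have "\<dots> \<le> R ^ d b * \<bar>c b x\<bar>"
      using power_increasing[OF B(2)[OF b(1)] R(1)] by (intro mult_right_mono) auto
    also have "\<dots> = \<bar>c b (dil V l R x)\<bar>" using R(1) by (simp add: cd[OF b(1)] abs_mult)
    also have "\<dots> \<le> norm (dil V l R x) * C b" by (rule C(2)[OF b(1)])
    finally have ge: "1 \<le> norm (dil V l R x)" using C(1)[OF b(1)] by simp
    \<comment> \<open>Here \<open>1 \<le> d b\<close> matters: a basis vector of degree 0 would
      survive the factor 0.\<close>
    have z: "dil V l 0 x = 0" unfolding rd using B(2) by (intro sum.neutral ballI) (simp add: power_0_left, fastforce)
    have "continuous_on {0..R} (\<lambda>r. norm (dil V l r x))"
      unfolding rd by (intro continuous_intros)
    then obtain r where r: "0 \<le> r" "r \<le> R" "norm (dil V l r x) = 1"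
      using IVT'[of "\<lambda>r. norm (dil V l r x)" 0 1 R] ge z R by auto
    then have "r \<noteq> 0" using z by auto
    with r show ?thesis by (intro exI[of _ r]) auto
  qed
qed

end

section \<open>Homogeneity of \<open>N\<close> and compactness of its shells\<close>

context polar_carnot
begin

lemma N_cont: "continuous_on (- {0}) N"
  by (intro continuous_at_imp_continuous_on ballI N_isCont) (simp add: W_eq)

lemma N_dil:
  assumes "r > 0" "x \<noteq> 0" "dil V l r x \<noteq> 0"
  shows "N (dil V l r x) = r * N x"
proof -
  have "N (dil V l r x) = \<bar>r powr (2 - Q) * u x\<bar> powr \<kappa>"
    using assms by (simp add: N_eq powr_abs_base u_homogeneous)
  also have "\<dots> = (r powr (2 - Q)) powr \<kappa> * \<bar>u x\<bar> powr \<kappa>" by (simp add: abs_mult powr_mult)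
  also have "(r powr (2 - Q)) powr \<kappa> = r" using assms Q_gt by (simp add: powr_powr \<kappa>_def)
  finally show ?thesis using assms by (simp add: N_eq powr_abs_base)
qed

text \<open>A dilation brings each point of the shell to the unit sphere, where \<open>N\<close> has
  positive extrema. Homogeneity then bounds the dilation factor and its inverse, so the shell lies
  in a compact Euclidean annulus \<open>T\<close> that avoids 0, and \<open>N\<close> is continuous
  there.\<close>

lemma shell_compact:
  assumes "0 < a"
  shows "compact {x. a \<le> N x \<and> N x \<le> b}"
proof (cases "a \<le> b")
  case False
  then have e: "{x. a \<le> N x \<and> N x \<le> b} = {}" by auto
  show ?thesis unfolding e by simp
next
  case True
  have S: "compact (sphere (0::'a) 1)" "sphere (0::'a) 1 \<noteq> {}" "sphere (0::'a) 1 \<subseteq> - {0}"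
    by (rule compact_sphere, simp, auto)
  note NS = continuous_on_subset[OF N_cont S(3)]
  obtain x1 where x1: "norm x1 = 1" "\<And>y. norm y = 1 \<Longrightarrow> N x1 \<le> N y"
    using continuous_attains_inf[OF S(1,2) NS] unfolding Bex_def Ball_def mem_sphere_0 by blast
  obtain x2 where x2: "norm x2 = 1" "\<And>y. norm y = 1 \<Longrightarrow> N y \<le> N x2"
    using continuous_attains_sup[OF S(1,2) NS] unfolding Bex_def Ball_def mem_sphere_0 by blast
  have "x1 \<noteq> 0" "x2 \<noteq> 0" using x1(1) x2(1) by auto
  then have p: "N x1 > 0" "N x2 > 0" by (auto intro!: N_pos simp: W_eq)
  obtain K1 where K1: "K1 > 0" "\<And>r x. 0 \<le> r \<Longrightarrow> r \<le> N x2 / a \<Longrightarrow> norm (dil V l r x) \<le> K1 * norm x"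
    using dil_bound[of "N x2 / a"] by blast
  obtain K2 where K2: "K2 > 0" "\<And>r x. 0 \<le> r \<Longrightarrow> r \<le> b / N x1 \<Longrightarrow> norm (dil V l r x) \<le> K2 * norm x"
    using dil_bound[of "b / N x1"] by blast
  define T where "T = cball (0::'a) K2 - ball 0 (1 / K1)"
  have T: "compact T" unfolding T_def by (intro compact_diff) auto
  have T0: "T \<subseteq> - {0}" using K1 by (auto simp: T_def)
  have "{x. a \<le> N x \<and> N x \<le> b} \<subseteq> T"
  proof clarify
    fix x assume ab: "a \<le> N x" "N x \<le> b"
    then have "x \<in> W" using assms N_pos_iff[of x] by auto
    then have x: "x \<noteq> 0" by (simp add: W_eq)
    obtain r where r: "r > 0" "norm (dil V l r x) = 1" using dil_one[OF x] by blast
    then have N: "N (dil V l r x) = r * N x" by (intro N_dil x) auto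
    then have rN: "N x1 \<le> r * N x" "r * N x \<le> N x2" using x1(2)[OF r(2)] x2(2)[OF r(2)] by simp_all
    have Nx: "N x > 0" using ab assms by simp
    have "r * a \<le> N x2" using rN(2) ab(1) r(1) by (meson mult_left_mono less_imp_le order_trans)
    then have "1 \<le> K1 * norm x" using K1(2)[of r x] r assms by (simp add: pos_le_divide_eq)
    moreover have "N x1 \<le> r * b" using rN(1) ab(2) r(1) by (meson mult_left_mono less_imp_le order_trans)
    then have "1 / r \<le> b / N x1" using p r by (simp add: field_simps)
    then have "norm x \<le> K2"
      using K2(2)[of "1/r" "dil V l r x"] r by (simp add: dil_inverse)
    ultimately show "x \<in> T" using K1(1) by (simp add: T_def field_simps)
  qed
  then have "{x. a \<le> N x \<and> N x \<le> b} = T \<inter> N -` {a..b}" by auto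
  moreover have "closed (T \<inter> N -` {a..b})"
    by (rule continuous_closed_preimage[OF continuous_on_subset[OF N_cont T0] compact_imp_closed[OF T]]) simp
  ultimately show ?thesis using T compact_Int_closed[OF T, of "T \<inter> N -` {a..b}"] by (simp add: Int_absorb2 inf.absorb2)
qed

end

section \<open>Polar coordinates\<close>

text \<open>Young's inequality, from convexity of the exponential with weights
  \<open>1 - 1/p\<close> and \<open>1/p\<close>. It says that \<open>r powr p\<close> lies above its
  tangent at \<open>r = k\<close>; equality there is what makes the extremal density
  optimal.\<close>

lemma powr_tangent_le:
  fixes r k p :: real
  assumes "p > 1" "r \<ge> 0" "k \<ge> 0"
  shows "p * (k powr (p - 1) * r) \<le> r powr p + (p - 1) * k powr p"
proof (cases "r = 0 \<or> k = 0")
  case True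
  then show ?thesis using assms by auto
next
  case False
  then have rk: "r > 0" "k > 0" using assms by auto
  have "exp ((1 - 1/p) * (p * ln k) + (1/p) * (p * ln r)) \<le> (1 - 1/p) * exp (p * ln k) + (1/p) * exp (p * ln r)"
    using convex_onD[OF exp_convex, of "1/p" "p * ln k" "p * ln r"] assms by simp
  also have "(1 - 1/p) * (p * ln k) + (1/p) * (p * ln r) = (p - 1) * ln k + ln r"
    using assms by (simp add: field_simps)
  also have "exp \<dots> = k powr (p - 1) * r"
    using rk by (simp add: exp_add powr_def)
  finally have "k powr (p - 1) * r \<le> (1 - 1/p) * k powr p + (1/p) * r powr p"
    using rk by (simp add: powr_def)
  then have "p * (k powr (p - 1) * r) \<le> p * ((1 - 1/p) * k powr p + (1/p) * r powr p)"
    using assms by (intro mult_left_mono) auto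
  also have "\<dots> = r powr p + (p - 1) * k powr p" using assms by (simp add: field_simps)
  finally show ?thesis .
qed

locale polar_shell = polar_carnot m V l xs u \<phi> v
  for m :: "'a::euclidean_space \<Rightarrow> 'a \<Rightarrow> 'a" and V :: "nat \<Rightarrow> 'a set" and l :: nat and xs :: "'a list"
    and u :: "'a \<Rightarrow> real" and \<phi> :: "real \<Rightarrow> 'a \<Rightarrow> 'a" and v :: "'a measure" +
  fixes a b :: real
  assumes a_pos: "0 < a" and ab: "a < b"
begin

definition R :: "'a set" where "R = {x. a < N x \<and> N x < b}"

lemma R_subset: "R \<subseteq> - {0}"
  using a_pos by (auto simp: R_def normG_def)

lemma R_open: "open R"
proof -
  have "R = (- {0}) \<inter> N -` {a<..<b}" using R_subset by (auto simp: R_def)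
  then show ?thesis using continuous_open_preimage[OF N_cont, of "{a<..<b}"] by (simp add: open_Compl)
qed

lemma R_borel [measurable]: "R \<in> sets borel"
  using R_open by (rule borel_open)

text \<open>Dilating any nonzero vector to \<open>N = (a + b) / 2\<close> lands in the ring. Being
  open, the ring then has positive measure, on which \<open>J_v_integrable\<close> relies.\<close>

lemma R_nonempty: "R \<noteq> {}"
proof -
  obtain x :: 'a where x: "x \<in> Basis" using nonempty_Basis by blast
  then have x0: "x \<noteq> 0" by auto
  then have Nx: "N x > 0" by (intro N_pos) (simp add: W_eq)
  define r where "r = (a + b) / 2 / N x"
  have r: "r > 0" using Nx a_pos ab by (simp add: r_def)
  have "dil V l r x \<noteq> 0"
  proof
    assume "dil V l r x = 0"
    then have "dil V l (1 / r) 0 = x" using dil_inverse[OF r, of x] by simp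
    moreover obtain K where K: "\<forall>r' y. 0 \<le> r' \<and> r' \<le> 1 / r \<longrightarrow> norm (dil V l r' y) \<le> K * norm y"
      using dil_bound[of "1 / r"] by blast
    have "norm (dil V l (1 / r) 0) \<le> K * norm (0 :: 'a)" using K[rule_format, of "1 / r" 0] r by simp
    ultimately show False using x0 by simp
  qed
  from N_dil[OF r x0 this] have "N (dil V l r x) = (a + b) / 2" using Nx by (simp add: r_def)
  then have "dil V l r x \<in> R" using ab by (simp add: R_def)
  then show ?thesis by blast
qed

lemma R_finite: "emeasure lborel R < \<infinity>"
proof -
  have "bounded R"
    by (rule bounded_subset[OF compact_imp_bounded[OF shell_compact[OF a_pos, of b]]]) (auto simp: R_def)
  from emeasure_bounded_finite[OF this] show ?thesis by simp
qed

lemma R_measure_pos: "measure lborel R > 0"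
proof -
  obtain x where "x \<in> R" using R_nonempty by blast
  then obtain e where e: "e > 0" "ball x e \<subseteq> R" using R_open open_contains_ball by blast
  have "0 < measure lborel (ball x e)" by (rule content_ball_pos[OF e(1)])
  also have "\<dots> \<le> measure lborel R"
    by (rule measure_mono_fmeasurable[OF e(2)]) (use R_finite in \<open>auto simp: fmeasurable_def\<close>)
  finally show ?thesis .
qed

lemma bounded_integrable:
  fixes f :: "'a \<Rightarrow> real"
  assumes "f \<in> borel_measurable borel" "\<And>x. \<bar>f x\<bar> \<le> M" "\<And>x. x \<notin> R \<Longrightarrow> f x = 0"
  shows "integrable lborel f"
proof (rule Bochner_Integration.integrable_bound)
  have "integrable lborel (indicat_real R)" using R_finite by (intro integrable_real_indicator) auto
  then show "integrable lborel (\<lambda>x. \<bar>M\<bar> * indicat_real R x)" by (rule integrable_mult_right)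
  show "AE x in lborel. norm (f x) \<le> norm (\<bar>M\<bar> * indicat_real R x)"
  proof (rule AE_I2)
    fix x show "norm (f x) \<le> norm (\<bar>M\<bar> * indicat_real R x)"
      using assms(2)[of x] assms(3)[of x] by (cases "x \<in> R") auto
  qed
qed (use assms in simp)

lemma R_bounded_cont:
  assumes "continuous_on (- {0}) f"
  obtains M where "\<And>x. x \<in> R \<Longrightarrow> \<bar>f x :: real\<bar> \<le> M"
proof -
  have "{x. a \<le> N x \<and> N x \<le> b} \<subseteq> - {0}" using a_pos by (auto simp: normG_def)
  then have "bounded (f ` {x. a \<le> N x \<and> N x \<le> b})"
    by (intro compact_imp_bounded compact_continuous_image shell_compact[OF a_pos] continuous_on_subset[OF assms])
  then obtain M where M: "\<forall>y\<in>f ` {x. a \<le> N x \<and> N x \<le> b}. norm y \<le> M" unfolding bounded_iff by blast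
  show thesis
  proof (rule that)
    fix x assume "x \<in> R"
    then have "f x \<in> f ` {x. a \<le> N x \<and> N x \<le> b}" by (intro imageI) (simp add: R_def)
    with M have "norm (f x) \<le> M" by (rule bspec)
    then show "\<bar>f x\<bar> \<le> M" by simp
  qed
qed

lemma flow_in_R:
  assumes "\<xi> \<in> space v" "s > 0"
  shows "N (\<phi> s \<xi>) = s" "\<phi> s \<xi> \<in> R \<longleftrightarrow> s \<in> {a<..<b}"
proof -
  show N: "N (\<phi> s \<xi>) = s"
    unfolding flow_N[OF space_vD(1,3)[OF assms(1)] assms(2)] space_vD(2)[OF assms(1)] by simp
  show "\<phi> s \<xi> \<in> R \<longleftrightarrow> s \<in> {a<..<b}" unfolding R_def mem_Collect_eq N by simp
qed

text \<open>The flow is only controlled for positive \<open>s\<close>. Clamping the parameter to the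
  interval from \<open>a\<close> to \<open>b\<close> gives a continuous curve on the whole line
  without changing integrals over that interval.\<close>

lemma flow_measurable:
  assumes "\<xi> \<notin> Z" and [measurable]: "h \<in> borel_measurable borel"
  shows "(\<lambda>s. h (\<phi> (max a (min b s)) \<xi>)) \<in> borel_measurable borel"
proof -
  have "continuous_on {a..b} (\<lambda>s. \<phi> s \<xi>)"
    using a_pos by (intro continuous_at_imp_continuous_on ballI flow_isCont[OF assms(1)]) auto
  then have "continuous_on UNIV (\<lambda>s. \<phi> (max a (min b s)) \<xi>)"
  proof (rule continuous_on_compose2)
    show "continuous_on UNIV (\<lambda>s. max a (min b s))" by (intro continuous_intros)
    show "(\<lambda>s. max a (min b s)) ` UNIV \<subseteq> {a..b}" using ab by auto
  qed
  from borel_measurable_continuous_onI[OF this] assms(2) show ?thesis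
    by (rule measurable_compose)
qed

text \<open>The inner integral of the polar formula for functions that vanish off the ring; on a
  flow line the ring is the parameter interval from \<open>a\<close> to \<open>b\<close>.\<close>

definition J :: "('a \<Rightarrow> real) \<Rightarrow> 'a \<Rightarrow> real" where
  "J f \<xi> = (\<integral>s. indicator {a<..<b} s * (f (\<phi> s \<xi>) * s powr (Q - 1)) \<partial>lborel)"

lemma J_integrable:
  assumes xi: "\<xi> \<notin> Z" and f: "f \<in> borel_measurable borel" "\<And>x. \<bar>f x\<bar> \<le> M"
  shows "integrable lborel (\<lambda>s. indicator {a<..<b} s * (f (\<phi> s \<xi>) * s powr r))"
proof -
  \<comment> \<open>The power is monotone in one direction or the other, according to the sign of
    \<open>r\<close>, so its values at the endpoints bound it.\<close>
  define K where "K = max (a powr r) (b powr r)"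
  have K: "s powr r \<le> K" if "s \<in> {a<..<b}" for s
  proof (cases "r \<ge> 0")
    case True
    then have "s powr r \<le> b powr r" using that a_pos by (intro powr_mono2) auto
    then show ?thesis by (simp add: K_def)
  next
    case False
    then have "s powr r \<le> a powr r" using that a_pos by (intro powr_mono2') auto
    then show ?thesis by (simp add: K_def)
  qed
  have K0: "K \<ge> 0" by (simp add: K_def max_def)
  have M: "M \<ge> 0" using f(2)[of 0] by linarith
  have eq: "(\<lambda>s. indicator {a<..<b} s * (f (\<phi> s \<xi>) * s powr r)) =
      (\<lambda>s. indicator {a<..<b} s * (f (\<phi> (max a (min b s)) \<xi>) * s powr r))"
    by (auto simp: fun_eq_iff indicator_def)
  show ?thesis
  proof (rule Bochner_Integration.integrable_bound)
    show "integrable lborel (\<lambda>s. (M * K) * indicat_real {a<..<b} s)"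
      using ab by (intro integrable_mult_right integrable_real_indicator) auto
    show "(\<lambda>s. indicator {a<..<b} s * (f (\<phi> s \<xi>) * s powr r)) \<in> borel_measurable lborel"
      unfolding eq using flow_measurable[OF xi f(1)] by simp
    show "AE s in lborel. norm (indicator {a<..<b} s * (f (\<phi> s \<xi>) * s powr r)) \<le> norm ((M * K) * indicat_real {a<..<b} s)"
    proof (rule AE_I2)
      fix s :: real
      show "norm (indicator {a<..<b} s * (f (\<phi> s \<xi>) * s powr r)) \<le> norm ((M * K) * indicat_real {a<..<b} s)"
      proof (cases "s \<in> {a<..<b}")
        case True
        have "\<bar>f (\<phi> s \<xi>)\<bar> * s powr r \<le> M * K" using f(2) K[OF True] M by (intro mult_mono) auto
        then show ?thesis using True M K0 by (simp add: abs_mult)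
      qed simp
    qed
  qed
qed

lemma polar_J:
  fixes f :: "'a \<Rightarrow> real"
  assumes f: "f \<in> borel_measurable borel" "\<And>x. \<bar>f x\<bar> \<le> M" "\<And>x. x \<notin> R \<Longrightarrow> f x = 0"
  shows "(\<integral>x. f x \<partial>lborel) = (\<integral>\<xi>. J f \<xi> \<partial>v)"
proof (rule trans[OF polar_formula[OF bounded_integrable[OF f]] Bochner_Integration.integral_cong[OF refl]])
  fix \<xi> assume xi: "\<xi> \<in> space v"
  have "(\<lambda>s. indicator {0<..} s *\<^sub>R (f (\<phi> s \<xi>) * s powr (Q - 1))) = (\<lambda>s. indicator {a<..<b} s * (f (\<phi> s \<xi>) * s powr (Q - 1)))"
  proof
    fix s
    show "indicator {0<..} s *\<^sub>R (f (\<phi> s \<xi>) * s powr (Q - 1)) = indicator {a<..<b} s * (f (\<phi> s \<xi>) * s powr (Q - 1))"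
      using flow_in_R(2)[OF xi, of s] f(3)[of "\<phi> s \<xi>"] a_pos by (cases "s > 0") (auto simp: indicator_def)
  qed
  then show "(LINT s:{0<..}|lborel. f (\<phi> s \<xi>) * s powr (Q - 1)) = J f \<xi>"
    by (simp add: set_lebesgue_integral_def J_def)
qed

text \<open>The Bochner integral of a non-integrable function is 0, so adding a function with positive
  integral turns the polar formula into an integrability statement.\<close>

lemma J_v_integrable:
  fixes f :: "'a \<Rightarrow> real"
  assumes f: "f \<in> borel_measurable borel" "\<And>x. 0 \<le> f x" "\<And>x. f x \<le> M" "\<And>x. x \<notin> R \<Longrightarrow> f x = 0"
  shows "integrable v (J f)"
proof -
  have pos: "integrable v (J g)"
    if g: "g \<in> borel_measurable borel" "\<And>x. indicat_real R x \<le> g x" "\<And>x. g x \<le> M'" "\<And>x. x \<notin> R \<Longrightarrow> g x = 0" for g M'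
  proof (rule ccontr)
    assume "\<not> integrable v (J g)"
    then have 0: "(\<integral>\<xi>. J g \<xi> \<partial>v) = 0" by (rule not_integrable_integral_eq)
    have g0: "0 \<le> g x" for x by (rule order_trans[OF indicator_pos_le g(2)])
    have ab: "\<bar>g x\<bar> \<le> M'" for x using g0[of x] g(3)[of x] by simp
    have "measure lborel R = (\<integral>x. indicat_real R x \<partial>lborel)" by simp
    also have "\<dots> \<le> (\<integral>x. g x \<partial>lborel)"
      by (rule integral_mono[OF integrable_real_indicator bounded_integrable[OF g(1) ab g(4)] g(2)]) (use R_finite in auto)
    also have "\<dots> = 0" using polar_J[OF g(1) ab g(4)] 0 by simp
    finally show False using R_measure_pos by simp
  qed
  have iR: "indicat_real R \<in> borel_measurable borel" by simp
  have 1: "integrable v (J (indicat_real R))" 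
    by (rule pos[of "indicat_real R" 1]) (simp_all add: indicator_def)
  have 2: "integrable v (J (\<lambda>x. f x + indicat_real R x))"
  proof (rule pos)
    show "f x + indicat_real R x \<le> M + 1" for x
      by (intro add_mono f(3)) (simp add: indicator_def)
    show "(\<lambda>x. f x + indicat_real R x) \<in> borel_measurable borel" using f(1) by measurable
    show "indicat_real R x \<le> f x + indicat_real R x" for x using f(2)[of x] by simp
    show "x \<notin> R \<Longrightarrow> f x + indicat_real R x = 0" for x using f(4)[of x] by simp
  qed
  have abf: "\<bar>f x\<bar> \<le> M" for x using f(2)[of x] f(3)[of x] by simp
  have eq: "J f \<xi> = J (\<lambda>x. f x + indicat_real R x) \<xi> - J (indicat_real R) \<xi>" if "\<xi> \<in> space v" for \<xi>
  proof -
    note xi = space_vD(1)[OF that]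
    have iR1: "\<bar>indicat_real R x\<bar> \<le> 1" for x by (simp add: indicator_def)
    have "J (\<lambda>x. f x + indicat_real R x) \<xi> = (\<integral>s. indicator {a<..<b} s * (f (\<phi> s \<xi>) * s powr (Q - 1))
        + indicator {a<..<b} s * (indicat_real R (\<phi> s \<xi>) * s powr (Q - 1)) \<partial>lborel)"
      unfolding J_def by (simp only: distrib_left distrib_right)
    also have "\<dots> = J f \<xi> + J (indicat_real R) \<xi>"
      unfolding J_def
      by (rule Bochner_Integration.integral_add[OF J_integrable[OF xi f(1) abf] J_integrable[OF xi iR iR1]])
    finally show ?thesis by simp
  qed
  show ?thesis
    by (rule iffD2[OF Bochner_Integration.integrable_cong[OF refl eq] Bochner_Integration.integrable_diff[OF 2 1]])
qed

end

section \<open>The modulus\<close>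

lemma abs_cont_on_lipschitz:
  assumes "abs_cont_on I \<gamma>" and L: "L-lipschitz_on S F" and sub: "\<And>t. t \<in> I \<Longrightarrow> \<gamma> t \<in> S"
  shows "abs_cont_on I (\<lambda>t. F (\<gamma> t))"
  unfolding abs_cont_on_def
proof (intro allI impI)
  fix e :: real assume e: "e > 0"
  have L0: "L \<ge> 0" using L by (rule lipschitz_on_nonneg)
  then have e': "e / (L + 1) > 0" using e by simp
  obtain d where d: "d > 0" and D: "\<forall>D::(real \<times> real) set.
        nonoverlapping I d D \<longrightarrow> (\<Sum>(s, t)\<in>D. norm (\<gamma> t - \<gamma> s)) < e / (L + 1)"
    using assms(1)[unfolded abs_cont_on_def, THEN spec, THEN mp, OF e'] by (elim exE conjE)
  show "\<exists>\<delta>>0. \<forall>D::(real \<times> real) set.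
        nonoverlapping I \<delta> D \<longrightarrow> (\<Sum>(s, t)\<in>D. norm (F (\<gamma> t) - F (\<gamma> s))) < e"
  proof (rule exI[of _ d], rule conjI[OF d], rule allI, rule impI)
    fix D :: "(real \<times> real) set"
    assume A: "nonoverlapping I d D"
    have "(\<Sum>(s, t)\<in>D. norm (F (\<gamma> t) - F (\<gamma> s))) \<le> (\<Sum>(s, t)\<in>D. L * norm (\<gamma> t - \<gamma> s))"
    proof (rule sum_mono, clarify)
      fix s t assume "(s, t) \<in> D"
      then have "s \<le> t" "{s..t} \<subseteq> I" using A by auto
      then have "\<gamma> s \<in> S" "\<gamma> t \<in> S" using sub by auto
      then show "norm (F (\<gamma> t) - F (\<gamma> s)) \<le> L * norm (\<gamma> t - \<gamma> s)"
        using lipschitz_onD[OF L] by (simp add: dist_norm)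
    qed
    also have "\<dots> = L * (\<Sum>(s, t)\<in>D. norm (\<gamma> t - \<gamma> s))" by (simp add: sum_distrib_left split_def)
    also have "\<dots> \<le> L * (e / (L + 1))"
      using D[THEN spec, THEN mp, OF A] L0 by (intro mult_left_mono) auto
    also have "\<dots> < e" using e L0 by (simp add: field_simps)
    finally show "(\<Sum>(s, t)\<in>D. norm (F (\<gamma> t) - F (\<gamma> s))) < e" .
  qed
qed

context carnot
begin

lemma horizontal_span:
  assumes "w \<in> span (hvec m g ` set xs)"
  shows "\<exists>c. w = (hcomb c g)"
proof -
  define H where "H = range (\<lambda>c :: nat \<Rightarrow> real. \<Sum>i<length xs. c i *\<^sub>R hvec m g (xs ! i))"
  have "subspace H"
  proof (rule subspaceI)
    show "0 \<in> H" unfolding H_def by (rule range_eqI[of _ _ "\<lambda>_. 0"]) simp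
  next
    fix x y assume "x \<in> H" "y \<in> H"
    then obtain c d where "x = (hcomb c g)" "y = (hcomb d g)"
      unfolding H_def by blast
    then show "x + y \<in> H" unfolding H_def
      by (intro range_eqI[of _ _ "\<lambda>i. c i + d i"]) (simp add: scaleR_add_left sum.distrib)
  next
    fix r :: real and x assume "x \<in> H"
    then obtain c where "x = (hcomb c g)"
      unfolding H_def by blast
    then show "r *\<^sub>R x \<in> H" unfolding H_def
      by (intro range_eqI[of _ _ "\<lambda>i. r * c i"]) (simp add: scaleR_sum_right)
  qed
  moreover have "hvec m g ` set xs \<subseteq> H"
  proof clarify
    fix x assume "x \<in> set xs"
    then obtain j where j: "j < length xs" "x = xs ! j" by (auto simp: in_set_conv_nth)
    have "(\<Sum>i<length xs. (if i = j then 1 else 0) *\<^sub>R hvec m g (xs ! i)) = (\<Sum>i<length xs. if i = j then hvec m g (xs ! j) else 0)"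
      by (rule sum.cong) auto
    also have "\<dots> = hvec m g x" using j by simp
    finally show "hvec m g x \<in> H" unfolding H_def by (intro range_eqI[of _ _ "\<lambda>i. if i = j then 1 else 0"]) simp
  qed
  ultimately have "span (hvec m g ` set xs) \<subseteq> H" by (simp add: span_minimal)
  then show ?thesis using assms unfolding H_def by blast
qed

end

locale polar_modulus = polar_shell m V l xs u \<phi> v a b
  for m :: "'a::euclidean_space \<Rightarrow> 'a \<Rightarrow> 'a" and V :: "nat \<Rightarrow> 'a set" and l :: nat and xs :: "'a list"
    and u :: "'a \<Rightarrow> real" and \<phi> :: "real \<Rightarrow> 'a \<Rightarrow> 'a" and v :: "'a measure" and a b :: real +
  fixes p :: real
  assumes p_gt: "p > 1"
begin

definition q :: real where "q = (1 - Q) / (p - 1)"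
definition C :: real where "C = (\<integral>s. indicator {a<..<b} s * s powr q \<partial>lborel)"
definition slope :: "'a \<Rightarrow> real" where "slope \<xi> = sqrt (grad2 \<xi>)"

text \<open>A radial curve has speed \<open>1 / slope \<xi>\<close>, which the gradient factor
  cancels; division by \<open>C\<close> then gives every radial curve \<sigma>-length 1.\<close>

definition \<sigma> :: "'a \<Rightarrow> real" where
  "\<sigma> x = (if x \<in> R then sqrt (grad2 x) * N x powr q / C else 0)"

text \<open>The first identity removes the polar weight from \<open>\<sigma> powr (p - 1)\<close>;
  the second turns \<open>\<sigma> powr p\<close> with its weight back into the integrand of
  \<open>C\<close>.\<close>

lemma q_props: "(p - 1) * q + (Q - 1) = 0" "p * q + (Q - 1) = q"
  using p_gt by (simp_all add: q_def field_simps)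

lemma powr_antiderivative:
  obtains \<Phi> where "\<And>s. s > 0 \<Longrightarrow> (\<Phi> has_real_derivative s powr q) (at s)" "C = \<Phi> b - \<Phi> a"
proof -
  have "\<exists>\<Phi>. \<forall>s>0. (\<Phi> has_real_derivative s powr q) (at s)"
  proof (cases "q = - 1")
    \<comment> \<open>This is the conformal exponent \<open>p = Q\<close>, where the antiderivative
      is a logarithm.\<close>
    case True
    then show ?thesis
      by (intro exI[of _ ln]) (auto intro!: derivative_eq_intros simp: powr_minus_divide)
  next
    case False
    then show ?thesis
      by (intro exI[of _ "\<lambda>s. s powr (q + 1) / (q + 1)"]) (auto intro!: derivative_eq_intros)
  qed
  then obtain \<Phi> where \<Phi>: "\<And>s. s > 0 \<Longrightarrow> (\<Phi> has_real_derivative s powr q) (at s)" by blast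
  have "(LBINT s=a..b. s powr q) = \<Phi> b - \<Phi> a"
  proof (rule interval_integral_FTC_finite)
    show "continuous_on {min a b..max a b} (\<lambda>s. s powr q)"
      using a_pos ab by (intro continuous_intros) auto
    fix x assume "min a b \<le> x" "x \<le> max a b"
    then have "x > 0" using a_pos ab by auto
    then show "(\<Phi> has_vector_derivative x powr q) (at x within {min a b..max a b})"
      using \<Phi>[of x] by (simp add: has_field_derivative_at_within has_real_derivative_iff_has_vector_derivative[symmetric])
  qed
  moreover have "(LBINT s=a..b. s powr q) = C"
    using ab by (simp add: interval_integral_Ioo set_lebesgue_integral_def C_def)
  ultimately have "C = \<Phi> b - \<Phi> a" by simp
  with \<Phi> show thesis by (rule that)
qed

lemma C_LBINT: "(LBINT s=a..b. s powr ((1 - Q) / (p - 1))) = C"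
  using ab by (simp add: interval_integral_Ioo set_lebesgue_integral_def C_def q_def)

lemma C_pos: "C > 0"
proof (rule powr_antiderivative)
  fix \<Phi> assume \<Phi>: "\<And>s. s > 0 \<Longrightarrow> (\<Phi> has_real_derivative s powr q) (at s)" "C = \<Phi> b - \<Phi> a"
  have "\<Phi> a < \<Phi> b"
  proof (rule DERIV_pos_imp_increasing[OF ab])
    fix s assume "a \<le> s" "s \<le> b"
    then have "s > 0" using a_pos by simp
    then show "\<exists>y. (\<Phi> has_real_derivative y) (at s) \<and> y > 0" using \<Phi>(1) by (intro exI[of _ "s powr q"]) simp
  qed
  then show "C > 0" using \<Phi>(2) by simp
qed

lemma \<sigma>_nonneg: "\<sigma> x \<ge> 0"
  using C_pos N_nonneg[of x] grad2_nonneg[of x] by (simp add: \<sigma>_def)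

lemma grad_powr_cont: "continuous_on (- {0}) (\<lambda>x. sqrt (grad2 x) * N x powr q / C)"
proof (rule continuous_at_imp_continuous_on, rule ballI)
  fix x :: 'a assume "x \<in> - {0}"
  then have x: "x \<in> W" by (simp add: W_eq)
  show "isCont (\<lambda>x. sqrt (grad2 x) * N x powr q / C) x"
    using grad2_isCont[OF x] N_isCont[OF x] N_pos[OF x] C_pos
    by (intro continuous_intros) auto
qed

lemma \<sigma>_borel [measurable]: "\<sigma> \<in> borel_measurable borel"
proof -
  have "\<sigma> = (\<lambda>x. indicator R x *\<^sub>R (sqrt (grad2 x) * N x powr q / C))"
    by (simp add: fun_eq_iff \<sigma>_def indicator_def)
  then show ?thesis
    using borel_measurable_continuous_on_indicator[OF R_borel continuous_on_subset[OF grad_powr_cont R_subset]] by simp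
qed

lemma \<sigma>_bounded: obtains M where "M \<ge> 0" "\<And>x. \<sigma> x \<le> M"
proof -
  obtain M where M: "\<And>x. x \<in> R \<Longrightarrow> \<bar>sqrt (grad2 x) * N x powr q / C\<bar> \<le> M"
    using R_bounded_cont[OF grad_powr_cont] by blast
  have "\<sigma> x \<le> max M 0" for x
  proof (cases "x \<in> R")
    case True
    then have "\<sigma> x = sqrt (grad2 x) * N x powr q / C" by (simp add: \<sigma>_def)
    then show ?thesis using abs_le_D1[OF M[OF True]] by (simp add: le_max_iff_disj)
  qed (simp add: \<sigma>_def)
  then show thesis by (rule that[rotated]) simp
qed

lemma slope_pos: "\<xi> \<in> space v \<Longrightarrow> slope \<xi> > 0"
  using grad2_pos[OF space_vD(1)] by (simp add: slope_def)

lemma lam_eq: "\<xi> \<in> space v \<Longrightarrow> lam m xs N \<phi> \<xi> = slope \<xi>"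
  using space_vD[of \<xi>] flow_1[of \<xi>] by (simp add: lam_def slope_def)

lemma \<sigma>_flow:
  assumes "\<xi> \<in> space v" "s \<in> {a<..<b}"
  shows "\<sigma> (\<phi> s \<xi>) = slope \<xi> * s powr q / C"
proof -
  have s: "s > 0" using assms a_pos by simp
  show ?thesis
    using flow_in_R[OF assms(1) s] flow_grad2[OF space_vD(1,3)[OF assms(1)] s] assms(2)
    by (simp add: \<sigma>_def slope_def)
qed

lemma J_\<sigma>:
  assumes xi: "\<xi> \<in> space v"
  shows "J (\<lambda>x. \<sigma> x powr p) \<xi> = slope \<xi> powr p * C powr (1 - p)"
proof -
  have eq: "indicator {a<..<b} s * (\<sigma> (\<phi> s \<xi>) powr p * s powr (Q - 1)) = (slope \<xi> / C) powr p * (indicator {a<..<b} s * s powr q)" for s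
  proof (cases "s \<in> {a<..<b}")
    case True
    then have s: "s > 0" using a_pos by simp
    have "(slope \<xi> * s powr q / C) powr p * s powr (Q - 1) = (slope \<xi> / C) powr p * (s powr (p * q) * s powr (Q - 1))"
      using slope_pos[OF xi] C_pos by (simp add: powr_mult powr_divide powr_powr mult_ac)
    also have "s powr (p * q) * s powr (Q - 1) = s powr q" using s by (simp add: powr_add[symmetric] q_props)
    finally show ?thesis using True by (simp add: \<sigma>_flow[OF xi True])
  qed simp
  have "J (\<lambda>x. \<sigma> x powr p) \<xi> = (\<integral>s. (slope \<xi> / C) powr p * (indicator {a<..<b} s * s powr q) \<partial>lborel)"
    unfolding J_def eq ..
  also have "\<dots> = (slope \<xi> / C) powr p * C" by (simp add: C_def)
  also have "\<dots> = slope \<xi> powr p * C powr (1 - p)"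
    using C_pos slope_pos[OF xi] by (simp add: powr_divide powr_diff)
  finally show ?thesis .
qed

definition I :: real where "I = (\<integral>x. \<sigma> x powr p \<partial>lborel)"

lemma \<sigma>_powr_le: "\<exists>M. \<forall>x. \<sigma> x powr p \<le> M"
proof -
  obtain M where M: "M \<ge> 0" "\<And>x. \<sigma> x \<le> M" by (rule \<sigma>_bounded) (rule that)
  have "\<sigma> x powr p \<le> M powr p" for x
    using M(2) \<sigma>_nonneg p_gt by (intro powr_mono2) auto
  then show ?thesis by (intro exI allI)
qed

lemma \<sigma>_powr_borel: "(\<lambda>x. \<sigma> x powr p) \<in> borel_measurable borel"
  by measurable

lemma \<sigma>_powr_zero: "x \<notin> R \<Longrightarrow> \<sigma> x powr p = 0"
  by (simp add: \<sigma>_def)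

text \<open>Polar coordinates split the energy of \<sigma> into the two factors of the theorem.
  Integrability over \<open>v\<close> is recorded because the lower bound needs the outer integral
  as a non-negative one as well.\<close>

lemma \<sigma>_powr_integrable: "integrable lborel (\<lambda>x. \<sigma> x powr p)"
  and slope_integrable: "integrable v (\<lambda>\<xi>. slope \<xi> powr p * C powr (1 - p))"
  and I_eq: "I = (\<integral>\<xi>. slope \<xi> powr p * C powr (1 - p) \<partial>v)"
proof -
  from \<sigma>_powr_le obtain M where M: "\<forall>x. \<sigma> x powr p \<le> M" ..
  then have le: "\<sigma> x powr p \<le> M" for x by (rule spec)
  have abs: "\<bar>\<sigma> x powr p\<bar> \<le> M" for x using le[of x] by (simp only: abs_of_nonneg[OF powr_ge_zero])
  show "integrable lborel (\<lambda>x. \<sigma> x powr p)" by (rule bounded_integrable[OF \<sigma>_powr_borel abs \<sigma>_powr_zero])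
  have "integrable v (J (\<lambda>x. \<sigma> x powr p))"
    by (rule J_v_integrable[OF \<sigma>_powr_borel powr_ge_zero le \<sigma>_powr_zero])
  moreover have "integrable v (J (\<lambda>x. \<sigma> x powr p)) \<longleftrightarrow> integrable v (\<lambda>\<xi>. slope \<xi> powr p * C powr (1 - p))"
    by (rule Bochner_Integration.integrable_cong[OF refl J_\<sigma>])
  ultimately show "integrable v (\<lambda>\<xi>. slope \<xi> powr p * C powr (1 - p))" by (simp only:)
  have "I = (\<integral>\<xi>. J (\<lambda>x. \<sigma> x powr p) \<xi> \<partial>v)"
    unfolding I_def by (rule polar_J[OF \<sigma>_powr_borel abs \<sigma>_powr_zero])
  moreover have "(\<integral>\<xi>. J (\<lambda>x. \<sigma> x powr p) \<xi> \<partial>v) = (\<integral>\<xi>. slope \<xi> powr p * C powr (1 - p) \<partial>v)"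
    by (rule Bochner_Integration.integral_cong[OF refl J_\<sigma>])
  ultimately show "I = (\<integral>\<xi>. slope \<xi> powr p * C powr (1 - p) \<partial>v)" by (rule trans)
qed

lemma I_lam: "I = (\<integral>\<xi>. lam m xs N \<phi> \<xi> powr p \<partial>v) * (LBINT s=a..b. s powr ((1 - Q) / (p - 1))) powr (1 - p)"
proof -
  have "(\<integral>\<xi>. lam m xs N \<phi> \<xi> powr p \<partial>v) = (\<integral>\<xi>. slope \<xi> powr p \<partial>v)"
    by (rule Bochner_Integration.integral_cong[OF refl]) (simp add: lam_eq)
  moreover have "I = (\<integral>\<xi>. slope \<xi> powr p \<partial>v) * C powr (1 - p)"
    unfolding I_eq by (rule integral_mult_left_zero)
  ultimately show ?thesis by (simp add: C_LBINT)
qed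

lemma I_nonneg: "I \<ge> 0"
  unfolding I_def by (intro Bochner_Integration.integral_nonneg) simp

lemma I_nn: "(\<integral>\<^sup>+ x. ennreal (\<sigma> x powr p) \<partial>lborel) = ennreal I"
  unfolding I_def by (rule nn_integral_eq_integral[OF \<sigma>_powr_integrable]) simp

text \<open>The function \<open>F\<close> changes by 1 between the two boundary spheres and has
  horizontal gradient of norm \<sigma> in the ring. The delicate point is absolute continuity of
  \<open>F\<close> along the curve: \<open>F\<close> is only locally Lipschitz, but the curve runs
  in a compact shell, on which one constant suffices.\<close>

lemma \<sigma>_admissible:
  assumes "(\<gamma>, \<alpha>, \<beta>) \<in> curve_family m xs N a b"
  shows "1 \<le> curve_int m xs (\<lambda>x. ennreal (\<sigma> x)) \<gamma> \<alpha> \<beta>"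
proof -
  have hc: "\<alpha> < \<beta>" "abs_cont_on {\<alpha>..\<beta>} \<gamma>"
    and ae: "AE t in lborel. t \<in> {\<alpha><..<\<beta>} \<longrightarrow> \<gamma> differentiable (at t) \<and>
        vector_derivative \<gamma> (at t) \<in> span (hvec m (\<gamma> t) ` set xs)"
    and ends: "(N (\<gamma> \<alpha>) = a \<and> N (\<gamma> \<beta>) = b) \<or> (N (\<gamma> \<alpha>) = b \<and> N (\<gamma> \<beta>) = a)"
    and inner: "\<And>t. t \<in> {\<alpha><..<\<beta>} \<Longrightarrow> \<gamma> t \<in> R"
    using assms by (auto simp: curve_family_def horizontal_curve_def R_def)
  obtain \<Phi> where \<Phi>: "\<And>s. s > 0 \<Longrightarrow> (\<Phi> has_real_derivative s powr q) (at s)" "C = \<Phi> b - \<Phi> a"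
    by (rule powr_antiderivative) (rule that)
  define F where "F = (\<lambda>x. \<Phi> (N x) / C)"
  define F' where "F' = (\<lambda>x h. N x powr q / C * (\<kappa> * N x / u x * Du x h))"
  have F': "(F has_derivative F' x) (at x)" if "x \<in> W" for x
  proof -
    have "((\<lambda>x. \<Phi> (N x)) has_derivative (\<lambda>h. N x powr q * (\<kappa> * N x / u x * Du x h))) (at x)"
      using has_derivative_compose[OF N_has_derivative[OF that] \<Phi>(1)[OF N_pos[OF that], unfolded has_field_derivative_def]]
      by simp
    from has_derivative_divide[OF this, of "\<lambda>_. C" "\<lambda>_. 0"] C_pos show ?thesis
      unfolding F_def F'_def by (auto intro!: derivative_eq_intros simp: field_simps elim!: has_derivative_eq_rhs)
  qed
  \<comment> \<open>The closed shell also contains the endpoints of the curve, which the open ring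
    leaves out.\<close>
  define S where "S = {x. a \<le> N x \<and> N x \<le> b}"
  have S: "compact S" "S \<subseteq> - {0}" using shell_compact[OF a_pos] a_pos by (auto simp: S_def normG_def)
  have \<gamma>S: "\<gamma> t \<in> S" if "t \<in> {\<alpha>..\<beta>}" for t
  proof (cases "t = \<alpha> \<or> t = \<beta>")
    case True
    then show ?thesis using ends ab by (auto simp: S_def)
  next
    case False
    then have "\<gamma> t \<in> R" using that by (intro inner) auto
    then show ?thesis by (simp add: S_def R_def)
  qed
  have loc: "\<exists>r>0. \<exists>L. L-lipschitz_on (cball x r) F" if x: "x \<noteq> 0" for x
  proof -
    define r where "r = norm x / 2"
    have r: "r > 0" "cball x r \<subseteq> - {0}" using x by (simp_all add: r_def)
    \<comment> \<open>Bounds the operator norm of \<open>F'\<close> and is continuous, hence bounded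
      on the ball; this gives the Lipschitz constant.\<close>
    define D where "D = (\<lambda>y. \<Sum>b\<in>Basis. \<bar>N y powr q / C * (\<kappa> * N y / u y) * dirD b u y\<bar>)"
    have "continuous_on (cball x r) D"
      unfolding D_def
    proof (intro continuous_on_sum continuous_on_rabs continuous_on_mult)
      have y: "isCont N y" "N y \<noteq> 0" "isCont u y" "u y \<noteq> 0" if "y \<in> cball x r" for y
      proof -
        have "y \<in> - {0}" using r(2) that by (rule subsetD)
        then have "y \<noteq> 0" "y \<in> W" by (simp_all add: W_eq)
        then show "isCont N y" "N y \<noteq> 0" "isCont u y" "u y \<noteq> 0"
          using N_isCont[of y] N_pos[of y] u_isCont[of y] u_nonzero[of y] by simp_all
      qed
      show "continuous_on (cball x r) (\<lambda>y. N y powr q / C)"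
      proof (rule continuous_at_imp_continuous_on, rule ballI)
        fix z assume "z \<in> cball x r"
        from y[OF this] C_pos show "isCont (\<lambda>y. N y powr q / C) z" by (intro continuous_intros) auto
      qed
      show "continuous_on (cball x r) (\<lambda>y. \<kappa> * N y / u y)"
      proof (rule continuous_at_imp_continuous_on, rule ballI)
        fix z assume "z \<in> cball x r"
        from y[OF this] show "isCont (\<lambda>y. \<kappa> * N y / u y) z" by (intro continuous_intros) auto
      qed
      show "continuous_on (cball x r) (dirD b u)" for b
        by (rule continuous_on_subset[OF smooth_on_continuous_on[OF smooth_on_dirD[OF u_smooth]] r(2)])
    qed
    then have "bounded (D ` cball x r)" by (intro compact_imp_bounded compact_continuous_image) auto
    then obtain L where "\<forall>y\<in>D ` cball x r. norm y \<le> L" unfolding bounded_iff ..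
    then have nL: "norm (D y) \<le> L" if "y \<in> cball x r" for y using imageI[OF that] by (rule bspec)
    have L: "D y \<le> L" "L \<ge> 0" if "y \<in> cball x r" for y
      using nL[OF that] unfolding real_norm_def by linarith+
    have "norm (F y - F z) \<le> L * norm (y - z)" if yz: "y \<in> cball x r" "z \<in> cball x r" for y z
    proof (rule differentiable_bound[OF convex_cball _ _ yz])
      fix w assume w: "w \<in> cball x r"
      have "w \<in> W" unfolding W_eq using r(2) w by (rule subsetD)
      then show "(F has_derivative F' w) (at w within cball x r)"
        by (rule has_derivative_at_withinI[OF F'])
      show "onorm (F' w) \<le> L"
      proof (rule onorm_le)
        fix h :: 'a
        define k where "k = N w powr q / C * (\<kappa> * N w / u w)"
        have F'k: "F' w h = (\<Sum>b\<in>Basis. k * dirD b u w * (h \<bullet> b))"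
          unfolding F'_def Du_def k_def[symmetric] sum_distrib_left mult.assoc[symmetric]
          by (simp add: k_def mult_ac)
        have "norm (F' w h) \<le> (\<Sum>b\<in>Basis. \<bar>k * dirD b u w\<bar> * norm h)"
          unfolding F'k real_norm_def
        proof (rule order_trans[OF sum_abs], rule sum_mono)
          fix b :: 'a assume b: "b \<in> Basis"
          show "\<bar>k * dirD b u w * (h \<bullet> b)\<bar> \<le> \<bar>k * dirD b u w\<bar> * norm h"
            by (subst abs_mult) (rule mult_left_mono[OF Basis_le_norm[OF b] abs_ge_zero])
        qed
        then have "norm (F' w h) \<le> D w * norm h" by (simp only: D_def k_def sum_distrib_right)
        then show "norm (F' w h) \<le> L * norm h"
          using L(1)[OF w] by (meson mult_right_mono norm_ge_zero order_trans)
      qed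
    qed
    moreover have "L \<ge> 0" using L(2)[of x] r(1) by simp
    ultimately have "L-lipschitz_on (cball x r) F" by (intro lipschitz_onI) (auto simp: dist_norm)
    with r(1) show ?thesis by blast
  qed
  \<comment> \<open>\<open>local_lipschitz\<close> is about families depending on time, so a
    constant family over the single time 0 stands in for \<open>F\<close>.\<close>
  have "local_lipschitz {0::real} S (\<lambda>_. F)"
  proof (rule local_lipschitzI)
    fix t :: real and x assume "x \<in> S"
    then have "x \<noteq> 0" using S(2) by auto
    from loc[OF this] obtain r L where "r > 0" "L-lipschitz_on (cball x r) F" by blast
    then show "\<exists>r>0. \<exists>L. \<forall>t\<in>cball t r \<inter> {0}. L-lipschitz_on (cball x r \<inter> S) F"
      by (intro exI[of _ r] conjI exI[of _ L] ballI) (auto intro: lipschitz_on_subset)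
  qed
  then obtain L where "\<And>t::real. t \<in> {0} \<Longrightarrow> L-lipschitz_on S F"
    by (rule local_lipschitz_compact_implies_lipschitz[OF _ S(1)]) auto
  then have L: "L-lipschitz_on S F" by blast
  have ac: "abs_cont_on {\<alpha>..\<beta>} (\<lambda>t. F (\<gamma> t))"
    by (rule abs_cont_on_lipschitz[OF hc(2) L]) (use \<gamma>S in auto)
  have "ennreal \<bar>F (\<gamma> \<beta>) - F (\<gamma> \<alpha>)\<bar> \<le>
      (\<integral>\<^sup>+ t\<in>{\<alpha>..\<beta>}. (ennreal (\<sigma> (\<gamma> t)) * ennreal (hnorm m xs (\<gamma> t) (vector_derivative \<gamma> (at t)))) \<partial>lborel)"
  proof (rule abs_cont_on_nn_integral_ge[OF hc(1) ac, where h'="\<lambda>t. F' (\<gamma> t) (vector_derivative \<gamma> (at t))"])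
    show "AE t in lborel. t \<in> {\<alpha><..<\<beta>} \<longrightarrow>
        ((\<lambda>t. F (\<gamma> t)) has_real_derivative F' (\<gamma> t) (vector_derivative \<gamma> (at t))) (at t) \<and>
        ennreal \<bar>F' (\<gamma> t) (vector_derivative \<gamma> (at t))\<bar>
        \<le> ennreal (\<sigma> (\<gamma> t)) * ennreal (hnorm m xs (\<gamma> t) (vector_derivative \<gamma> (at t)))"
      using ae
    proof (eventually_elim, intro impI)
      fix t assume t: "t \<in> {\<alpha><..<\<beta>}" and "t \<in> {\<alpha><..<\<beta>} \<longrightarrow> \<gamma> differentiable (at t) \<and>
        vector_derivative \<gamma> (at t) \<in> span (hvec m (\<gamma> t) ` set xs)"
      then have d: "(\<gamma> has_vector_derivative vector_derivative \<gamma> (at t)) (at t)"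
        and sp: "vector_derivative \<gamma> (at t) \<in> span (hvec m (\<gamma> t) ` set xs)"
        using vector_derivative_works by auto
      obtain c where c: "vector_derivative \<gamma> (at t) = (hcomb c (\<gamma> t))"
        using horizontal_span[OF sp] by blast
      define x where "x = \<gamma> t"
      have xR: "x \<in> R" using inner[OF t] by (simp add: x_def)
      then have xW: "x \<in> W" using R_subset W_eq by auto
      note Fd = F'[OF xW]
      note lin = has_derivative_linear[OF Fd]
      have 1: "((\<lambda>t. F (\<gamma> t)) has_real_derivative F' x (vector_derivative \<gamma> (at t))) (at t)"
        using has_derivative_compose[OF d[unfolded has_vector_derivative_def], of F "F' x"] Fd
        unfolding has_field_derivative_def x_def
        by (auto simp: linear_scale[OF lin[unfolded x_def]] mult.commute elim!: has_derivative_eq_rhs)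
      have FX: "F' x (hvec m x w) = N x powr q / C * Xf m w N x" for w
        using xW by (simp add: F'_def X_N X_u W_def)
      have "F' x (vector_derivative \<gamma> (at t)) = N x powr q / C * (\<Sum>i<length xs. c i * X i N x)"
        unfolding c x_def[symmetric] by (simp add: linear_sum[OF lin] linear_scale[OF lin] FX sum_distrib_left mult_ac)
      then have eq: "\<bar>F' x (vector_derivative \<gamma> (at t))\<bar> = N x powr q / C * \<bar>\<Sum>i<length xs. c i * X i N x\<bar>"
        using C_pos by (simp add: abs_mult)
      have "\<bar>\<Sum>i<length xs. c i * X i N x\<bar> \<le> (\<Sum>i<length xs. \<bar>c i\<bar> * \<bar>X i N x\<bar>)"
        unfolding abs_mult[symmetric] by (rule sum_abs)
      \<comment> \<open>Cauchy-Schwarz in horizontal coordinates: one factor is the speed of the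
        curve, the other is |grad N|.\<close>
      also have "\<dots> \<le> L2_set c {..<length xs} * L2_set (\<lambda>i. X i N x) {..<length xs}" by (rule L2_set_mult_ineq)
      also have "\<dots> = hnorm m xs x (vector_derivative \<gamma> (at t)) * sqrt (grad2 x)"
        unfolding c x_def[symmetric] by (simp add: hnorm_eq L2_set_def hgrad_sq_def)
      finally have "N x powr q / C * \<bar>\<Sum>i<length xs. c i * X i N x\<bar>
          \<le> N x powr q / C * (hnorm m xs x (vector_derivative \<gamma> (at t)) * sqrt (grad2 x))"
        using C_pos by (intro mult_left_mono) auto
      then have "\<bar>F' x (vector_derivative \<gamma> (at t))\<bar> \<le> \<sigma> x * hnorm m xs x (vector_derivative \<gamma> (at t))"
        unfolding eq using xR by (simp add: \<sigma>_def mult_ac)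
      then have "ennreal \<bar>F' x (vector_derivative \<gamma> (at t))\<bar> \<le> ennreal (\<sigma> x) * ennreal (hnorm m xs x (vector_derivative \<gamma> (at t)))"
        by (simp add: ennreal_mult'[symmetric] \<sigma>_nonneg ennreal_leI)
      with 1 show "((\<lambda>t. F (\<gamma> t)) has_real_derivative F' (\<gamma> t) (vector_derivative \<gamma> (at t))) (at t) \<and>
        ennreal \<bar>F' (\<gamma> t) (vector_derivative \<gamma> (at t))\<bar>
        \<le> ennreal (\<sigma> (\<gamma> t)) * ennreal (hnorm m xs (\<gamma> t) (vector_derivative \<gamma> (at t)))"
        unfolding x_def by blast
    qed
  qed
  moreover have "\<bar>F (\<gamma> \<beta>) - F (\<gamma> \<alpha>)\<bar> = 1"
    using ends C_pos \<Phi>(2) by (auto simp: F_def diff_divide_distrib[symmetric] abs_minus_commute[of "\<Phi> a"])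
  ultimately show ?thesis by (simp add: curve_int_def)
qed

end

section \<open>Radial curves and the lower bound for the modulus\<close>

context polar_modulus
begin

lemma radial_hnorm:
  assumes xi: "\<xi> \<in> space v" and s: "s > 0"
  shows "hnorm m xs (\<phi> s \<xi>) (vector_derivative (\<lambda>s. \<phi> s \<xi>) (at s)) = 1 / slope \<xi>"
proof -
  note x = space_vD(1,3)[OF xi]
  have "vector_derivative (\<lambda>s. \<phi> s \<xi>) (at s) = (hcomb (coef s \<xi>) (\<phi> s \<xi>))"
    by (rule vector_derivative_at[OF flow_deriv[OF x(1) s]])
  then have "hnorm m xs (\<phi> s \<xi>) (vector_derivative (\<lambda>s. \<phi> s \<xi>) (at s)) = sqrt ((N \<xi>)\<^sup>2 / grad2 \<xi>)"
    by (simp only: hnorm_eq coef_sq_sum[OF x s])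
  then show ?thesis by (simp add: space_vD(2)[OF xi] slope_def real_sqrt_divide)
qed

text \<open>Membership in the family needs absolute continuity, which comes from a Lipschitz bound:
  the coefficients of the velocity are at most \<open>1 / slope \<xi>\<close>, and the fields are
  bounded along the compact arc.\<close>

lemma radial_curve:
  assumes xi: "\<xi> \<in> space v"
  shows "((\<lambda>s. \<phi> s \<xi>), a, b) \<in> curve_family m xs N a b"
proof -
  note x = space_vD(1,3)[OF xi]
  note pos = less_le_trans[OF a_pos]
  have der: "((\<lambda>s. \<phi> s \<xi>) has_vector_derivative (hcomb (coef s \<xi>) (\<phi> s \<xi>))) (at s)"
    if "a \<le> s" for s
    by (rule flow_deriv[OF x(1) pos[OF that]])
  have cont: "continuous_on {a..b} (\<lambda>s. \<phi> s \<xi>)"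
    by (intro continuous_at_imp_continuous_on ballI flow_isCont[OF x(1)] pos) simp
  have "\<exists>h. \<forall>s\<in>{a..b}. norm (hvec m (\<phi> s \<xi>) w) \<le> h" for w
  proof -
    have "compact ((\<lambda>s. \<phi> s \<xi>) ` {a..b})" by (rule compact_continuous_image[OF cont]) simp
    then have "bounded ((\<lambda>y. hvec m y w) ` ((\<lambda>s. \<phi> s \<xi>) ` {a..b}))"
      by (rule compact_imp_bounded[OF compact_continuous_image[OF continuous_on_hvec]])
    then show ?thesis by (auto simp: bounded_iff)
  qed
  then obtain h where h: "\<And>w s. s \<in> {a..b} \<Longrightarrow> norm (hvec m (\<phi> s \<xi>) w) \<le> h w" by metis
  define L where "L = (\<Sum>i<length xs. 1 / slope \<xi> * \<bar>h (xs ! i)\<bar>)"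
  have L0: "L \<ge> 0" unfolding L_def using slope_pos[OF xi] by (intro sum_nonneg) simp
  have bnd: "norm (hcomb (coef s \<xi>) (\<phi> s \<xi>)) \<le> L" if s: "s \<in> {a..b}" for s
    unfolding L_def
  proof (rule sum_norm_le)
    have s0: "s > 0" using s a_pos by simp
    fix i assume i: "i \<in> {..<length xs}"
    have "(coef s \<xi> i)\<^sup>2 \<le> (\<Sum>i<length xs. (coef s \<xi> i)\<^sup>2)"
      by (rule member_le_sum) (use i in auto)
    also have "\<dots> = (1 / slope \<xi>)\<^sup>2"
      unfolding coef_sq_sum[OF x s0] space_vD(2)[OF xi] slope_def using grad2_nonneg[of \<xi>] by (simp add: power_divide)
    finally have "\<bar>coef s \<xi> i\<bar> \<le> 1 / slope \<xi>"
      using slope_pos[OF xi] by (simp add: abs_le_square_iff[symmetric])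
    then show "norm (coef s \<xi> i *\<^sub>R hvec m (\<phi> s \<xi>) (xs ! i)) \<le> 1 / slope \<xi> * \<bar>h (xs ! i)\<bar>"
      unfolding norm_scaleR using h[OF s, of "xs ! i"] slope_pos[OF xi] by (intro mult_mono) auto
  qed
  have lip: "L-lipschitz_on {a..b} (\<lambda>s. \<phi> s \<xi>)"
  proof (rule lipschitz_onI[OF _ L0])
    fix s t assume st: "s \<in> {a..b}" "t \<in> {a..b}"
    show "dist (\<phi> s \<xi>) (\<phi> t \<xi>) \<le> L * dist s t"
      unfolding dist_norm
    proof (rule differentiable_bound[OF convex_real_interval(5) _ _ st])
      fix r assume r: "r \<in> {a..b}"
      show "((\<lambda>s. \<phi> s \<xi>) has_derivative (\<lambda>h. h *\<^sub>R (hcomb (coef r \<xi>) (\<phi> r \<xi>)))) (at r within {a..b})"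
      proof (rule has_derivative_at_withinI)
        have "a \<le> r" using r by simp
        from der[OF this] show "((\<lambda>s. \<phi> s \<xi>) has_derivative (\<lambda>h. h *\<^sub>R (hcomb (coef r \<xi>) (\<phi> r \<xi>)))) (at r)"
          unfolding has_vector_derivative_def .
      qed
      show "onorm (\<lambda>h. h *\<^sub>R (hcomb (coef r \<xi>) (\<phi> r \<xi>))) \<le> L"
      proof (rule onorm_le)
        fix h :: real
        have "\<bar>h\<bar> * norm (hcomb (coef r \<xi>) (\<phi> r \<xi>)) \<le> \<bar>h\<bar> * L"
          by (rule mult_left_mono[OF bnd[OF r] abs_ge_zero])
        then show "norm (h *\<^sub>R (hcomb (coef r \<xi>) (\<phi> r \<xi>))) \<le> L * norm h"
          by (simp only: norm_scaleR real_norm_def mult.commute)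
      qed
    qed
  qed
  \<comment> \<open>The flow line is seen as a Lipschitz map applied to the identity curve, so that
    \<open>abs_cont_on_lipschitz\<close> fits.\<close>
  have "abs_cont_on {a..b} (\<lambda>t. t)"
    unfolding abs_cont_on_def
  proof (intro allI impI)
    fix e :: real assume e: "e > 0"
    show "\<exists>\<delta>>0. \<forall>D. nonoverlapping {a..b} \<delta> D \<longrightarrow> (\<Sum>(s, t)\<in>D. norm (t - s)) < e"
    proof (rule exI[of _ e], rule conjI[OF e], rule allI, rule impI, elim conjE)
      fix D :: "(real \<times> real) set"
      assume D: "\<forall>(s, t)\<in>D. s \<le> t \<and> {s..t} \<subseteq> {a..b}" and less: "(\<Sum>(s, t)\<in>D. t - s) < e"
      have "(\<Sum>(s, t)\<in>D. norm (t - s)) = (\<Sum>(s, t)\<in>D. t - s)"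
      proof (rule sum.cong[OF refl], clarify)
        fix s t assume "(s, t) \<in> D"
        with D have "s \<le> t" by blast
        then show "norm (t - s) = t - s" by simp
      qed
      then show "(\<Sum>(s, t)\<in>D. norm (t - s)) < e" using less by (simp only:)
    qed
  qed
  from this lip have ac: "abs_cont_on {a..b} (\<lambda>s. \<phi> s \<xi>)" by (rule abs_cont_on_lipschitz)
  have horiz: "horizontal_curve m xs (\<lambda>s. \<phi> s \<xi>) a b"
    unfolding horizontal_curve_def
  proof (intro conjI ab ac AE_I2 impI)
    fix s assume "s \<in> {a<..<b}"
    then have "a \<le> s" by simp
    note d = der[OF this]
    show "(\<lambda>s. \<phi> s \<xi>) differentiable (at s)"
      using d unfolding has_vector_derivative_def differentiable_def by blast
    show "vector_derivative (\<lambda>s. \<phi> s \<xi>) (at s) \<in> span (hvec m (\<phi> s \<xi>) ` set xs)"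
      unfolding vector_derivative_at[OF d]
      by (intro span_sum span_scale span_base imageI nth_mem) simp
  qed
  have "curve_int m xs (\<lambda>_. 1) (\<lambda>s. \<phi> s \<xi>) a b \<le> (\<integral>\<^sup>+ s. ennreal (1 / slope \<xi>) * indicator {a..b} s \<partial>lborel)"
    unfolding curve_int_def
  proof (rule nn_integral_mono)
    fix s
    show "1 * ennreal (hnorm m xs (\<phi> s \<xi>) (vector_derivative (\<lambda>s. \<phi> s \<xi>) (at s))) * indicator {a..b} s
        \<le> ennreal (1 / slope \<xi>) * indicator {a..b} s"
    proof (cases "s \<in> {a..b}")
      case True
      then have "a \<le> s" by simp
      show ?thesis unfolding radial_hnorm[OF xi pos[OF \<open>a \<le> s\<close>]] by simp
    next
      case False
      then show ?thesis by simp
    qed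
  qed
  also have "\<dots> < \<infinity>" using ab by (simp add: nn_integral_cmult_indicator ennreal_mult_less_top)
  finally have fin: "curve_int m xs (\<lambda>_. 1) (\<lambda>s. \<phi> s \<xi>) a b < \<infinity>" .
  have Ns: "N (\<phi> s \<xi>) = s" if "a \<le> s" for s by (rule flow_in_R(1)[OF xi pos[OF that]])
  show ?thesis
    unfolding curve_family_def using horiz fin Ns ab by simp
qed

text \<open>The length element of a radial curve is \<open>ds\<close> divided by the slope, so
  admissibility becomes a bound for an integral in \<open>s\<close> alone. The endpoints form a null
  set, and between them the clamped flow is the flow itself.\<close>

lemma slope_le_flow_integral:
  assumes \<rho> [measurable]: "\<rho> \<in> borel_measurable borel" and xi: "\<xi> \<in> space v"
    and adm: "1 \<le> curve_int m xs \<rho> (\<lambda>s. \<phi> s \<xi>) a b"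
  shows "ennreal (slope \<xi>) \<le> (\<integral>\<^sup>+ s. indicator {a<..<b} s * \<rho> (\<phi> s \<xi>) \<partial>lborel)"
proof -
  have [measurable]: "(\<lambda>s. \<rho> (\<phi> (max a (min b s)) \<xi>)) \<in> borel_measurable borel"
    by (rule flow_measurable[OF space_vD(1)[OF xi] \<rho>])
  have eq: "(\<integral>\<^sup>+ s. indicator {a<..<b} s * \<rho> (\<phi> s \<xi>) \<partial>lborel) = (\<integral>\<^sup>+ s. indicator {a<..<b} s * \<rho> (\<phi> (max a (min b s)) \<xi>) \<partial>lborel)"
    by (rule nn_integral_cong) (auto simp: indicator_def)
  have "AE s in lborel. s \<noteq> a \<and> s \<noteq> b" using AE_lborel_singleton[of a] AE_lborel_singleton[of b] by eventually_elim simp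
  then have ae: "AE s in lborel. \<rho> (\<phi> s \<xi>) * ennreal (hnorm m xs (\<phi> s \<xi>) (vector_derivative (\<lambda>s. \<phi> s \<xi>) (at s))) * indicator {a..b} s
      = ennreal (1 / slope \<xi>) * (indicator {a<..<b} s * \<rho> (\<phi> (max a (min b s)) \<xi>))"
  proof eventually_elim
    fix s assume s: "s \<noteq> a \<and> s \<noteq> b"
    show "\<rho> (\<phi> s \<xi>) * ennreal (hnorm m xs (\<phi> s \<xi>) (vector_derivative (\<lambda>s. \<phi> s \<xi>) (at s))) * indicator {a..b} s
      = ennreal (1 / slope \<xi>) * (indicator {a<..<b} s * \<rho> (\<phi> (max a (min b s)) \<xi>))"
    proof (cases "s \<in> {a<..<b}")
      case True
      then have "s > 0" using a_pos by simp
      from radial_hnorm[OF xi this] True show ?thesis by (simp add: mult.commute)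
    next
      case False
      then have "s \<notin> {a..b}" using s by auto
      then show ?thesis using False by simp
    qed
  qed
  have "curve_int m xs \<rho> (\<lambda>s. \<phi> s \<xi>) a b = (\<integral>\<^sup>+ s. ennreal (1 / slope \<xi>) * (indicator {a<..<b} s * \<rho> (\<phi> (max a (min b s)) \<xi>)) \<partial>lborel)"
    unfolding curve_int_def by (rule nn_integral_cong_AE[OF ae])
  also have "\<dots> = ennreal (1 / slope \<xi>) * (\<integral>\<^sup>+ s. indicator {a<..<b} s * \<rho> (\<phi> s \<xi>) \<partial>lborel)"
    unfolding eq by (rule nn_integral_cmult) measurable
  finally have "ennreal (slope \<xi>) * 1 \<le> ennreal (slope \<xi>) * (ennreal (1 / slope \<xi>) * (\<integral>\<^sup>+ s. indicator {a<..<b} s * \<rho> (\<phi> s \<xi>) \<partial>lborel))"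
    using adm by (intro mult_left_mono) auto
  also have "\<dots> = (\<integral>\<^sup>+ s. indicator {a<..<b} s * \<rho> (\<phi> s \<xi>) \<partial>lborel)"
    using slope_pos[OF xi] by (simp add: mult.assoc[symmetric] ennreal_mult'[symmetric])
  finally show ?thesis by simp
qed

definition trunc :: "('a \<Rightarrow> ennreal) \<Rightarrow> nat \<Rightarrow> 'a \<Rightarrow> real" where
  "trunc \<rho> n x = enn2real (min (\<rho> x) (of_nat n))"

lemma trunc_props:
  shows "trunc \<rho> n x \<ge> 0" "trunc \<rho> n x \<le> real n" "ennreal (trunc \<rho> n x) = min (\<rho> x) (of_nat n)"
    "\<rho> \<in> borel_measurable borel \<Longrightarrow> trunc \<rho> n \<in> borel_measurable borel"
proof -
  have fin: "min (\<rho> x) (of_nat n) < top" by (rule le_less_trans[OF min.cobounded2]) (simp add: of_nat_less_top)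
  show "trunc \<rho> n x \<ge> 0" by (simp add: trunc_def)
  show e: "ennreal (trunc \<rho> n x) = min (\<rho> x) (of_nat n)"
    unfolding trunc_def using fin by simp
  have "ennreal (trunc \<rho> n x) \<le> ennreal (real n)" unfolding e by (simp add: ennreal_of_nat_eq_real_of_nat)
  then show "trunc \<rho> n x \<le> real n" by simp
  show "trunc \<rho> n \<in> borel_measurable borel" if [measurable]: "\<rho> \<in> borel_measurable borel"
    unfolding trunc_def[abs_def] by measurable
qed

lemma SUP_min_of_nat: "(SUP n. min x (of_nat n)) = (x :: ennreal)"
proof -
  have "(SUP n. inf x (of_nat n)) = inf x (SUP n. of_nat n)" by (rule inf_SUP[symmetric])
  then show ?thesis by (simp add: ennreal_SUP_of_nat_eq_top inf_min)
qed

text \<open>The mixed term of \<open>powr_tangent_le\<close> with \<open>k = \<sigma> x\<close>;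
  truncation of \<rho> makes it bounded, as \<open>polar_J\<close> requires.\<close>

definition pairing :: "('a \<Rightarrow> ennreal) \<Rightarrow> nat \<Rightarrow> 'a \<Rightarrow> real" where
  "pairing \<rho> n x = \<sigma> x powr (p - 1) * trunc \<rho> n x"

lemma pairing_props:
  assumes \<rho>: "\<rho> \<in> borel_measurable borel"
  shows "pairing \<rho> n \<in> borel_measurable borel" "0 \<le> pairing \<rho> n x" "x \<notin> R \<Longrightarrow> pairing \<rho> n x = 0"
    "\<exists>M. \<forall>x. pairing \<rho> n x \<le> M"
proof -
  have [measurable]: "trunc \<rho> n \<in> borel_measurable borel" by (rule trunc_props(4)[OF \<rho>])
  show "pairing \<rho> n \<in> borel_measurable borel" unfolding pairing_def[abs_def] by measurable
  show "0 \<le> pairing \<rho> n x" unfolding pairing_def using trunc_props(1) by (intro mult_nonneg_nonneg) auto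
  show "x \<notin> R \<Longrightarrow> pairing \<rho> n x = 0" by (simp add: pairing_def \<sigma>_def)
  obtain M where M: "M \<ge> 0" "\<And>x. \<sigma> x \<le> M" by (rule \<sigma>_bounded) (rule that)
  have "pairing \<rho> n x \<le> M powr (p - 1) * real n" for x
    unfolding pairing_def using M \<sigma>_nonneg p_gt trunc_props(1,2)
    by (intro mult_mono powr_mono2) auto
  then show "\<exists>M. \<forall>x. pairing \<rho> n x \<le> M" by (intro exI allI)
qed

text \<open>By the choice of \<open>q\<close> all powers of \<open>s\<close> cancel, so the radial
  integral of the truncated density appears without weight, and only powers of the slope and of
  \<open>C\<close> stay as factors.\<close>

lemma J_pairing:
  assumes \<rho>: "\<rho> \<in> borel_measurable borel" and xi: "\<xi> \<in> space v"
  shows "ennreal (J (pairing \<rho> n) \<xi>) = ennreal (slope \<xi> powr (p - 1) * C powr (1 - p)) *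
    (\<integral>\<^sup>+ s. indicator {a<..<b} s * min (\<rho> (\<phi> s \<xi>)) (of_nat n) \<partial>lborel)"
proof -
  note pr = pairing_props[OF \<rho>, where n=n]
  from pr(4) obtain M where "\<forall>x. pairing \<rho> n x \<le> M" ..
  then have abs: "\<bar>pairing \<rho> n x\<bar> \<le> M" for x using pr(2)[of x] by (simp only: abs_of_nonneg)
  have flow_eq: "ennreal (indicator {a<..<b} s * (pairing \<rho> n (\<phi> s \<xi>) * s powr (Q - 1))) =
      ennreal (slope \<xi> powr (p - 1) * C powr (1 - p)) * (indicator {a<..<b} s * min (\<rho> (\<phi> s \<xi>)) (of_nat n))" for s
  proof (cases "s \<in> {a<..<b}")
    case True
    then have s: "s > 0" using a_pos by simp
    have "(slope \<xi> * s powr q / C) powr (p - 1) * s powr (Q - 1)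
        = slope \<xi> powr (p - 1) / C powr (p - 1) * (s powr ((p - 1) * q) * s powr (Q - 1))"
      using slope_pos[OF xi] C_pos by (simp add: powr_mult powr_divide powr_powr mult_ac)
    also have "s powr ((p - 1) * q) * s powr (Q - 1) = 1"
      using s by (simp only: powr_add[symmetric] q_props(1)) simp
    also have "slope \<xi> powr (p - 1) / C powr (p - 1) * 1 = slope \<xi> powr (p - 1) * C powr (1 - p)"
      using powr_minus_divide[of C "p - 1"] by simp
    finally have "pairing \<rho> n (\<phi> s \<xi>) * s powr (Q - 1) = slope \<xi> powr (p - 1) * C powr (1 - p) * trunc \<rho> n (\<phi> s \<xi>)"
      by (simp add: pairing_def \<sigma>_flow[OF xi True] mult_ac)
    then show ?thesis using True by (simp add: ennreal_mult' trunc_props(1,3) mult_ac)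
  qed simp
  have [measurable]: "(\<lambda>s. \<rho> (\<phi> (max a (min b s)) \<xi>)) \<in> borel_measurable borel"
    by (rule flow_measurable[OF space_vD(1)[OF xi] \<rho>])
  have clamp: "(\<integral>\<^sup>+ s. K * (indicator {a<..<b} s * min (\<rho> (\<phi> s \<xi>)) (of_nat n)) \<partial>lborel)
      = (\<integral>\<^sup>+ s. K * (indicator {a<..<b} s * min (\<rho> (\<phi> (max a (min b s)) \<xi>)) (of_nat n)) \<partial>lborel)" for K :: ennreal
    by (rule nn_integral_cong) (auto simp: indicator_def)
  have "ennreal (J (pairing \<rho> n) \<xi>) = (\<integral>\<^sup>+ s. ennreal (indicator {a<..<b} s * (pairing \<rho> n (\<phi> s \<xi>) * s powr (Q - 1))) \<partial>lborel)"
    unfolding J_def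
    by (rule nn_integral_eq_integral[symmetric, OF J_integrable[OF space_vD(1)[OF xi] pr(1) abs]])
       (intro AE_I2 mult_nonneg_nonneg pr(2); simp)
  also have "\<dots> = ennreal (slope \<xi> powr (p - 1) * C powr (1 - p)) *
      (\<integral>\<^sup>+ s. indicator {a<..<b} s * min (\<rho> (\<phi> (max a (min b s)) \<xi>)) (of_nat n) \<partial>lborel)"
    unfolding flow_eq clamp by (rule nn_integral_cmult) measurable
  finally show ?thesis using clamp[of 1] by simp
qed

text \<open>The truncations keep every integrand bounded, so that the polar formula applies;
  monotone convergence then recovers the density itself.\<close>

lemma I_le_SUP_pairing:
  assumes \<rho> [measurable]: "\<rho> \<in> borel_measurable borel"
    and adm: "\<And>\<xi>. \<xi> \<in> space v \<Longrightarrow> 1 \<le> curve_int m xs \<rho> (\<lambda>s. \<phi> s \<xi>) a b"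
  shows "ennreal I \<le> (SUP n. ennreal (\<integral>x. pairing \<rho> n x \<partial>lborel))"
proof -
  have int: "integrable v (J (pairing \<rho> n))" and eq: "(\<integral>x. pairing \<rho> n x \<partial>lborel) = (\<integral>\<xi>. J (pairing \<rho> n) \<xi> \<partial>v)" for n
  proof -
    note pr = pairing_props[OF \<rho>, where n=n]
    from pr(4) obtain M where "\<forall>x. pairing \<rho> n x \<le> M" ..
    then have le: "pairing \<rho> n x \<le> M" for x by (rule spec)
    then have abs: "\<bar>pairing \<rho> n x\<bar> \<le> M" for x using pr(2)[of x] by (simp only: abs_of_nonneg)
    show "integrable v (J (pairing \<rho> n))" by (rule J_v_integrable[OF pr(1,2) le pr(3)])
    show "(\<integral>x. pairing \<rho> n x \<partial>lborel) = (\<integral>\<xi>. J (pairing \<rho> n) \<xi> \<partial>v)" by (rule polar_J[OF pr(1) abs pr(3)])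
  qed
  have J0: "0 \<le> J (pairing \<rho> n) \<xi>" for n \<xi>
    unfolding J_def by (intro Bochner_Integration.integral_nonneg mult_nonneg_nonneg pairing_props(2)[OF \<rho>]) auto
  define G where "G = (\<lambda>n \<xi>. ennreal (slope \<xi> powr (p - 1) * C powr (1 - p)) *
    (\<integral>\<^sup>+ s. indicator {a<..<b} s * min (\<rho> (\<phi> s \<xi>)) (of_nat n) \<partial>lborel))"
  have JG: "ennreal (J (pairing \<rho> n) \<xi>) = G n \<xi>" if "\<xi> \<in> space v" for n \<xi>
    unfolding G_def by (rule J_pairing[OF \<rho> that])
  \<comment> \<open>No regularity of the flow in \<xi> is directly at hand; measurability in \<xi>
    is inherited from the integrability of \<open>J\<close> over \<open>v\<close>.\<close>
  have Gm: "G n \<in> borel_measurable v" for n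
  proof -
    have "(\<lambda>\<xi>. ennreal (J (pairing \<rho> n) \<xi>)) \<in> borel_measurable v"
      using borel_measurable_integrable[OF int[of n]] by measurable
    then show ?thesis using measurable_cong[of v "\<lambda>\<xi>. ennreal (J (pairing \<rho> n) \<xi>)" "G n" borel] JG by blast
  qed
  have Ginc: "incseq G"
  proof (intro incseq_SucI le_funI)
    fix n \<xi>
    have "min (\<rho> (\<phi> s \<xi>)) (of_nat n) \<le> min (\<rho> (\<phi> s \<xi>)) (of_nat (Suc n))" for s
      by (intro min.mono order_refl) (simp add: ennreal_of_nat_eq_real_of_nat)
    then show "G n \<xi> \<le> G (Suc n) \<xi>"
      unfolding G_def by (intro mult_left_mono nn_integral_mono) auto
  qed
  have "ennreal I = (\<integral>\<^sup>+ \<xi>. ennreal (slope \<xi> powr p * C powr (1 - p)) \<partial>v)"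
    unfolding I_eq by (rule nn_integral_eq_integral[symmetric, OF slope_integrable]) simp
  also have "\<dots> \<le> (\<integral>\<^sup>+ \<xi>. (SUP n. G n \<xi>) \<partial>v)"
  proof (rule nn_integral_mono)
    fix \<xi> assume xi: "\<xi> \<in> space v"
    have [measurable]: "(\<lambda>s. \<rho> (\<phi> (max a (min b s)) \<xi>)) \<in> borel_measurable borel"
      by (rule flow_measurable[OF space_vD(1)[OF xi] \<rho>])
    have clamp: "(\<integral>\<^sup>+ s. indicator {a<..<b} s * min (\<rho> (\<phi> s \<xi>)) (of_nat n) \<partial>lborel)
      = (\<integral>\<^sup>+ s. indicator {a<..<b} s * min (\<rho> (\<phi> (max a (min b s)) \<xi>)) (of_nat n) \<partial>lborel)" for n
      by (rule nn_integral_cong) (auto simp: indicator_def)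
    have "(\<integral>\<^sup>+ s. indicator {a<..<b} s * \<rho> (\<phi> s \<xi>) \<partial>lborel) =
        (\<integral>\<^sup>+ s. (SUP n. indicator {a<..<b} s * min (\<rho> (\<phi> (max a (min b s)) \<xi>)) (of_nat n)) \<partial>lborel)"
      by (rule nn_integral_cong) (auto simp: indicator_def SUP_min_of_nat)
    also have "\<dots> = (SUP n. (\<integral>\<^sup>+ s. indicator {a<..<b} s * min (\<rho> (\<phi> (max a (min b s)) \<xi>)) (of_nat n) \<partial>lborel))"
    proof (rule nn_integral_monotone_convergence_SUP)
      show "incseq (\<lambda>n s. indicator {a<..<b} s * min (\<rho> (\<phi> (max a (min b s)) \<xi>)) (of_nat n) :: ennreal)"
        by (intro incseq_SucI le_funI mult_left_mono min.mono order_refl) (simp_all add: ennreal_of_nat_eq_real_of_nat)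
    qed measurable
    finally have sup: "(SUP n. G n \<xi>) = ennreal (slope \<xi> powr (p - 1) * C powr (1 - p)) *
        (\<integral>\<^sup>+ s. indicator {a<..<b} s * \<rho> (\<phi> s \<xi>) \<partial>lborel)"
      unfolding G_def clamp SUP_mult_left_ennreal[symmetric] by (simp only:)
    \<comment> \<open>One power of the slope is supplied by admissibility, the others by
      \<open>\<sigma> powr (p - 1)\<close>.\<close>
    have "slope \<xi> powr p = slope \<xi> powr (p - 1) * slope \<xi>"
      using slope_pos[OF xi] powr_add[of "slope \<xi>" "p - 1" 1] by simp
    then have "ennreal (slope \<xi> powr p * C powr (1 - p)) = ennreal (slope \<xi> powr (p - 1) * C powr (1 - p)) * ennreal (slope \<xi>)"
      using slope_pos[OF xi] by (simp add: ennreal_mult'[symmetric] mult_ac)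
    also have "\<dots> \<le> (SUP n. G n \<xi>)"
      unfolding sup by (intro mult_left_mono slope_le_flow_integral[OF \<rho> xi adm[OF xi]]) simp
    finally show "ennreal (slope \<xi> powr p * C powr (1 - p)) \<le> (SUP n. G n \<xi>)" .
  qed
  also have "\<dots> = (SUP n. \<integral>\<^sup>+ \<xi>. G n \<xi> \<partial>v)"
    by (rule nn_integral_monotone_convergence_SUP[OF Ginc Gm])
  also have "\<dots> = (SUP n. ennreal (\<integral>x. pairing \<rho> n x \<partial>lborel))"
  proof (rule SUP_cong[OF refl])
    fix n
    have "(\<integral>\<^sup>+ \<xi>. G n \<xi> \<partial>v) = (\<integral>\<^sup>+ \<xi>. ennreal (J (pairing \<rho> n) \<xi>) \<partial>v)"
      by (rule nn_integral_cong) (rule JG[symmetric])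
    also have "\<dots> = ennreal (\<integral>\<xi>. J (pairing \<rho> n) \<xi> \<partial>v)"
      by (rule nn_integral_eq_integral[OF int]) (simp add: J0)
    finally show "(\<integral>\<^sup>+ \<xi>. G n \<xi> \<partial>v) = ennreal (\<integral>x. pairing \<rho> n x \<partial>lborel)" unfolding eq .
  qed
  finally show ?thesis .
qed

text \<open>Integrates the tangent inequality at \<sigma> over the group; the truncated density has
  at most the energy of \<rho>.\<close>

lemma pairing_le_energy:
  assumes \<rho>: "\<rho> \<in> borel_measurable borel"
  shows "ennreal p * ennreal (\<integral>x. pairing \<rho> n x \<partial>lborel) \<le> (\<integral>\<^sup>+ x. epow (\<rho> x) p \<partial>lborel) + ennreal ((p - 1) * I)"
proof -
  note pr = pairing_props[OF \<rho>, where n=n]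
  from pr(4) obtain M where "\<forall>x. pairing \<rho> n x \<le> M" ..
  then have abs: "\<bar>pairing \<rho> n x\<bar> \<le> M" for x using pr(2)[of x] by (simp only: abs_of_nonneg)
  have [measurable]: "trunc \<rho> n \<in> borel_measurable borel" by (rule trunc_props(4)[OF \<rho>])
  note [measurable] = pr(1)
  have le: "ennreal (trunc \<rho> n x powr p) \<le> epow (\<rho> x) p" for x
  proof (cases "\<rho> x = \<infinity>")
    case False
    have "ennreal (trunc \<rho> n x) \<le> ennreal (enn2real (\<rho> x))"
      unfolding trunc_props(3) using False by (simp add: less_top)
    then have "trunc \<rho> n x \<le> enn2real (\<rho> x)" by simp
    then have "trunc \<rho> n x powr p \<le> enn2real (\<rho> x) powr p"
      using p_gt trunc_props(1) by (intro powr_mono2) auto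
    then show ?thesis using False by (simp add: epow_def ennreal_leI)
  qed (simp add: epow_def)
  have "ennreal p * ennreal (\<integral>x. pairing \<rho> n x \<partial>lborel) = ennreal p * (\<integral>\<^sup>+ x. ennreal (pairing \<rho> n x) \<partial>lborel)"
    by (subst nn_integral_eq_integral[OF bounded_integrable[OF pr(1) abs pr(3)]]) (simp_all add: pr(2))
  also have "\<dots> = (\<integral>\<^sup>+ x. ennreal p * ennreal (pairing \<rho> n x) \<partial>lborel)"
    by (rule nn_integral_cmult[symmetric]) measurable
  also have "\<dots> \<le> (\<integral>\<^sup>+ x. ennreal (trunc \<rho> n x powr p) + ennreal (p - 1) * ennreal (\<sigma> x powr p) \<partial>lborel)"
  proof (rule nn_integral_mono)
    fix x
    have "ennreal p * ennreal (pairing \<rho> n x) = ennreal (p * (\<sigma> x powr (p - 1) * trunc \<rho> n x))"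
      using p_gt by (simp add: pairing_def ennreal_mult'[symmetric])
    also have "\<dots> \<le> ennreal (trunc \<rho> n x powr p + (p - 1) * \<sigma> x powr p)"
      by (rule ennreal_leI[OF powr_tangent_le[OF p_gt trunc_props(1) \<sigma>_nonneg]])
    also have "\<dots> = ennreal (trunc \<rho> n x powr p) + ennreal (p - 1) * ennreal (\<sigma> x powr p)"
      using p_gt by (simp add: ennreal_mult'[symmetric])
    finally show "ennreal p * ennreal (pairing \<rho> n x) \<le> ennreal (trunc \<rho> n x powr p) + ennreal (p - 1) * ennreal (\<sigma> x powr p)" .
  qed
  also have "\<dots> = (\<integral>\<^sup>+ x. ennreal (trunc \<rho> n x powr p) \<partial>lborel) + ennreal (p - 1) * (\<integral>\<^sup>+ x. ennreal (\<sigma> x powr p) \<partial>lborel)"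
    by (subst nn_integral_add) (auto simp: nn_integral_cmult)
  also have "\<dots> \<le> (\<integral>\<^sup>+ x. epow (\<rho> x) p \<partial>lborel) + ennreal ((p - 1) * I)"
    unfolding I_nn using p_gt I_nonneg by (intro add_mono nn_integral_mono le) (simp add: ennreal_mult')
  finally show ?thesis .
qed

theorem modulus_eq_I: "modulus m xs p (curve_family m xs N a b) = ennreal I"
proof (rule antisym)
  have "modulus m xs p (curve_family m xs N a b) \<le> (\<integral>\<^sup>+ x. epow (ennreal (\<sigma> x)) p \<partial>lborel)"
    unfolding modulus_def
  proof (rule INF_lower, rule CollectI, rule conjI)
    show "(\<lambda>x. ennreal (\<sigma> x)) \<in> borel_measurable borel" by measurable
    show "\<forall>(\<gamma>, \<alpha>, \<beta>)\<in>curve_family m xs N a b. 1 \<le> curve_int m xs (\<lambda>x. ennreal (\<sigma> x)) \<gamma> \<alpha> \<beta>"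
      using \<sigma>_admissible by blast
  qed
  also have "\<dots> = ennreal I"
    unfolding I_nn[symmetric] by (rule nn_integral_cong) (simp add: epow_def \<sigma>_nonneg)
  finally show "modulus m xs p (curve_family m xs N a b) \<le> ennreal I" .
  show "ennreal I \<le> modulus m xs p (curve_family m xs N a b)"
    unfolding modulus_def
  proof (rule INF_greatest, elim CollectE conjE)
    fix \<rho> :: "'a \<Rightarrow> ennreal"
    assume \<rho>: "\<rho> \<in> borel_measurable borel"
      and adm: "\<forall>(\<gamma>, \<alpha>, \<beta>)\<in>curve_family m xs N a b. 1 \<le> curve_int m xs \<rho> \<gamma> \<alpha> \<beta>"
    \<comment> \<open>Testing \<rho> on the radial curves alone already gives the sharp
      bound.\<close>
    have adm': "1 \<le> curve_int m xs \<rho> (\<lambda>s. \<phi> s \<xi>) a b" if "\<xi> \<in> space v" for \<xi>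
      using bspec[OF adm radial_curve[OF that]] by simp
    define P where "P = (\<integral>\<^sup>+ x. epow (\<rho> x) p \<partial>lborel)"
    have "ennreal p * ennreal I \<le> ennreal p * (SUP n. ennreal (\<integral>x. pairing \<rho> n x \<partial>lborel))"
      by (intro mult_left_mono I_le_SUP_pairing[OF \<rho> adm']) auto
    also have "\<dots> = (SUP n. ennreal p * ennreal (\<integral>x. pairing \<rho> n x \<partial>lborel))"
      by (rule SUP_mult_left_ennreal)
    also have "\<dots> \<le> P + ennreal ((p - 1) * I)"
      unfolding P_def by (rule SUP_least) (rule pairing_le_energy[OF \<rho>])
    finally have main: "ennreal p * ennreal I \<le> P + ennreal ((p - 1) * I)" .
    \<comment> \<open>Since \<open>I\<close> is finite, \<open>(p - 1) * I\<close> can be subtracted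
      from both sides of \<open>main\<close>, which leaves \<open>I\<close> below \<open>P\<close>;
      for infinite \<open>P\<close> there is nothing to show.\<close>
    show "ennreal I \<le> (\<integral>\<^sup>+ x. epow (\<rho> x) p \<partial>lborel)"
      unfolding P_def[symmetric]
    proof (cases P)
      case (real c)
      moreover have "ennreal p * ennreal I = ennreal (p * I)"
        using p_gt by (simp add: ennreal_mult')
      moreover have "ennreal c + ennreal ((p - 1) * I) = ennreal (c + (p - 1) * I)"
        using real p_gt I_nonneg by (intro ennreal_plus[symmetric]) auto
      ultimately have "ennreal (p * I) \<le> ennreal (c + (p - 1) * I)"
        using main by (simp only:)
      moreover have "0 \<le> c + (p - 1) * I" using real p_gt I_nonneg by simp
      ultimately have "p * I \<le> c + (p - 1) * I" by (simp only: ennreal_le_iff)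
      then show "ennreal I \<le> P" using real by (simp add: left_diff_distrib ennreal_leI)
    qed simp
  qed
qed

theorem modulus_formula:
  "modulus m xs p (curve_family m xs N a b) =
    ennreal ((\<integral>\<xi>. lam m xs N \<phi> \<xi> powr p \<partial>v) * (LBINT s=a..b. s powr ((1 - Q) / (p - 1))) powr (1 - p))"
  using modulus_eq_I by (simp only: I_lam)

end

theorem theorem4p8:
  fixes m :: "'a::euclidean_space \<Rightarrow> 'a \<Rightarrow> 'a"
    and V :: "nat \<Rightarrow> 'a set" and l :: nat and xs :: "'a list"
    and u :: "'a \<Rightarrow> real" and \<phi> :: "real \<Rightarrow> 'a \<Rightarrow> 'a" and v :: "'a measure"
    and a b p :: real
  defines "Q \<equiv> real (hdim V l)"
  defines "N \<equiv> normG Q u"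
  defines "Z \<equiv> Zset m xs N"
  assumes "carnot_group m V l xs"
    and "Q > 2"
    and "fundamental_solution m V l xs u"
    and "polarizable m xs N"
    and "radial_flow m xs N \<phi>"
    and "polar_measure N Z \<phi> Q v"
    and "0 < a" and "a < b" and "p > 1"
  shows "modulus m xs p (curve_family m xs N a b) =
           ennreal ((\<integral>\<xi>. lam m xs N \<phi> \<xi> powr p \<partial>v) *
                    (LBINT s=a..b. s powr ((1 - Q) / (p - 1))) powr (1 - p))"
proof -
  interpret polar_modulus m V l xs u \<phi> v a b p
    by unfold_locales (fact assms[unfolded Z_def N_def Q_def])+
  show ?thesis
    unfolding N_def Q_def by (rule modulus_formula)
qed

end
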